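(* Let $N\ge2$ and let $f(z)=\sum_{k=0}^N a_k z^k$ be a random complex polynomial whose coefficients $a_k$ are independent, with $\operatorname{Re}a_k$ and $\operatorname{Im}a_k$ independent real centered Gaussian random variables each of variance $\binom{N}{k}$. Almost surely $f$ has $N$ roots $z_1,\dots,z_N\in\mathbb{C}$ (with multiplicity); let $X_i=2\hat z_i-(0,0,1)\in\mathbb{S}^2$. Then $$\mathbb{E}\big(V(X_1,\dots,X_N)\big)=-\frac{N^2}{4}\ln\Big(\frac4e\Big)-\frac{N\ln N}{4}+\frac N4\ln\Big(\frac4e\Big).$$
   Context: $\mathbb{S}^2=\{x\in\mathbb{R}^3:\|x\|=1\}$. For $x_1,\dots,x_N\in\mathbb{S}^2$ the logarithmic energy is $V(x_1,\dots,x_N)=-\sum_{1\le i<j\le N}\ln\|x_i-x_j\|$ (with value $+\infty$ if two points coincide). For $z\in\mathbb{C}$, $\hat z=\frac{(z,1)}{1+|z|^2}\in\mathbb{C}\times\mathbb{R}\cong\mathbb{R}^3$, a point of the sphere of radius $1/2$ centered at $(0,0,1/2)$; thus $2\hat z-(0,0,1)$ is the corresponding point of the unit sphere (inverse stereographic projection). $V(X_1,\dots,X_N)$ does not depend on the ordering of the roots. *)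

theory Defs
  imports "HOL-Probability.Probability" "HOL-Computational_Algebra.Fundamental_Theorem_Algebra"
begin

text \<open>The point hat z of the sphere of radius 1/2 centred at (0,0,1/2), in C x R = R^3.\<close>
definition hat :: "complex \<Rightarrow> complex \<times> real" where
  "hat z = (z / complex_of_real (1 + (cmod z)\<^sup>2), 1 / (1 + (cmod z)\<^sup>2))"

text \<open>Inverse stereographic projection onto the unit sphere: 2 hat z - (0,0,1).\<close>
definition sphere_point :: "complex \<Rightarrow> complex \<times> real" where
  "sphere_point z = 2 *\<^sub>R hat z - (0, 1)"

definition log_energy :: "('a::real_normed_vector) list \<Rightarrow> ereal" where
  "log_energy xs =
     (if distinct xs
      then ereal (- (\<Sum>i<length xs. \<Sum>j\<in>{i<..<length xs}. ln (norm (xs ! i - xs ! j))))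
      else \<infinity>)"

definition complex_gaussian :: "real \<Rightarrow> complex measure" where
  "complex_gaussian v =
     distr (density lborel (normal_density 0 (sqrt v)) \<Otimes>\<^sub>M density lborel (normal_density 0 (sqrt v)))
       borel (\<lambda>(x, y). Complex x y)"

definition coeff_measure :: "nat \<Rightarrow> (nat \<Rightarrow> complex) measure" where
  "coeff_measure N = (\<Pi>\<^sub>M k\<in>{0..N}. complex_gaussian (real (N choose k)))"

definition rand_poly :: "nat \<Rightarrow> (nat \<Rightarrow> complex) \<Rightarrow> complex poly" where
  "rand_poly N a = (\<Sum>k\<le>N. monom (a k) k)"

text \<open>The roots of f listed with multiplicity (in some order; V does not depend on it),
  mapped to the unit sphere.\<close>
definition root_points :: "nat \<Rightarrow> (nat \<Rightarrow> complex) \<Rightarrow> (complex \<times> real) list" where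
  "root_points N a = map sphere_point (SOME xs. mset xs = proots (rand_poly N a))"

end

theory Submission
  imports Defs "HOL-Complex_Analysis.Conformal_Mappings" "HOL-Real_Asymp.Real_Asymp"
begin

text \<open>
  The chordal distance of two projected points is \<open>2|z - w|\<close> divided by
  \<open>sqrt (1 + |z|\<^sup>2) sqrt (1 + |w|\<^sup>2)\<close>, and \<open>f'(z\<^sub>i)\<close> is the leading coefficient \<open>a\<^sub>N\<close> times the product
  of the \<open>z\<^sub>i - z\<^sub>j\<close>. Hence the energy equals
  \<open>N/2 ln |a\<^sub>N| - N(N-1)/2 ln 2\<close> plus the sum over the roots of
  \<open>(N-1)/2 ln (1 + |z|\<^sup>2) - 1/2 ln |f'(z)|\<close>. The expectation of such a sum over the roots is given
  by a Kac-Rice formula: integrate the constant coefficient first, change variables with the area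
  formula for the polynomial map \<open>f - a\<^sub>0\<close>, and condition the Gaussian vector \<open>(f(z), f'(z))\<close> on
  \<open>f(z) = 0\<close>. The resulting roots are uniform on the sphere, and given a root at \<open>z\<close> the value
  \<open>f'(z)\<close> is a size-biased complex Gaussian. The expectation of \<open>ln |a\<^sub>N|\<close> and its size-biased
  version differ by \<open>1/2\<close>, so Euler's constant cancels.
\<close>

section \<open>The area formula for complex polynomials\<close>

text \<open>The Gaussian density of the constant coefficient, taken at minus the rest of the
  polynomial, does the smoothing that a delta function at \<open>f(z) = 0\<close> would otherwise
  call for, while the other coefficients alone determine \<open>f'\<close>. The area formula
  contributes the weight \<open>|f'(z)|^2\<close>: it size-biases the law of \<open>f'(z)\<close> at
  a root, and its conditional mean times the density of \<open>f(z)\<close> at \<open>0\<close> is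
  the intensity of the roots, which the binomial variances turn into the area density of the sphere.
  The weight vanishes together with \<open>f'\<close>, and this excludes multiple roots almost
  surely.

  Two obstacles shape the rest. The roots are listed by an arbitrary choice, so everything is
  phrased through sums over the root multiset, whose measurability comes from counting roots in
  closed sets. And the energy has no fixed sign: the formula is proved for nonnegative functions
  first and then for differences, so the logarithms must be shown integrable. That rests on
  \<open>(t - 1) * ln t\<close>, which is nonnegative and has an elementary primitive against
  \<open>exp (- t)\<close>.\<close>

definition vec_of_complex :: "complex \<Rightarrow> real^2" where
  "vec_of_complex z = vector [Re z, Im z]"

definition complex_of_vec :: "real^2 \<Rightarrow> complex" where
  "complex_of_vec v = Complex (v $ 1) (v $ 2)"

lemma complex_of_vec_inverse [simp]: "complex_of_vec (vec_of_complex z) = z"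
  by (simp add: complex_of_vec_def vec_of_complex_def)

lemma vec_of_complex_inverse [simp]: "vec_of_complex (complex_of_vec v) = v"
  by (simp add: complex_of_vec_def vec_of_complex_def vec_eq_iff forall_2)

lemma bounded_linear_complex_of_vec: "bounded_linear complex_of_vec"
  unfolding linear_conv_bounded_linear [symmetric] complex_of_vec_def
  by (rule linearI) (auto simp: complex_eq_iff)

lemma bounded_linear_vec_of_complex: "bounded_linear vec_of_complex"
  unfolding linear_conv_bounded_linear [symmetric] vec_of_complex_def
  by (rule linearI) (auto simp: vec_eq_iff forall_2)

lemma measurable_complex_of_vec [measurable]: "complex_of_vec \<in> borel \<rightarrow>\<^sub>M borel"
  by (intro borel_measurable_continuous_onI linear_continuous_on bounded_linear_complex_of_vec)

lemma vec_of_complex_image: "vec_of_complex ` A = complex_of_vec -` A"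
  by (auto intro!: image_eqI[of _ _ "complex_of_vec _"])

lemma exists_2: "(\<exists>i::2. P i) \<longleftrightarrow> P 1 \<or> P 2"
  using forall_2[of "\<lambda>i. \<not> P i"] by blast

text \<open>The change of variables used below takes place in \<open>real^2\<close>; this identity
  brings it back to the complex plane. The coordinate map sends boxes to boxes with the same side
  lengths, and boxes determine \<open>lborel\<close>.\<close>

lemma lborel_complex_eq_distr: "(lborel :: complex measure) = distr lborel borel complex_of_vec"
proof (rule lborel_eqI)
  fix l u :: complex
  assume le: "\<And>b. b \<in> Basis \<Longrightarrow> l \<bullet> b \<le> u \<bullet> b"
  have "complex_of_vec -` box l u = box (vec_of_complex l) (vec_of_complex u)"
    by (auto simp: box_def Basis_complex_def Basis_vec_def complex_of_vec_def vec_of_complex_def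
        inner_axis forall_2 exists_2)
  moreover have "\<And>b. b \<in> Basis \<Longrightarrow> vec_of_complex l \<bullet> b \<le> vec_of_complex u \<bullet> b"
    using le[of 1] le[of \<i>] by (auto simp: Basis_complex_def Basis_vec_def vec_of_complex_def inner_axis exists_2 forall_2)
  moreover have "prod ((\<bullet>) (vec_of_complex u - vec_of_complex l)) Basis = prod ((\<bullet>) (u - l)) Basis"
  proof -
    have B: "(Basis :: (real^2) set) = {axis 1 1, axis 2 1}"
      by (auto simp: Basis_vec_def UNIV_2)
    have ne: "axis 1 1 \<noteq> (axis 2 1 :: real^2)"
      by (simp add: axis_eq_axis)
    show ?thesis
      unfolding B using ne by (simp add: Basis_complex_def inner_axis vec_of_complex_def)
  qed
  ultimately show "emeasure (distr lborel borel complex_of_vec) (box l u) = ennreal (prod ((\<bullet>) (u - l)) Basis)"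
    by (simp add: emeasure_distr emeasure_lborel_box_eq)
qed simp

lemma emeasure_vec_of_complex_image:
  assumes "A \<in> sets borel"
  shows "emeasure lborel (vec_of_complex ` A) = emeasure lborel A"
proof -
  have "emeasure lborel A = emeasure (distr lborel borel complex_of_vec) A"
    by (simp add: lborel_complex_eq_distr[symmetric])
  then show ?thesis
    using assms by (simp add: emeasure_distr vec_of_complex_image)
qed

text \<open>Multiplication by \<open>x + i y\<close> is the real matrix with rows
  \<open>(x, - y)\<close> and \<open>(y, x)\<close>. Applied to a complex derivative, this is the
  Cauchy-Riemann form of the Jacobian.\<close>

lemma det_complex_mult:
  "det (matrix (\<lambda>h. vec_of_complex (c * complex_of_vec h))) = (cmod c)\<^sup>2"
  by (simp add: det_2 matrix_def vec_of_complex_def complex_of_vec_def axis_def cmod_power2) (simp add: power2_eq_square)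

text \<open>By invariance of domain \<open>f\<close> is a homeomorphism of \<open>V\<close> onto an
  open set, so the image of a Borel set is a preimage under the continuous inverse and hence Borel.
  Boundedness of the image gives it finite measure, as the change of variables with a real value of
  the integral demands.\<close>

lemma holomorphic_injective_image:
  fixes f f' :: "complex \<Rightarrow> complex"
  assumes V: "open V" and inj: "inj_on f V"
    and der: "\<And>z. z \<in> V \<Longrightarrow> (f has_field_derivative f' z) (at z)"
    and A: "A \<in> sets borel" "A \<subseteq> V" and bd: "bounded (f ` A)"
    and f' [measurable]: "f' \<in> borel_measurable borel"
  shows "f ` A \<in> sets borel"
    and "emeasure lborel (f ` A) = (\<integral>\<^sup>+z. ennreal ((cmod (f' z))\<^sup>2) * indicator A z \<partial>lborel)"
proof -
  have cont: "continuous_on V f"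
    by (intro DERIV_continuous_on[of _ _ f']) (use der has_field_derivative_at_within in blast)
  obtain g where g: "homeomorphism V (f ` V) f g"
    using invariance_of_domain_homeomorphism[OF V cont _ inj] by auto
  have openV: "open (f ` V)"
    using invariance_of_domain[OF cont V inj] .
  have "f ` A = g -` A \<inter> f ` V"
    using g A(2) inj unfolding homeomorphism_def by (force simp: inj_on_def)
  moreover have "g \<in> borel_measurable (restrict_space borel (f ` V))"
    using g by (intro borel_measurable_continuous_on_restrict) (simp add: homeomorphism_def)
  hence "g -` A \<inter> space (restrict_space borel (f ` V)) \<in> sets (restrict_space borel (f ` V))"
    using A(1) by measurable
  ultimately show fA: "f ` A \<in> sets borel"
    using openV by (subst (asm) sets_restrict_space_iff) (auto simp: space_restrict_space)
  let ?S = "vec_of_complex ` A"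
  let ?F = "\<lambda>x. vec_of_complex (f (complex_of_vec x))"
  let ?F' = "\<lambda>x h. vec_of_complex (f' (complex_of_vec x) * complex_of_vec h)"
  have S: "?S \<in> sets borel"
    unfolding vec_of_complex_image using measurable_sets[OF measurable_complex_of_vec A(1)] by simp
  have FS: "?F ` ?S = vec_of_complex ` f ` A"
    by (auto simp: image_image)
  have FSb: "?F ` ?S \<in> sets borel"
    unfolding FS unfolding vec_of_complex_image
    using measurable_sets[OF measurable_complex_of_vec fA] by simp
  have derF: "(?F has_derivative ?F' x) (at x within ?S)" if "x \<in> ?S" for x
  proof -
    have "complex_of_vec x \<in> V" using that A(2) by auto
    then have "(f has_derivative (\<lambda>h. f' (complex_of_vec x) * h)) (at (complex_of_vec x))"
      using der by (simp add: has_field_derivative_def)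
    from has_derivative_compose[OF bounded_linear_imp_has_derivative[OF bounded_linear_complex_of_vec] this]
    have "((\<lambda>x. f (complex_of_vec x)) has_derivative (\<lambda>h. f' (complex_of_vec x) * complex_of_vec h)) (at x within ?S)" .
    from bounded_linear.has_derivative[OF bounded_linear_vec_of_complex this] show ?thesis .
  qed
  have injF: "inj_on ?F ?S"
    using inj A(2) by (auto simp: inj_on_def dest!: arg_cong[where f = complex_of_vec]) blast
  have "bounded (?F ` ?S)"
    unfolding FS by (rule bounded_linear_image[OF bd bounded_linear_vec_of_complex])
  then have lm: "?F ` ?S \<in> lmeasurable"
    using FSb by (intro bounded_set_imp_lmeasurable) auto
  have "((\<lambda>x. \<bar>det (matrix (?F' x))\<bar>) has_integral measure lebesgue (?F ` ?S)) ?S"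
    using has_measure_differentiable_image[of ?S ?F ?F'] S derF injF lm by auto
  then have "((\<lambda>x. (cmod (f' (complex_of_vec x)))\<^sup>2) has_integral measure lebesgue (?F ` ?S)) ?S"
    by (simp only: det_complex_mult) simp
  then have "(\<integral>\<^sup>+x. ennreal ((cmod (f' (complex_of_vec x)))\<^sup>2) * indicator ?S x \<partial>lborel) = ennreal (measure lebesgue (?F ` ?S))"
    by (intro nn_integral_has_integral_lebesgue') auto
  also have "ennreal (measure lebesgue (?F ` ?S)) = emeasure lebesgue (?F ` ?S)"
    using lm by (simp add: emeasure_eq_measure2)
  also have "\<dots> = emeasure lborel (f ` A)"
    using FSb FS emeasure_vec_of_complex_image[OF fA] by simp
  also have "(\<integral>\<^sup>+x. ennreal ((cmod (f' (complex_of_vec x)))\<^sup>2) * indicator ?S x \<partial>lborel)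
    = (\<integral>\<^sup>+x. ennreal ((cmod (f' (complex_of_vec x)))\<^sup>2) * indicator A (complex_of_vec x) \<partial>lborel)"
    unfolding vec_of_complex_image by (simp add: indicator_def)
  also have "\<dots> = (\<integral>\<^sup>+z. ennreal ((cmod (f' z))\<^sup>2) * indicator A z \<partial>distr lborel borel complex_of_vec)"
    using A(1) by (subst nn_integral_distr) auto
  finally show "emeasure lborel (f ` A) = (\<integral>\<^sup>+z. ennreal ((cmod (f' z))\<^sup>2) * indicator A z \<partial>lborel)"
    by (simp add: lborel_complex_eq_distr[symmetric])
qed

section \<open>From injective pieces to the fibres of a polynomial\<close>

lemma measurable_poly [measurable]: "poly (p :: complex poly) \<in> borel_measurable borel"
  by (intro borel_measurable_continuous_onI continuous_intros)

lemma finite_poly_fiber: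
  fixes g :: "complex poly"
  assumes "degree g > 0"
  shows "finite {z. poly g z = w}"
proof -
  have "g - [:w:] \<noteq> 0" using assms by auto
  from poly_roots_finite[OF this] show ?thesis by simp
qed

text \<open>Around each noncritical point there is a ball on which the polynomial is injective, and
  by Lindelof countably many such balls cover the noncritical set.\<close>

lemma injective_pieces:
  fixes g :: "complex poly"
  shows "\<exists>B :: nat \<Rightarrow> complex set. (\<forall>n. open (B n) \<and> bounded (B n) \<and> inj_on (poly g) (B n))
    \<and> (\<Union>n. B n) = {z. poly (pderiv g) z \<noteq> 0}"
proof -
  let ?U = "{z. poly (pderiv g) z \<noteq> 0}"
  let ?F = "{ball z r | z r. inj_on (poly g) (ball z r) \<and> ball z r \<subseteq> ?U}"
  obtain F' where F': "F' \<subseteq> ?F" "countable F'" "\<Union>F' = \<Union>?F"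
    by (rule Lindelof[of ?F]) auto
  have U: "open ?U"
    by (intro open_Collect_neq continuous_intros)
  have "\<Union>?F = ?U"
  proof (intro equalityI subsetI)
    fix z assume z: "z \<in> ?U"
    have hol: "poly g holomorphic_on A" for A
      unfolding holomorphic_on_def field_differentiable_def
      using poly_DERIV[of g] has_field_derivative_at_within by blast
    have "deriv (poly g) z \<noteq> 0"
      using z DERIV_imp_deriv[OF poly_DERIV[of g z]] by simp
    then obtain r where "r > 0" "ball z r \<subseteq> ?U" "inj_on (poly g) (ball z r)"
      using has_complex_derivative_locally_injective[of "poly g" ?U z] U z
      using hol by metis
    then show "z \<in> \<Union>?F" by (intro UnionI[of "ball z r"]) auto
  qed auto
  \<comment> \<open>The countable subcover may be empty; adding the empty set leaves the union
    unchanged and makes the family enumerable by \<open>nat\<close>.\<close>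
  moreover define B where "B = from_nat_into (insert {} F')"
  have R: "range B = insert {} F'"
    unfolding B_def using F' by (intro range_from_nat_into) auto
  have *: "B n \<in> insert {} F'" for n using R by auto
  have "open (B n)" "bounded (B n)" "inj_on (poly g) (B n)" for n
    using *[of n] F'(1) by auto
  moreover have "(\<Union>n. B n) = \<Union>F'" using R by auto
  ultimately show ?thesis using F'(3) by (intro exI[of _ B]) simp
qed

text \<open>The injective pieces are made disjoint. Each contributes to the fibre sum the indicator
  of its image, whose area is known. The finitely many critical points contribute a finite sum of
  indicators of single points: a null function of \<open>w\<close> on the left, matched on the right
  by the vanishing of the derivative.\<close>

lemma poly_area_formula_indicator:
  fixes g :: "complex poly"
  assumes deg: "degree g > 0" and A: "A \<in> sets borel"
  shows "(\<lambda>w. \<Sum>z | poly g z = w. indicator A z :: ennreal) \<in> borel_measurable borel" (is ?M)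
    and "(\<integral>\<^sup>+w. (\<Sum>z | poly g z = w. indicator A z) \<partial>lborel)
       = (\<integral>\<^sup>+z. indicator A z * ennreal ((cmod (poly (pderiv g) z))\<^sup>2) \<partial>lborel)" (is ?I)
proof -
  obtain B :: "nat \<Rightarrow> complex set" where B: "\<And>n. open (B n)" "\<And>n. bounded (B n)" "\<And>n. inj_on (poly g) (B n)"
    "(\<Union>n. B n) = {z. poly (pderiv g) z \<noteq> 0}"
    using injective_pieces[of g] by auto
  define C where "C = {z. poly (pderiv g) z = 0}"
  define D where "D = disjointed B"
  have D: "disjoint_family D" "\<And>n. D n \<subseteq> B n" "(\<Union>n. D n) = - C"
    unfolding D_def C_def using B(4)
    by (auto simp: disjoint_family_disjointed disjointed_subset UN_disjointed_eq)
  have Dm: "D n \<in> sets borel" for n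
  proof -
    have "range B \<subseteq> sets borel" using B(1) by auto
    from sets.range_disjointed_sets[OF this] show ?thesis unfolding D_def by blast
  qed
  have "pderiv g \<noteq> 0" using deg by (simp add: pderiv_eq_0_iff)
  then have C: "finite C" unfolding C_def by (rule poly_roots_finite)
  have piece: "poly g ` (A \<inter> D n) \<in> sets borel"
    "emeasure lborel (poly g ` (A \<inter> D n)) =
      (\<integral>\<^sup>+z. ennreal ((cmod (poly (pderiv g) z))\<^sup>2) * indicator (A \<inter> D n) z \<partial>lborel)" for n
  proof -
    have "bounded (poly g ` closure (B n))"
      using B(2) by (intro compact_imp_bounded compact_continuous_image continuous_intros) simp
    then have bd: "bounded (poly g ` (A \<inter> D n))"
      by (rule bounded_subset) (use D(2)[of n] closure_subset in blast)
    have sub: "A \<inter> D n \<subseteq> B n" using D(2)[of n] by auto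
    show "poly g ` (A \<inter> D n) \<in> sets borel"
      "emeasure lborel (poly g ` (A \<inter> D n)) =
      (\<integral>\<^sup>+z. ennreal ((cmod (poly (pderiv g) z))\<^sup>2) * indicator (A \<inter> D n) z \<partial>lborel)"
      using holomorphic_injective_image[where f = "poly g" and f' = "poly (pderiv g)" and V = "B n" and A = "A \<inter> D n"]
        B(1,3)[of n] sub A Dm[of n] bd poly_DERIV[of g] measurable_poly by auto
  qed
  have ind: "indicator A z = (\<Sum>n. indicator (A \<inter> D n) z :: ennreal) + indicator (A \<inter> C) z" for z
  proof -
    have "(\<Sum>n. indicator (A \<inter> D n) z :: ennreal) = indicator (\<Union>n. A \<inter> D n) z"
      by (rule suminf_indicator) (use D(1) in \<open>auto simp: disjoint_family_on_def\<close>)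
    also have "(\<Union>n. A \<inter> D n) = A - C" using D(3) by auto
    finally show ?thesis by (auto simp: indicator_def)
  qed
  have one: "(\<Sum>z | poly g z = w. indicator (A \<inter> D n) z) = (indicator (poly g ` (A \<inter> D n)) w :: ennreal)" for n w
  proof (cases "w \<in> poly g ` (A \<inter> D n)")
    case True
    then obtain z where z: "z \<in> A \<inter> D n" "w = poly g z" by auto
    have "(\<Sum>z' | poly g z' = w. indicator (A \<inter> D n) z') = (\<Sum>z'\<in>{z}. indicator (A \<inter> D n) z' :: ennreal)"
      using z B(3)[of n] D(2)[of n] finite_poly_fiber[OF deg]
      by (intro sum.mono_neutral_right) (auto simp: indicator_def inj_on_def)
    then show ?thesis using z True by simp
  next
    case False
    then have "\<And>z. poly g z = w \<Longrightarrow> z \<notin> A \<inter> D n" by auto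
    then have "(\<Sum>z | poly g z = w. indicator (A \<inter> D n) z) = (0 :: ennreal)"
      by (intro sum.neutral) (auto simp: indicator_def)
    then show ?thesis using False by simp
  qed
  have split: "(\<Sum>z | poly g z = w. indicator A z :: ennreal)
      = (\<Sum>n. indicator (poly g ` (A \<inter> D n)) w) + (\<Sum>z\<in>A \<inter> C. indicator {poly g z} w)" for w
  proof -
    have "(\<Sum>z | poly g z = w. indicator A z :: ennreal)
      = (\<Sum>n. \<Sum>z | poly g z = w. indicator (A \<inter> D n) z) + (\<Sum>z | poly g z = w. indicator (A \<inter> C) z)"
    proof -
      have "(\<Sum>n. \<Sum>z | poly g z = w. indicator (A \<inter> D n) z :: ennreal)
        = (\<Sum>z | poly g z = w. \<Sum>n. indicator (A \<inter> D n) z)"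
        by (rule suminf_sum) (rule summableI)
      then show ?thesis by (simp only: ind[symmetric] sum.distrib[symmetric])
    qed
    also have "(\<Sum>z | poly g z = w. indicator (A \<inter> C) z :: ennreal) = (\<Sum>z\<in>A \<inter> C \<inter> {z. poly g z = w}. 1)"
      using finite_poly_fiber[OF deg] C by (intro sum.mono_neutral_cong) (auto simp: indicator_def)
    also have "\<dots> = (\<Sum>z\<in>A \<inter> C. indicator {poly g z} w :: ennreal)"
      using C by (intro sum.mono_neutral_cong_left) (auto simp: indicator_def)
    finally show ?thesis by (simp add: one)
  qed
  show ?M
    unfolding split using piece(1) by measurable
  have "(\<integral>\<^sup>+w. (\<Sum>z | poly g z = w. indicator A z) \<partial>lborel)
      = (\<Sum>n. emeasure lborel (poly g ` (A \<inter> D n)))"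
  proof -
    have [measurable]: "poly g ` (A \<inter> D n) \<in> sets borel" for n by (rule piece)
    show ?thesis
      unfolding split using piece(1)
      by (simp add: nn_integral_add nn_integral_suminf nn_integral_sum)
  qed
  also have "\<dots> = (\<integral>\<^sup>+z. (\<Sum>n. ennreal ((cmod (poly (pderiv g) z))\<^sup>2) * indicator (A \<inter> D n) z) \<partial>lborel)"
    unfolding piece using A Dm
    by (intro nn_integral_suminf[symmetric]) (auto intro!: borel_measurable_times_ennreal
        borel_measurable_indicator)
  also have "\<dots> = (\<integral>\<^sup>+z. indicator A z * ennreal ((cmod (poly (pderiv g) z))\<^sup>2) \<partial>lborel)"
  proof (intro nn_integral_cong)
    fix z
    have "(\<Sum>n. ennreal ((cmod (poly (pderiv g) z))\<^sup>2) * indicator (A \<inter> D n) z)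
      = ennreal ((cmod (poly (pderiv g) z))\<^sup>2) * (\<Sum>n. indicator (A \<inter> D n) z)"
      by (rule ennreal_suminf_cmult)
    then show "(\<Sum>n. ennreal ((cmod (poly (pderiv g) z))\<^sup>2) * indicator (A \<inter> D n) z)
      = indicator A z * ennreal ((cmod (poly (pderiv g) z))\<^sup>2)"
      by (subst ind) (cases "z \<in> C"; simp add: C_def mult.commute)
  qed
  finally show ?I .
qed

text \<open>Measurability and the integral identity are proved as one conjunction because the
  induction needs both together: additivity and monotone convergence on the left apply only once the
  fibre sums are known to be measurable.\<close>

theorem poly_area_formula:
  fixes g :: "complex poly" and \<phi> :: "complex \<Rightarrow> ennreal"
  assumes deg: "degree g > 0" and \<phi>: "\<phi> \<in> borel_measurable borel"
  shows "(\<lambda>w. \<Sum>z | poly g z = w. \<phi> z) \<in> borel_measurable borel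
    \<and> (\<integral>\<^sup>+w. (\<Sum>z | poly g z = w. \<phi> z) \<partial>lborel)
       = (\<integral>\<^sup>+z. \<phi> z * ennreal ((cmod (poly (pderiv g) z))\<^sup>2) \<partial>lborel)"
proof -
  show ?thesis using \<phi>
  proof (induction rule: borel_measurable_induct)
    case (cong f g)
    then show ?case by simp
  next
    case (set A)
    then show ?case using poly_area_formula_indicator[OF deg] by simp
  next
    case (mult u c)
    note [measurable] = mult(2)
    from mult show ?case
      by (auto simp: sum_distrib_left[symmetric] nn_integral_cmult mult.assoc intro!: borel_measurable_times_ennreal)
  next
    case (add u v)
    note [measurable] = add(1,3)
    from add show ?case
      by (auto simp: sum.distrib nn_integral_add distrib_right intro!: borel_measurable_add)
  next
    case (seq U)
    note [measurable] = seq(1)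
    have [measurable]: "(\<lambda>w. \<Sum>z | poly g z = w. U i z) \<in> borel_measurable borel" for i
      using seq by simp
    have S: "(\<Sum>z | poly g z = w. (SUP i. U i z)) = (SUP i. \<Sum>z | poly g z = w. U i z)" for w
      using seq(3) by (subst ennreal_SUP_sum) (auto simp: incseq_def le_fun_def image_image)
    have inc: "incseq (\<lambda>i w. \<Sum>z | poly g z = w. U i z)"
      "incseq (\<lambda>i z. U i z * ennreal ((cmod (poly (pderiv g) z))\<^sup>2))"
      using seq(3) by (auto simp: incseq_def le_fun_def intro!: sum_mono mult_right_mono)
    have "(\<integral>\<^sup>+w. (SUP i. \<Sum>z | poly g z = w. U i z) \<partial>lborel) = (SUP i. \<integral>\<^sup>+w. (\<Sum>z | poly g z = w. U i z) \<partial>lborel)"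
      by (rule nn_integral_monotone_convergence_SUP[OF inc(1)]) simp
    also have "\<dots> = (SUP i. \<integral>\<^sup>+z. U i z * ennreal ((cmod (poly (pderiv g) z))\<^sup>2) \<partial>lborel)"
      using seq by simp
    also have "\<dots> = (\<integral>\<^sup>+z. (SUP i. U i z * ennreal ((cmod (poly (pderiv g) z))\<^sup>2)) \<partial>lborel)"
      by (rule nn_integral_monotone_convergence_SUP[OF inc(2), symmetric]) simp
    also have "\<dots> = (\<integral>\<^sup>+z. (SUP i. U i z) * ennreal ((cmod (poly (pderiv g) z))\<^sup>2) \<partial>lborel)"
      by (simp add: SUP_mult_right_ennreal)
    finally have I: "(\<integral>\<^sup>+w. (SUP i. \<Sum>z | poly g z = w. U i z) \<partial>lborel) = \<dots>" .
    have eq: "(SUP i. U i) = (\<lambda>z. SUP i. U i z)"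
      by (auto simp: image_image)
    show ?case
      unfolding eq S using I by simp
  qed
qed

section \<open>Complex Gaussian variables\<close>

text \<open>Here \<open>v\<close> is the variance of each real coordinate, so
  \<open>E |z|^2 = 2 v\<close>; the normalisation \<open>E |u|^2 = 1\<close> corresponds to
  \<open>v = 1/2\<close>.\<close>

definition complex_normal_density :: "real \<Rightarrow> complex \<Rightarrow> real" where
  "complex_normal_density v z = exp (- (cmod z)\<^sup>2 / (2 * v)) / (2 * pi * v)"

lemma complex_normal_density_nonneg [simp]: "v \<ge> 0 \<Longrightarrow> complex_normal_density v z \<ge> 0"
  by (simp add: complex_normal_density_def)

lemma measurable_complex_normal_density [measurable]: "complex_normal_density v \<in> borel_measurable borel"
  unfolding complex_normal_density_def by measurable

lemma measurable_Complex [measurable]: "(\<lambda>(x, y). Complex x y) \<in> borel \<Otimes>\<^sub>M borel \<rightarrow>\<^sub>M borel"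
  by (simp add: borel_prod split_beta')
    (intro borel_measurable_continuous_onI continuous_intros)

lemma lborel_complex_eq_distr_pair:
  "(lborel :: complex measure) = distr (lborel \<Otimes>\<^sub>M lborel) borel (\<lambda>(x, y). Complex x y)"
proof (rule lborel_eqI)
  fix l u :: complex
  assume le: "\<And>b. b \<in> Basis \<Longrightarrow> l \<bullet> b \<le> u \<bullet> b"
  have "(\<lambda>(x, y). Complex x y) -` box l u = {Re l<..<Re u} \<times> {Im l<..<Im u}"
    by (auto simp: box_def Basis_complex_def)
  then show "emeasure (distr (lborel \<Otimes>\<^sub>M lborel) borel (\<lambda>(x, y). Complex x y)) (box l u)
    = ennreal (prod ((\<bullet>) (u - l)) Basis)"
    using le[of 1] le[of \<i>]
    by (simp add: emeasure_distr space_pair_measure lborel.emeasure_pair_measure_Times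
        Basis_complex_def ennreal_mult)
qed simp

lemma complex_gaussian_eq_density:
  assumes "v > 0"
  shows "complex_gaussian v = density lborel (\<lambda>z. ennreal (complex_normal_density v z))"
proof -
  have "complex_normal_density v (Complex x y) = normal_density 0 (sqrt v) x * normal_density 0 (sqrt v) y" for x y
  proof -
    have "normal_density 0 (sqrt v) x * normal_density 0 (sqrt v) y
      = (exp (- x\<^sup>2 / (2 * v)) * exp (- y\<^sup>2 / (2 * v))) / (sqrt (2 * pi * v) * sqrt (2 * pi * v))"
      using assms by (simp add: normal_density_def)
    also have "sqrt (2 * pi * v) * sqrt (2 * pi * v) = 2 * pi * v"
      using assms by simp
    also have "exp (- x\<^sup>2 / (2 * v)) * exp (- y\<^sup>2 / (2 * v)) = exp (- (x\<^sup>2 + y\<^sup>2) / (2 * v))"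
      by (simp add: exp_add[symmetric] diff_divide_distrib add_divide_distrib)
    finally show ?thesis
      by (simp add: complex_normal_density_def cmod_power2)
  qed
  then have eq: "ennreal (complex_normal_density v (Complex x y))
    = ennreal (normal_density 0 (sqrt v) x) * ennreal (normal_density 0 (sqrt v) y)" for x y
    by (simp add: ennreal_mult')
  have "density lborel (normal_density 0 (sqrt v)) \<Otimes>\<^sub>M density lborel (normal_density 0 (sqrt v))
      = density (lborel \<Otimes>\<^sub>M lborel) (\<lambda>(x, y). ennreal (normal_density 0 (sqrt v) x) * ennreal (normal_density 0 (sqrt v) y))"
    using assms by (intro pair_measure_density)
      (auto intro!: lborel.sigma_finite_measure_axioms prob_space_imp_sigma_finite prob_space_normal_density)
  then have "complex_gaussian v = distr (density (lborel \<Otimes>\<^sub>M lborel)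
      (\<lambda>p. ennreal (complex_normal_density v ((\<lambda>(x, y). Complex x y) p)))) borel (\<lambda>(x, y). Complex x y)"
    by (simp add: complex_gaussian_def eq split_beta')
  also have "\<dots> = density (distr (lborel \<Otimes>\<^sub>M lborel) borel (\<lambda>(x, y). Complex x y)) (\<lambda>z. ennreal (complex_normal_density v z))"
    by (rule density_distr[symmetric]) measurable
  finally show ?thesis
    by (simp add: lborel_complex_eq_distr_pair[symmetric])
qed

lemma prob_space_complex_gaussian: "v > 0 \<Longrightarrow> prob_space (complex_gaussian v)"
  unfolding complex_gaussian_def
  by (intro prob_space.prob_space_distr prob_space_pair prob_space_normal_density
      measurable_Complex[THEN measurable_cong_sets[OF sets_pair_measure_cong refl, THEN eqset_imp_iff, THEN iffD2, rotated -1]])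
    auto

lemma sets_complex_gaussian [simp, measurable_cong]: "sets (complex_gaussian v) = sets borel"
  by (simp add: complex_gaussian_def)

lemma space_complex_gaussian [simp]: "space (complex_gaussian v) = UNIV"
  by (simp add: complex_gaussian_def)

lemma nn_integral_complex_gaussian:
  fixes F :: "complex \<Rightarrow> ennreal"
  assumes "v > 0" "F \<in> borel_measurable borel"
  shows "(\<integral>\<^sup>+z. F z \<partial>complex_gaussian v) = (\<integral>\<^sup>+z. ennreal (complex_normal_density v z) * F z \<partial>lborel)"
  using assms by (subst complex_gaussian_eq_density) (auto simp: nn_integral_density)

text \<open>The area formula for the polynomial \<open>[:0, \<alpha>:]\<close>, whose fibres are
  single points and whose derivative is the constant \<alpha>.\<close>

lemma nn_integral_complex_scale:
  fixes \<alpha> :: complex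
  assumes "\<alpha> \<noteq> 0" and F: "F \<in> borel_measurable borel"
  shows "(\<integral>\<^sup>+z. F z \<partial>lborel) = (\<integral>\<^sup>+z. ennreal ((cmod \<alpha>)\<^sup>2) * F (\<alpha> * z) \<partial>lborel)"
proof -
  note [measurable] = F
  have "{z. z * \<alpha> = w} = {w / \<alpha>}" for w
    using assms by (auto simp: field_simps)
  then show ?thesis
    using poly_area_formula[of "[:0, \<alpha>:]" "\<lambda>z. F (\<alpha> * z)"] assms
    by (simp add: pderiv_pCons mult.commute)
qed

lemma nn_integral_complex_translate:
  fixes c :: complex
  assumes "F \<in> borel_measurable borel"
  shows "(\<integral>\<^sup>+z. F (c + z) \<partial>lborel) = (\<integral>\<^sup>+z. F z \<partial>lborel)"
proof -
  note [measurable] = assms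
  have "(\<integral>\<^sup>+z. F z \<partial>lborel) = (\<integral>\<^sup>+z. F z \<partial>distr lborel borel ((+) c))"
    by (simp add: lborel_distr_plus)
  then show ?thesis
    by (simp add: nn_integral_distr)
qed

lemma nn_integral_complex_gaussian_scale:
  assumes "\<alpha> \<noteq> 0" "v > 0" and F: "F \<in> borel_measurable borel"
  shows "(\<integral>\<^sup>+z. F (\<alpha> * z) \<partial>complex_gaussian v) = (\<integral>\<^sup>+z. F z \<partial>complex_gaussian ((cmod \<alpha>)\<^sup>2 * v))"
proof -
  note [measurable] = F
  have "ennreal (complex_normal_density v z)
      = ennreal ((cmod \<alpha>)\<^sup>2) * ennreal (complex_normal_density ((cmod \<alpha>)\<^sup>2 * v) (\<alpha> * z))" for z
    using assms by (simp add: complex_normal_density_def norm_mult power_mult_distrib ennreal_mult'[symmetric])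
  then show ?thesis
    using assms nn_integral_complex_scale[OF assms(1), of "\<lambda>z. complex_normal_density ((cmod \<alpha>)\<^sup>2 * v) z * F z"]
    by (simp add: nn_integral_complex_gaussian mult.assoc)
qed

text \<open>Completing the square in the variable \<open>a\<close>.\<close>
lemma complex_normal_density_mult:
  fixes c w a :: complex
  assumes s: "s > 0" and v: "v > 0"
  defines "s' \<equiv> s + (cmod c)\<^sup>2 * v"
  shows "complex_normal_density s (w + c * a) * complex_normal_density v a
    = complex_normal_density s' w * complex_normal_density (s * v / s') (a + of_real (v / s') * cnj c * w)"
proof -
  have s': "s' > 0" unfolding s'_def using s v by (intro add_pos_nonneg) auto
  have "(cmod (w + c * a))\<^sup>2 / (2 * s) + (cmod a)\<^sup>2 / (2 * v)
    = (cmod w)\<^sup>2 / (2 * s') + (cmod (a + of_real (v / s') * cnj c * w))\<^sup>2 / (2 * (s * v / s'))"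
  proof -
    define X Y W Z where "X = (cmod (w + c * a))\<^sup>2" and "Y = (cmod a)\<^sup>2" and "W = (cmod w)\<^sup>2"
      and "Z = (cmod (of_real s' * a + of_real v * cnj c * w))\<^sup>2"
    \<comment> \<open>The identity of the exponents multiplied by \<open>2 * s * v * s'\<close>; in
      real and imaginary parts it is a polynomial identity.\<close>
    have "X * (v * s') + Y * (s * s') = W * (s * v) + Z"
      unfolding X_def Y_def W_def Z_def s'_def cmod_power2
      by simp algebra
    moreover have "(cmod (a + of_real (v / s') * cnj c * w))\<^sup>2 = Z / s'\<^sup>2"
    proof -
      have "a + of_real (v / s') * cnj c * w = (of_real s' * a + of_real v * cnj c * w) / of_real s'"
        using s' by (simp add: field_simps)
      then show ?thesis
        using s' by (simp add: Z_def norm_divide power_divide)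
    qed
    ultimately show ?thesis
      unfolding X_def[symmetric] Y_def[symmetric] W_def[symmetric]
      using s v s' by (simp add: divide_simps power2_eq_square) algebra
  qed
  then have "exp (- (cmod (w + c * a))\<^sup>2 / (2 * s)) * exp (- (cmod a)\<^sup>2 / (2 * v))
    = exp (- (cmod w)\<^sup>2 / (2 * s')) * exp (- (cmod (a + of_real (v / s') * cnj c * w))\<^sup>2 / (2 * (s * v / s')))"
    by (simp add: exp_add[symmetric])
  moreover have "(2 * pi * s) * (2 * pi * v) = (2 * pi * s') * (2 * pi * (s * v / s'))"
    using s' by simp
  ultimately show ?thesis
    unfolding complex_normal_density_def by (simp only: times_divide_times_eq)
qed

text \<open>Integrating a density of variance \<open>s\<close> against the law of \<open>a\<close> amounts to conditioning on a
  linear combination of Gaussian variables being zero.\<close>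
lemma nn_integral_density_complex_gaussian:
  fixes c w :: complex
  assumes s: "s > 0" and v: "v > 0" and F: "F \<in> borel_measurable borel"
  defines "s' \<equiv> s + (cmod c)\<^sup>2 * v"
  shows "(\<integral>\<^sup>+a. ennreal (complex_normal_density s (w + c * a)) * F a \<partial>complex_gaussian v)
    = ennreal (complex_normal_density s' w)
      * (\<integral>\<^sup>+a. F (a - of_real (v / s') * cnj c * w) \<partial>complex_gaussian (s * v / s'))"
proof -
  note [measurable] = F
  have s': "s' > 0" unfolding s'_def using s v by (intro add_pos_nonneg) auto
  let ?u = "of_real (v / s') * cnj c * w"
  have "(\<integral>\<^sup>+a. ennreal (complex_normal_density s (w + c * a)) * F a \<partial>complex_gaussian v)
    = (\<integral>\<^sup>+a. ennreal (complex_normal_density v a * complex_normal_density s (w + c * a)) * F a \<partial>lborel)"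
    using v s by (simp add: nn_integral_complex_gaussian ennreal_mult mult.assoc)
  also have "\<dots> = (\<integral>\<^sup>+a. ennreal (complex_normal_density s' w) * (ennreal (complex_normal_density (s * v / s') (?u + a)) * F ((?u + a) - ?u)) \<partial>lborel)"
  proof (intro nn_integral_cong)
    fix a
    have "complex_normal_density v a * complex_normal_density s (w + c * a)
      = complex_normal_density s' w * complex_normal_density (s * v / s') (?u + a)"
      using complex_normal_density_mult[OF s v, of w c a] unfolding s'_def[symmetric]
      by (simp only: mult.commute[of "complex_normal_density v a"] add.commute[of _ a])
    then show "ennreal (complex_normal_density v a * complex_normal_density s (w + c * a)) * F a
      = ennreal (complex_normal_density s' w) * (ennreal (complex_normal_density (s * v / s') (?u + a)) * F ((?u + a) - ?u))"
      using s v s' by (simp add: ennreal_mult mult.assoc)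
  qed
  also have "\<dots> = ennreal (complex_normal_density s' w) * (\<integral>\<^sup>+a. ennreal (complex_normal_density (s * v / s') (?u + a)) * F ((?u + a) - ?u) \<partial>lborel)"
    by (rule nn_integral_cmult) measurable
  also have "(\<integral>\<^sup>+a. ennreal (complex_normal_density (s * v / s') (?u + a)) * F ((?u + a) - ?u) \<partial>lborel)
    = (\<integral>\<^sup>+a. ennreal (complex_normal_density (s * v / s') a) * F (a - ?u) \<partial>lborel)"
    by (rule nn_integral_complex_translate) measurable
  also have "\<dots> = (\<integral>\<^sup>+a. F (a - ?u) \<partial>complex_gaussian (s * v / s'))"
    using s v s' by (subst nn_integral_complex_gaussian) auto
  finally show ?thesis .
qed

text \<open>A case of the conditioning formula: with \<open>c = -1\<close> the density of the second
  summand is integrated against the first one, and since \<open>F u\<close> is constant in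
  \<open>a\<close>, the remaining Gaussian integral only contributes its total mass.\<close>

lemma nn_integral_complex_gaussian_convolution:
  assumes s: "s > 0" and v: "v > 0" and F: "F \<in> borel_measurable borel"
  shows "(\<integral>\<^sup>+a. (\<integral>\<^sup>+b. F (a + b) \<partial>complex_gaussian s) \<partial>complex_gaussian v)
    = (\<integral>\<^sup>+u. F u \<partial>complex_gaussian (s + v))"
proof -
  note [measurable] = F
  interpret G: prob_space "complex_gaussian v" by (rule prob_space_complex_gaussian[OF v])
  have "(\<integral>\<^sup>+a. (\<integral>\<^sup>+b. F (a + b) \<partial>complex_gaussian s) \<partial>complex_gaussian v)
    = (\<integral>\<^sup>+a. (\<integral>\<^sup>+u. ennreal (complex_normal_density s (u + (-1) * a)) * F u \<partial>lborel) \<partial>complex_gaussian v)"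
  proof (intro nn_integral_cong)
    fix a
    have "(\<integral>\<^sup>+b. F (a + b) \<partial>complex_gaussian s) = (\<integral>\<^sup>+b. ennreal (complex_normal_density s ((a + b) + (-1) * a)) * F (a + b) \<partial>lborel)"
      using s by (simp add: nn_integral_complex_gaussian)
    also have "\<dots> = (\<integral>\<^sup>+u. ennreal (complex_normal_density s (u + (-1) * a)) * F u \<partial>lborel)"
      by (rule nn_integral_complex_translate) measurable
    finally show "(\<integral>\<^sup>+b. F (a + b) \<partial>complex_gaussian s) = \<dots>" .
  qed
  also have "\<dots> = (\<integral>\<^sup>+u. (\<integral>\<^sup>+a. ennreal (complex_normal_density s (u + (-1) * a)) * F u \<partial>complex_gaussian v) \<partial>lborel)"
  proof -
    interpret pair_sigma_finite "complex_gaussian v" lborel ..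
    show ?thesis
      by (rule Fubini'[symmetric]) measurable
  qed
  also have "\<dots> = (\<integral>\<^sup>+u. ennreal (complex_normal_density (s + v) u) * F u \<partial>lborel)"
  proof (intro nn_integral_cong)
    fix u
    interpret G': prob_space "complex_gaussian (s * v / (s + v))"
      using s v by (intro prob_space_complex_gaussian) auto
    show "(\<integral>\<^sup>+a. ennreal (complex_normal_density s (u + (-1) * a)) * F u \<partial>complex_gaussian v)
      = ennreal (complex_normal_density (s + v) u) * F u"
      using nn_integral_density_complex_gaussian[OF s v, of "\<lambda>_. F u" u "-1"] G'.emeasure_space_1 by simp
  qed
  also have "\<dots> = (\<integral>\<^sup>+u. F u \<partial>complex_gaussian (s + v))"
    using s v by (simp add: nn_integral_complex_gaussian)
  finally show ?thesis .
qed

text \<open>By rotation invariance only the moduli of the coefficients matter. The result is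
  expressed as a multiple of a standard variable, so that the degenerate case \<alpha> = \<beta> = 0
  is covered, where no density of the total variance exists.\<close>

lemma nn_integral_complex_gaussian_linear:
  assumes s: "s > 0" and v: "v > 0" and F: "F \<in> borel_measurable borel"
  shows "(\<integral>\<^sup>+a. (\<integral>\<^sup>+b. F (\<alpha> * a + \<beta> * b) \<partial>complex_gaussian v) \<partial>complex_gaussian s)
    = (\<integral>\<^sup>+u. F (of_real (sqrt ((cmod \<alpha>)\<^sup>2 * s + (cmod \<beta>)\<^sup>2 * v)) * u) \<partial>complex_gaussian 1)"
proof -
  note [measurable] = F
  interpret G: prob_space "complex_gaussian v" by (rule prob_space_complex_gaussian[OF v])
  interpret H: prob_space "complex_gaussian s" by (rule prob_space_complex_gaussian[OF s])
  interpret I: prob_space "complex_gaussian 1" by (rule prob_space_complex_gaussian) simp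
  let ?r = "(cmod \<alpha>)\<^sup>2 * s + (cmod \<beta>)\<^sup>2 * v"
  have r: "?r > 0" if "\<alpha> \<noteq> 0 \<or> \<beta> \<noteq> 0"
    using that
  proof
    assume "\<alpha> \<noteq> 0" then show ?thesis using s v by (intro add_pos_nonneg) auto
  next
    assume "\<beta> \<noteq> 0" then show ?thesis using s v by (intro add_nonneg_pos) auto
  qed
  have R: "(\<integral>\<^sup>+u. F (of_real (sqrt ?r) * u) \<partial>complex_gaussian 1) = (\<integral>\<^sup>+u. F u \<partial>complex_gaussian ?r)"
    if "\<alpha> \<noteq> 0 \<or> \<beta> \<noteq> 0"
    using nn_integral_complex_gaussian_scale[of "of_real (sqrt ?r)" 1 F] r[OF that] F by simp
  consider "\<alpha> = 0" "\<beta> = 0" | "\<alpha> = 0" "\<beta> \<noteq> 0" | "\<alpha> \<noteq> 0" "\<beta> = 0" | "\<alpha> \<noteq> 0" "\<beta> \<noteq> 0" by blast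
  then show ?thesis
  proof cases
    case 1
    then show ?thesis using G.emeasure_space_1 H.emeasure_space_1 I.emeasure_space_1 by simp
  next
    case 2
    then show ?thesis using R nn_integral_complex_gaussian_scale[OF _ v F, of \<beta>] H.emeasure_space_1 by simp
  next
    case 3
    then show ?thesis using R nn_integral_complex_gaussian_scale[OF _ s F, of \<alpha>] G.emeasure_space_1 by simp
  next
    case 4
    have "(\<integral>\<^sup>+a. (\<integral>\<^sup>+b. F (\<alpha> * a + \<beta> * b) \<partial>complex_gaussian v) \<partial>complex_gaussian s)
      = (\<integral>\<^sup>+a. (\<integral>\<^sup>+b. F (\<alpha> * a + b) \<partial>complex_gaussian ((cmod \<beta>)\<^sup>2 * v)) \<partial>complex_gaussian s)"
      using 4 v by (subst nn_integral_complex_gaussian_scale[of \<beta> v, symmetric]) auto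
    also have "\<dots> = (\<integral>\<^sup>+a. (\<integral>\<^sup>+b. F (a + b) \<partial>complex_gaussian ((cmod \<beta>)\<^sup>2 * v)) \<partial>complex_gaussian ((cmod \<alpha>)\<^sup>2 * s))"
    proof -
      interpret B: prob_space "complex_gaussian ((cmod \<beta>)\<^sup>2 * v)"
        using 4 v by (intro prob_space_complex_gaussian) auto
      have "(\<lambda>a. \<integral>\<^sup>+b. F (a + b) \<partial>complex_gaussian ((cmod \<beta>)\<^sup>2 * v)) \<in> borel_measurable borel"
        by measurable
      from nn_integral_complex_gaussian_scale[OF _ s this, of \<alpha>] 4 show ?thesis by simp
    qed
    also have "\<dots> = (\<integral>\<^sup>+u. F u \<partial>complex_gaussian ?r)"
      using 4 s v F by (subst nn_integral_complex_gaussian_convolution) (auto simp: add.commute)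
    finally show ?thesis using R 4 by simp
  qed
qed

lemma product_sigma_finite_complex_gaussian:
  "(\<And>i. v i > 0) \<Longrightarrow> product_sigma_finite (\<lambda>i. complex_gaussian (v i))"
  unfolding product_sigma_finite_def
  by (auto intro: prob_space_imp_sigma_finite prob_space_complex_gaussian)

text \<open>In the application \<open>\<kappa> = 0\<close> and \<open>\<tau> = 0\<close>; the two parameters make the statement stable under
  integrating out one of the variables.\<close>
lemma gaussian_conditioning:
  fixes c d :: "'i \<Rightarrow> complex" and \<kappa> :: complex
  assumes I: "finite I" and v: "\<And>i. v i > 0" and F: "F \<in> borel_measurable borel"
    and s: "s > 0" and \<tau>: "\<tau> \<ge> 0"
  shows "(\<integral>\<^sup>+a. ennreal (complex_normal_density s (\<Sum>i\<in>I. c i * a i)) *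
        (\<integral>\<^sup>+y. F (\<kappa> * (\<Sum>i\<in>I. c i * a i) + (\<Sum>i\<in>I. d i * a i) + of_real (sqrt \<tau>) * y) \<partial>complex_gaussian 1)
      \<partial>(\<Pi>\<^sub>M i\<in>I. complex_gaussian (v i)))
    = ennreal (complex_normal_density (s + (\<Sum>i\<in>I. (cmod (c i))\<^sup>2 * v i)) 0) *
      (\<integral>\<^sup>+y. F (of_real (sqrt ((\<Sum>i\<in>I. (cmod (d i))\<^sup>2 * v i) + (cmod \<kappa>)\<^sup>2 * s + \<tau>
          - (cmod ((\<Sum>i\<in>I. d i * cnj (c i) * of_real (v i)) - \<kappa> * of_real s))\<^sup>2
            / (s + (\<Sum>i\<in>I. (cmod (c i))\<^sup>2 * v i)))) * y) \<partial>complex_gaussian 1)"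
  using I s \<tau>
proof (induction I arbitrary: s \<tau> \<kappa> rule: finite_induct)
  case empty
  interpret product_sigma_finite "\<lambda>i. complex_gaussian (v i)"
    by (rule product_sigma_finite_complex_gaussian[OF v])
  have "(cmod \<kappa>)\<^sup>2 * s + \<tau> - (cmod (\<kappa> * of_real s))\<^sup>2 / s = \<tau>"
    using empty by (simp add: norm_mult power_mult_distrib power2_eq_square)
  then show ?case
    by (simp add: space_PiM)
next
  case (insert i I)
  note [measurable] = F
  interpret product_sigma_finite "\<lambda>i. complex_gaussian (v i)"
    by (rule product_sigma_finite_complex_gaussian[OF v])
  interpret G: prob_space "complex_gaussian 1" by (rule prob_space_complex_gaussian) simp
  define s' where "s' = s + (cmod (c i))\<^sup>2 * v i"
  \<comment> \<open>\<beta> is the total coefficient of the variable \<open>a i\<close>.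
    Conditioning recentres this variable at a multiple of the first linear form, which changes the
    coefficient of that form to \<open>\<kappa>'\<close>; the fluctuation that remains joins the
    auxiliary noise and raises its variance to \<open>\<tau>'\<close>.\<close>
  define \<beta> where "\<beta> = \<kappa> * c i + d i"
  define \<kappa>' where "\<kappa>' = \<kappa> - \<beta> * of_real (v i / s') * cnj (c i)"
  define \<tau>' where "\<tau>' = (cmod \<beta>)\<^sup>2 * (s * v i / s') + \<tau>"
  have s': "s' > 0" unfolding s'_def using insert.prems v[of i] by (intro add_pos_nonneg) auto
  have \<tau>': "\<tau>' \<ge> 0" unfolding \<tau>'_def using insert.prems v[of i] s' by simp
  have sv: "s * v i / s' > 0" using insert.prems v[of i] s' by simp
  have nsq: "(of_real (cmod (c i)))\<^sup>2 = c i * cnj (c i)"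
    by (metis complex_norm_square of_real_power)
  let ?c = "\<lambda>a. \<Sum>i\<in>I. c i * a i" and ?d = "\<lambda>a. \<Sum>i\<in>I. d i * a i"
  have step: "(\<integral>\<^sup>+b. ennreal (complex_normal_density s (?c a + c i * b)) *
        (\<integral>\<^sup>+y. F (\<kappa> * (?c a + c i * b) + (?d a + d i * b) + of_real (sqrt \<tau>) * y) \<partial>complex_gaussian 1)
        \<partial>complex_gaussian (v i))
     = ennreal (complex_normal_density s' (?c a)) *
        (\<integral>\<^sup>+y. F (\<kappa>' * ?c a + ?d a + of_real (sqrt \<tau>') * y) \<partial>complex_gaussian 1)" for a
  proof -
    have "(\<integral>\<^sup>+b. ennreal (complex_normal_density s (?c a + c i * b)) *
        (\<integral>\<^sup>+y. F (\<kappa> * (?c a + c i * b) + (?d a + d i * b) + of_real (sqrt \<tau>) * y) \<partial>complex_gaussian 1)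
        \<partial>complex_gaussian (v i))
      = ennreal (complex_normal_density s' (?c a)) *
        (\<integral>\<^sup>+b. (\<integral>\<^sup>+y. F (\<kappa> * (?c a + c i * (b - of_real (v i / s') * cnj (c i) * ?c a))
            + (?d a + d i * (b - of_real (v i / s') * cnj (c i) * ?c a)) + of_real (sqrt \<tau>) * y) \<partial>complex_gaussian 1)
          \<partial>complex_gaussian (s * v i / s'))"
      unfolding s'_def
      by (rule nn_integral_density_complex_gaussian[OF insert.prems(1) v[of i]]) measurable
    also have "(\<integral>\<^sup>+b. (\<integral>\<^sup>+y. F (\<kappa> * (?c a + c i * (b - of_real (v i / s') * cnj (c i) * ?c a))
            + (?d a + d i * (b - of_real (v i / s') * cnj (c i) * ?c a)) + of_real (sqrt \<tau>) * y) \<partial>complex_gaussian 1)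
          \<partial>complex_gaussian (s * v i / s'))
      = (\<integral>\<^sup>+b. (\<integral>\<^sup>+y. F (\<kappa>' * ?c a + ?d a + (\<beta> * b + of_real (sqrt \<tau>) * y)) \<partial>complex_gaussian 1)
          \<partial>complex_gaussian (s * v i / s'))"
      by (intro nn_integral_cong arg_cong[where f = F]) (simp add: \<kappa>'_def \<beta>_def algebra_simps)
    also have "\<dots> = (\<integral>\<^sup>+y. F (\<kappa>' * ?c a + ?d a + of_real (sqrt \<tau>') * y) \<partial>complex_gaussian 1)"
      using nn_integral_complex_gaussian_linear[OF sv zero_less_one, of "\<lambda>u. F (\<kappa>' * ?c a + ?d a + u)" \<beta> "of_real (sqrt \<tau>)"]
        insert.prems(2) by (simp add: \<tau>'_def)
    finally show ?thesis .
  qed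
  \<comment> \<open>Read the density as the condition \<open>W + e = 0\<close>, where
    \<open>W\<close> is the form with coefficients \<open>c\<close> and \<open>e\<close> is an
    independent variable of variance \<open>s\<close>; under it, \<open>\<kappa> * W\<close> equals
    \<open>- \<kappa> * e\<close>. With \<open>D\<close> the form with coefficients
    \<open>d\<close>, the three expressions shown to be invariant are the variance of
    \<open>W + e\<close>, the covariance of \<open>D - \<kappa> * e\<close> with
    \<open>W + e\<close>, and the variance of \<open>D - \<kappa> * e\<close> plus noise. The
    formula is thus the usual conditional variance.\<close>
  have e1: "s' + (\<Sum>i\<in>I. (cmod (c i))\<^sup>2 * v i) = s + (\<Sum>j\<in>insert i I. (cmod (c j))\<^sup>2 * v j)"
    using insert.hyps by (simp add: s'_def)
  have e2: "(\<Sum>j\<in>I. d j * cnj (c j) * of_real (v j)) - \<kappa>' * of_real s'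
    = (\<Sum>j\<in>insert i I. d j * cnj (c j) * of_real (v j)) - \<kappa> * of_real s"
  proof -
    have "\<kappa>' * of_real s' = \<kappa> * of_real s' - \<beta> * of_real (v i) * cnj (c i)"
      using s' by (simp add: \<kappa>'_def left_diff_distrib)
    also have "\<dots> = \<kappa> * of_real s - d i * cnj (c i) * of_real (v i)"
      using nsq by (simp add: s'_def \<beta>_def algebra_simps)
    finally show ?thesis using insert.hyps by simp
  qed
  have e3: "(\<Sum>j\<in>I. (cmod (d j))\<^sup>2 * v j) + (cmod \<kappa>')\<^sup>2 * s' + \<tau>'
    = (\<Sum>j\<in>insert i I. (cmod (d j))\<^sup>2 * v j) + (cmod \<kappa>)\<^sup>2 * s + \<tau>"
  proof -
    have k: "(cmod \<kappa>')\<^sup>2 = (cmod (\<kappa> * of_real s - d i * cnj (c i) * of_real (v i)))\<^sup>2 / s'\<^sup>2"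
    proof -
      have "\<kappa>' = (\<kappa> * of_real s' - \<beta> * of_real (v i) * cnj (c i)) / of_real s'"
        using s' by (simp add: \<kappa>'_def diff_divide_distrib)
      also have "\<kappa> * of_real s' - \<beta> * of_real (v i) * cnj (c i) = \<kappa> * of_real s - d i * cnj (c i) * of_real (v i)"
        using nsq by (simp add: s'_def \<beta>_def algebra_simps)
      finally show ?thesis using s' by (simp add: norm_divide power_divide)
    qed
    have num: "(cmod (\<kappa> * of_real s - d i * cnj (c i) * of_real (v i)))\<^sup>2 + (cmod \<beta>)\<^sup>2 * (s * v i)
      = ((cmod (d i))\<^sup>2 * v i + (cmod \<kappa>)\<^sup>2 * s) * s'"
      unfolding s'_def \<beta>_def cmod_power2 by (simp add: algebra_simps power2_eq_square)
    have "(cmod \<kappa>')\<^sup>2 * s' + (cmod \<beta>)\<^sup>2 * (s * v i / s') = (cmod (d i))\<^sup>2 * v i + (cmod \<kappa>)\<^sup>2 * s"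
    proof -
      have "x / s'\<^sup>2 * s' + y * (s * v i / s') = (x + y * (s * v i)) / s'" for x y
        using s' by (simp add: power2_eq_square add_divide_distrib)
      then show ?thesis unfolding k using s' by (simp add: num)
    qed
    then show ?thesis
      using insert.hyps by (simp add: \<tau>'_def)
  qed
  have "(\<integral>\<^sup>+a. ennreal (complex_normal_density s (\<Sum>j\<in>insert i I. c j * a j)) *
        (\<integral>\<^sup>+y. F (\<kappa> * (\<Sum>j\<in>insert i I. c j * a j) + (\<Sum>j\<in>insert i I. d j * a j) + of_real (sqrt \<tau>) * y) \<partial>complex_gaussian 1)
      \<partial>(\<Pi>\<^sub>M i\<in>insert i I. complex_gaussian (v i)))
    = (\<integral>\<^sup>+a. (\<integral>\<^sup>+b. ennreal (complex_normal_density s (\<Sum>j\<in>insert i I. c j * (a(i := b)) j)) *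
        (\<integral>\<^sup>+y. F (\<kappa> * (\<Sum>j\<in>insert i I. c j * (a(i := b)) j) + (\<Sum>j\<in>insert i I. d j * (a(i := b)) j) + of_real (sqrt \<tau>) * y) \<partial>complex_gaussian 1)
        \<partial>complex_gaussian (v i)) \<partial>(\<Pi>\<^sub>M i\<in>I. complex_gaussian (v i)))"
    using insert.hyps by (intro product_nn_integral_insert) auto
  also have "\<dots> = (\<integral>\<^sup>+a. (\<integral>\<^sup>+b. ennreal (complex_normal_density s (?c a + c i * b)) *
        (\<integral>\<^sup>+y. F (\<kappa> * (?c a + c i * b) + (?d a + d i * b) + of_real (sqrt \<tau>) * y) \<partial>complex_gaussian 1)
        \<partial>complex_gaussian (v i)) \<partial>(\<Pi>\<^sub>M i\<in>I. complex_gaussian (v i)))"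
  proof -
    have "(\<Sum>j\<in>insert i I. e j * (a(i := b)) j) = (\<Sum>j\<in>I. e j * a j) + e i * b"
      for e a :: "'i \<Rightarrow> complex" and b
    proof -
      have "(\<Sum>j\<in>I. e j * (a(i := b)) j) = (\<Sum>j\<in>I. e j * a j)"
        using insert.hyps by (intro sum.cong) auto
      then show ?thesis using insert.hyps by (simp add: add.commute)
    qed
    then show ?thesis by (simp only:)
  qed
  also have "\<dots> = (\<integral>\<^sup>+a. ennreal (complex_normal_density s' (?c a)) *
        (\<integral>\<^sup>+y. F (\<kappa>' * ?c a + ?d a + of_real (sqrt \<tau>') * y) \<partial>complex_gaussian 1)
       \<partial>(\<Pi>\<^sub>M i\<in>I. complex_gaussian (v i)))"
    by (simp only: step)
  also note insert.IH[OF s' \<tau>', of \<kappa>']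
  finally show ?case
    unfolding e1 e2 e3 .
qed

section \<open>Radial integrals\<close>

text \<open>A disc of squared radius \<open>x\<close> has area \<open>pi * x\<close>, which is
  linear in \<open>x\<close>. Working with the squared modulus therefore gives polar integration
  with a constant density. The half lines \<open>{..x}\<close> form an intersection-stable
  generator.\<close>

lemma distr_cmod_power2_lborel:
  "distr lborel borel (\<lambda>z::complex. (cmod z)\<^sup>2) = density lborel (\<lambda>t. ennreal (pi * indicator {0..} t))"
proof (rule measure_eqI_generator_eq[where E = "range atMost" and \<Omega> = UNIV and A = "\<lambda>n::nat. {..real n}"])
  have ball: "emeasure lborel ((\<lambda>z::complex. (cmod z)\<^sup>2) -` {..x}) = ennreal (pi * max 0 x)" for x
  proof (cases "x \<ge> 0")
    case True
    have "(cmod z)\<^sup>2 \<le> x \<longleftrightarrow> cmod z \<le> sqrt x" for z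
      using real_sqrt_le_iff[of "(cmod z)\<^sup>2" x] by simp
    then have "(\<lambda>z::complex. (cmod z)\<^sup>2) -` {..x} = cball 0 (sqrt x)"
      by auto
    then show ?thesis using True by (simp add: emeasure_cball unit_ball_vol_2)
  next
    case False
    then have "(\<lambda>z::complex. (cmod z)\<^sup>2) -` {..x} = {}"
      using order_trans[OF zero_le_power2] by blast
    then show ?thesis using False by simp
  qed
  show "Int_stable (range atMost :: real set set)"
    by (auto simp: Int_stable_def)
  show "emeasure (distr lborel borel (\<lambda>z::complex. (cmod z)\<^sup>2)) {..real n} \<noteq> \<infinity>" for n
    by (simp add: emeasure_distr ball)
  fix X :: "real set" assume "X \<in> range atMost"
  then obtain x where X: "X = {..x}" by auto
  have "emeasure (density lborel (\<lambda>t. ennreal (pi * indicator {0..} t))) X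
      = (\<integral>\<^sup>+t. ennreal pi * indicator {0..x} t \<partial>lborel)"
    unfolding X by (subst emeasure_density) (auto intro!: nn_integral_cong simp: indicator_def)
  also have "\<dots> = ennreal (pi * max 0 x)"
    by (subst nn_integral_cmult_indicator) (auto simp: ennreal_mult max_def)
  finally show "emeasure (distr lborel borel (\<lambda>z::complex. (cmod z)\<^sup>2)) X
      = emeasure (density lborel (\<lambda>t. ennreal (pi * indicator {0..} t))) X"
    by (simp add: X emeasure_distr ball)
next
  have "sets borel = sigma_sets UNIV (range atMost :: real set set)"
    by (subst borel_eq_atMost) simp
  then show "sets (distr lborel borel (\<lambda>z::complex. (cmod z)\<^sup>2)) = sigma_sets UNIV (range atMost)"
    "sets (density lborel (\<lambda>t::real. ennreal (pi * indicator {0..} t))) = sigma_sets UNIV (range atMost)"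
    by simp_all
  show "(\<Union>n. {..real n}) = UNIV"
    using real_arch_simple by auto
qed auto

lemma nn_integral_radial:
  fixes F :: "real \<Rightarrow> ennreal"
  assumes F: "F \<in> borel_measurable borel"
  shows "(\<integral>\<^sup>+z. F ((cmod z)\<^sup>2) \<partial>lborel) = ennreal pi * (\<integral>\<^sup>+t. indicator {0..} t * F t \<partial>lborel)"
proof -
  note [measurable] = F
  have "(\<integral>\<^sup>+z. F ((cmod z)\<^sup>2) \<partial>lborel) = (\<integral>\<^sup>+t. F t \<partial>distr lborel borel (\<lambda>z::complex. (cmod z)\<^sup>2))"
    by (simp add: nn_integral_distr)
  also have "\<dots> = (\<integral>\<^sup>+t. ennreal pi * (indicator {0..} t * F t) \<partial>lborel)"
    unfolding distr_cmod_power2_lborel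
    by (subst nn_integral_density) (auto intro!: nn_integral_cong simp: indicator_def)
  finally show ?thesis by (simp add: nn_integral_cmult)
qed

text \<open>At \<open>0\<close> only a limit of the primitive is assumed, because the primitives
  below may contain \<open>t * ln t\<close>. The integral over the open half line is then carried to
  the closed one, from which it differs by a null set.\<close>

lemma nn_integral_FTC_half_line:
  fixes f F :: "real \<Rightarrow> real"
  assumes F: "\<And>x. x > 0 \<Longrightarrow> (F has_real_derivative f x) (at x)"
    and f: "\<And>x. x > 0 \<Longrightarrow> isCont f x" "\<And>x. x > 0 \<Longrightarrow> f x \<ge> 0"
    and lim: "(F \<longlongrightarrow> A) (at_right 0)" "(F \<longlongrightarrow> B) at_top"
  shows "(\<integral>\<^sup>+t. indicator {0..} t * ennreal (f t) \<partial>lborel) = ennreal (B - A)"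
proof -
  have "set_integrable lborel (einterval 0 \<infinity>) f" "(LBINT x=0..\<infinity>. f x) = B - A"
    by (rule interval_integral_FTC_nonneg[where F = F and f = f and a = 0 and b = \<infinity> and A = A and B = B];
        use assms in \<open>auto simp: zero_ereal_def ereal_tendsto_simps\<close>)+
  then have i: "integrable lborel (\<lambda>t. indicator {0<..} t * f t)" "(\<integral>t. indicator {0<..} t * f t \<partial>lborel) = B - A"
    by (auto simp: set_integrable_def interval_lebesgue_integral_def set_lebesgue_integral_def einterval_def zero_ereal_def greaterThan_def)
  have "(\<integral>\<^sup>+t. indicator {0..} t * ennreal (f t) \<partial>lborel) = (\<integral>\<^sup>+t. ennreal (indicator {0<..} t * f t) \<partial>lborel)"
    using AE_lborel_singleton[of "0::real"]
    by (intro nn_integral_cong_AE) (auto elim!: eventually_mono simp: indicator_def)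
  also have "\<dots> = ennreal (B - A)"
    unfolding i(2)[symmetric] using f(2)
    by (intro nn_integral_eq_integral i(1)) (auto simp: indicator_def)
  finally show ?thesis .
qed

section \<open>Explicit moments on the half line\<close>

lemma nn_integral_sphere_weight:
  "(\<integral>\<^sup>+t. indicator {0..} t * ennreal (1 / (1 + t)\<^sup>2) \<partial>lborel) = 1"
proof -
  have "(\<integral>\<^sup>+t. indicator {0..} t * ennreal (1 / (1 + t)\<^sup>2) \<partial>lborel) = ennreal (0 - (-1))"
  proof (rule nn_integral_FTC_half_line[where F = "\<lambda>t. - (1 / (1 + t))"])
    show "((\<lambda>t::real. - (1 / (1 + t))) \<longlongrightarrow> -1) (at_right 0)" by real_asymp
    show "((\<lambda>t::real. - (1 / (1 + t))) \<longlongrightarrow> 0) at_top" by real_asymp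
  qed (auto intro!: derivative_eq_intros continuous_intros simp: power2_eq_square)
  then show ?thesis by simp
qed

lemma nn_integral_sphere_weight_ln:
  "(\<integral>\<^sup>+t. indicator {0..} t * ennreal (ln (1 + t) / (1 + t)\<^sup>2) \<partial>lborel) = 1"
proof -
  have "(\<integral>\<^sup>+t. indicator {0..} t * ennreal (ln (1 + t) / (1 + t)\<^sup>2) \<partial>lborel) = ennreal (0 - (-1))"
  proof (rule nn_integral_FTC_half_line[where F = "\<lambda>t. - ((ln (1 + t) + 1) / (1 + t))"])
    show "((\<lambda>t::real. - ((ln (1 + t) + 1) / (1 + t))) \<longlongrightarrow> -1) (at_right 0)" by real_asymp
    show "((\<lambda>t::real. - ((ln (1 + t) + 1) / (1 + t))) \<longlongrightarrow> 0) at_top" by real_asymp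
    show "((\<lambda>t. - ((ln (1 + t) + 1) / (1 + t))) has_real_derivative ln (1 + t) / (1 + t)\<^sup>2) (at t)"
      if "t > 0" for t :: real
    proof -
      have "(1 + t) \<noteq> 0" using that by simp
      then show ?thesis using that
        by (auto intro!: derivative_eq_intros simp: power2_eq_square)
    qed
  qed (auto intro!: continuous_intros)
  then show ?thesis by simp
qed

lemma nn_integral_exp_mult:
  "(\<integral>\<^sup>+t. indicator {0..} t * ennreal (exp (- t) * t) \<partial>lborel) = 1"
proof -
  have "(\<integral>\<^sup>+t. indicator {0..} t * ennreal (exp (- t) * t) \<partial>lborel) = ennreal (0 - (-1))"
  proof (rule nn_integral_FTC_half_line[where F = "\<lambda>t. - (t + 1) * exp (- t)"])
    show "((\<lambda>t::real. - (t + 1) * exp (- t)) \<longlongrightarrow> -1) (at_right 0)" by real_asymp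
    show "((\<lambda>t::real. - (t + 1) * exp (- t)) \<longlongrightarrow> 0) at_top" by real_asymp
  qed (auto intro!: derivative_eq_intros continuous_intros simp: field_simps)
  then show ?thesis by simp
qed

text \<open>For an exponential variable this is the difference between the size-biased and the plain
  mean of the logarithm. Each mean separately involves Euler's constant, whereas the difference has
  an elementary primitive and a nonnegative integrand.\<close>

lemma nn_integral_exp_ln:
  "(\<integral>\<^sup>+t. indicator {0..} t * ennreal (exp (- t) * ((t - 1) * ln t)) \<partial>lborel) = 1"
proof -
  have "(\<integral>\<^sup>+t. indicator {0..} t * ennreal (exp (- t) * ((t - 1) * ln t)) \<partial>lborel) = ennreal (0 - (-1))"
  proof (rule nn_integral_FTC_half_line[where F = "\<lambda>t. - (t * ln t + 1) * exp (- t)"])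
    show "((\<lambda>t::real. - (t * ln t + 1) * exp (- t)) \<longlongrightarrow> -1) (at_right 0)" by real_asymp
    show "((\<lambda>t::real. - (t * ln t + 1) * exp (- t)) \<longlongrightarrow> 0) at_top" by real_asymp
    show "exp (- t) * ((t - 1) * ln t) \<ge> 0" if "t > 0" for t :: real
      using that by (cases "t \<ge> 1") (auto simp: mult_nonpos_nonpos)
  qed (auto intro!: derivative_eq_intros continuous_intros simp: field_simps)
  then show ?thesis by simp
qed

text \<open>The reason for singling out variance \<open>1/2\<close>: there the squared modulus is a
  standard exponential variable.\<close>

lemma nn_integral_complex_gaussian_radial:
  fixes F :: "real \<Rightarrow> ennreal"
  assumes F: "F \<in> borel_measurable borel"
  shows "(\<integral>\<^sup>+u. F ((cmod u)\<^sup>2) \<partial>complex_gaussian (1/2))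
    = (\<integral>\<^sup>+t. indicator {0..} t * (ennreal (exp (- t)) * F t) \<partial>lborel)"
proof -
  note [measurable] = F
  have "(\<integral>\<^sup>+u. F ((cmod u)\<^sup>2) \<partial>complex_gaussian (1/2))
    = (\<integral>\<^sup>+u. ennreal (exp (- (cmod u)\<^sup>2) / pi) * F ((cmod u)\<^sup>2) \<partial>lborel)"
    by (subst nn_integral_complex_gaussian) (auto simp: complex_normal_density_def)
  also have "\<dots> = ennreal pi * (\<integral>\<^sup>+t. indicator {0..} t * (ennreal (exp (- t) / pi) * F t) \<partial>lborel)"
    by (rule nn_integral_radial) measurable
  also have "\<dots> = (\<integral>\<^sup>+t. ennreal pi * (indicator {0..} t * (ennreal (exp (- t) / pi) * F t)) \<partial>lborel)"
    by (rule nn_integral_cmult[symmetric]) measurable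
  also have "\<dots> = (\<integral>\<^sup>+t. indicator {0..} t * (ennreal (exp (- t)) * F t) \<partial>lborel)"
  proof (intro nn_integral_cong)
    fix t :: real
    have "ennreal (exp (- t)) = ennreal pi * ennreal (exp (- t) / pi)"
      by (simp add: ennreal_mult'[symmetric])
    then show "ennreal pi * (indicator {0..} t * (ennreal (exp (- t) / pi) * F t))
      = indicator {0..} t * (ennreal (exp (- t)) * F t)"
      by (simp add: mult_ac)
  qed
  finally show ?thesis .
qed

lemma nn_integral_complex_gaussian_power2:
  "(\<integral>\<^sup>+u. ennreal ((cmod u)\<^sup>2) \<partial>complex_gaussian (1/2)) = 1"
  using nn_integral_exp_mult by (simp add: nn_integral_complex_gaussian_radial ennreal_mult'[symmetric])

text \<open>Dominates the logarithm by a function whose exponential integral is known, which settles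
  integrability at \<open>0\<close> and at infinity at once. At distance at least \<open>1/2\<close>
  from \<open>1\<close> the factor \<open>t - 1\<close> compensates for the constant
  \<open>2\<close>; closer to \<open>1\<close> the logarithm is bounded by the additive
  \<open>1\<close>.\<close>

lemma abs_ln_le:
  fixes t :: real
  assumes "t \<ge> 0"
  shows "\<bar>ln t\<bar> \<le> 2 * ((t - 1) * ln t) + 1"
proof (cases "t = 0")
  case False
  then have t: "t > 0" using assms by simp
  have eq: "(t - 1) * ln t = \<bar>t - 1\<bar> * \<bar>ln t\<bar>"
  proof -
    have "(t - 1) * ln t \<ge> 0"
      using t by (cases "t \<ge> 1") (auto simp: mult_nonpos_nonpos)
    then show ?thesis by (simp add: abs_mult[symmetric])
  qed
  show ?thesis
  proof (cases "\<bar>t - 1\<bar> \<ge> 1/2")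
    case True
    then have "1/2 * \<bar>ln t\<bar> \<le> \<bar>t - 1\<bar> * \<bar>ln t\<bar>"
      by (intro mult_right_mono) auto
    then show ?thesis unfolding eq by simp
  next
    case False
    then have "t \<ge> 1/2" "t \<le> 3/2" by (auto simp: abs_if split: if_splits)
    have "ln t \<le> 1" using ln_le_minus_one[OF t] \<open>t \<le> 3/2\<close> by simp
    moreover have "ln t \<ge> -1"
    proof -
      have "ln (1/t) \<le> 1/t - 1" using t by (intro ln_le_minus_one) simp
      moreover have "1/t \<le> 2" using \<open>t \<ge> 1/2\<close> t by (simp add: field_simps)
      ultimately show ?thesis using t by (simp add: ln_div)
    qed
    moreover have "(t - 1) * ln t \<ge> 0" unfolding eq by simp
    ultimately show ?thesis by simp
  qed
qed simp

text \<open>With \<open>T = |u|^2\<close> the two integrands differ by half of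
  \<open>(T - 1) * ln T\<close>, which has mean \<open>1\<close>. Only this difference is computed;
  the mean of \<open>ln |u|\<close> itself stays symbolic until it cancels.\<close>

lemma complex_gaussian_ln:
  shows "integrable (complex_gaussian (1/2)) (\<lambda>u. ln (cmod u))"
    and "integrable (complex_gaussian (1/2)) (\<lambda>u. (cmod u)\<^sup>2 * ln (cmod u))"
    and "(\<integral>u. (cmod u)\<^sup>2 * ln (cmod u) \<partial>complex_gaussian (1/2)) = (\<integral>u. ln (cmod u) \<partial>complex_gaussian (1/2)) + 1/2"
proof -
  let ?H = "complex_gaussian (1/2)"
  interpret H: prob_space ?H by (rule prob_space_complex_gaussian) simp
  define g where "g = (\<lambda>t::real. (t - 1) * ln t)"
  have [measurable]: "g \<in> borel_measurable borel" unfolding g_def by measurable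
  have g_nonneg: "g t \<ge> 0" if "t \<ge> 0" for t
  proof (cases "t = 0")
    case False
    then show ?thesis using that unfolding g_def
      by (cases "t \<ge> 1") (auto simp: mult_nonpos_nonpos)
  qed (simp add: g_def)
  have nn: "(\<integral>\<^sup>+u. ennreal (g ((cmod u)\<^sup>2)) \<partial>?H) = 1"
  proof -
    have "(\<integral>\<^sup>+u. ennreal (g ((cmod u)\<^sup>2)) \<partial>?H)
      = (\<integral>\<^sup>+t. indicator {0..} t * (ennreal (exp (- t)) * ennreal (g t)) \<partial>lborel)"
      by (rule nn_integral_complex_gaussian_radial) measurable
    also have "\<dots> = 1"
      using nn_integral_exp_ln by (simp only: g_def ennreal_mult'[symmetric] exp_ge_zero)
    finally show ?thesis .
  qed
  have ig: "integrable ?H (\<lambda>u. g ((cmod u)\<^sup>2))"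
    by (rule integrableI_nonneg) (auto simp: nn g_nonneg)
  have Ig: "(\<integral>u. g ((cmod u)\<^sup>2) \<partial>?H) = 1"
    by (subst integral_eq_nn_integral) (auto simp: nn g_nonneg)
  have "integrable ?H (\<lambda>u. ln ((cmod u)\<^sup>2))"
  proof (rule Bochner_Integration.integrable_bound)
    show "integrable ?H (\<lambda>u. 2 * g ((cmod u)\<^sup>2) + 1)" using ig by simp
    show "AE u in ?H. norm (ln ((cmod u)\<^sup>2)) \<le> norm (2 * g ((cmod u)\<^sup>2) + 1)"
    proof (intro AE_I2)
      fix u
      have "\<bar>ln ((cmod u)\<^sup>2)\<bar> \<le> 2 * g ((cmod u)\<^sup>2) + 1"
        unfolding g_def by (rule abs_ln_le) simp
      then show "norm (ln ((cmod u)\<^sup>2)) \<le> norm (2 * g ((cmod u)\<^sup>2) + 1)" by simp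
    qed
  qed measurable
  then show l: "integrable ?H (\<lambda>u. ln (cmod u))"
    by (simp add: ln_realpow)
  \<comment> \<open>This holds at \<open>u = 0\<close> as well, because
    \<open>ln 0 = 0\<close>.\<close>
  have eq: "(cmod u)\<^sup>2 * ln (cmod u) = ln (cmod u) + 1/2 * g ((cmod u)\<^sup>2)" for u
    by (simp add: g_def ln_realpow algebra_simps)
  show "integrable ?H (\<lambda>u. (cmod u)\<^sup>2 * ln (cmod u))"
    unfolding eq using l ig by simp
  show "(\<integral>u. (cmod u)\<^sup>2 * ln (cmod u) \<partial>?H) = (\<integral>u. ln (cmod u) \<partial>?H) + 1/2"
    unfolding eq using l ig Ig by simp
qed

text \<open>The normalised area of the unit sphere in the stereographic coordinate.\<close>
definition sphere_measure :: "complex measure" where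
  "sphere_measure = density lborel (\<lambda>z. ennreal (1 / (pi * (1 + (cmod z)\<^sup>2)\<^sup>2)))"

lemma sets_sphere_measure [simp, measurable_cong]: "sets sphere_measure = sets borel"
  by (simp add: sphere_measure_def)

lemma space_sphere_measure [simp]: "space sphere_measure = UNIV"
  by (simp add: sphere_measure_def)

lemma nn_integral_sphere_measure:
  fixes F :: "complex \<Rightarrow> ennreal"
  assumes "F \<in> borel_measurable borel"
  shows "(\<integral>\<^sup>+z. F z \<partial>sphere_measure) = (\<integral>\<^sup>+z. ennreal (1 / (pi * (1 + (cmod z)\<^sup>2)\<^sup>2)) * F z \<partial>lborel)"
  using assms unfolding sphere_measure_def by (subst nn_integral_density) auto

lemma nn_integral_sphere_measure_radial:
  fixes F :: "real \<Rightarrow> ennreal"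
  assumes F: "F \<in> borel_measurable borel"
  shows "(\<integral>\<^sup>+z. F ((cmod z)\<^sup>2) \<partial>sphere_measure)
    = (\<integral>\<^sup>+t. indicator {0..} t * (ennreal (1 / (1 + t)\<^sup>2) * F t) \<partial>lborel)"
proof -
  note [measurable] = F
  have "(\<integral>\<^sup>+z. F ((cmod z)\<^sup>2) \<partial>sphere_measure)
    = ennreal pi * (\<integral>\<^sup>+t. indicator {0..} t * (ennreal (1 / (pi * (1 + t)\<^sup>2)) * F t) \<partial>lborel)"
    by (subst nn_integral_sphere_measure) (auto intro!: nn_integral_radial[where F = "\<lambda>t. ennreal (1 / (pi * (1 + t)\<^sup>2)) * F t"])
  also have "\<dots> = (\<integral>\<^sup>+t. ennreal pi * (indicator {0..} t * (ennreal (1 / (pi * (1 + t)\<^sup>2)) * F t)) \<partial>lborel)"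
    by (rule nn_integral_cmult[symmetric]) measurable
  also have "\<dots> = (\<integral>\<^sup>+t. indicator {0..} t * (ennreal (1 / (1 + t)\<^sup>2) * F t) \<partial>lborel)"
  proof (intro nn_integral_cong)
    fix t :: real
    have "ennreal (1 / (1 + t)\<^sup>2) = ennreal pi * ennreal (1 / (pi * (1 + t)\<^sup>2))"
      by (simp add: ennreal_mult'[symmetric])
    then show "ennreal pi * (indicator {0..} t * (ennreal (1 / (pi * (1 + t)\<^sup>2)) * F t))
      = indicator {0..} t * (ennreal (1 / (1 + t)\<^sup>2) * F t)"
      by (simp add: mult_ac)
  qed
  finally show ?thesis .
qed

lemma prob_space_sphere_measure: "prob_space sphere_measure"
proof
  have "(\<integral>\<^sup>+z. 1 \<partial>sphere_measure) = 1"
    using nn_integral_sphere_measure_radial[of "\<lambda>_. 1"] nn_integral_sphere_weight by simp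
  then show "emeasure sphere_measure (space sphere_measure) = 1"
    by simp
qed

lemma sphere_measure_ln:
  shows "integrable sphere_measure (\<lambda>z. ln (1 + (cmod z)\<^sup>2))"
    and "(\<integral>z. ln (1 + (cmod z)\<^sup>2) \<partial>sphere_measure) = 1"
proof -
  have "(\<integral>\<^sup>+z. ennreal (ln (1 + (cmod z)\<^sup>2)) \<partial>sphere_measure) = 1"
  proof -
    have "(\<integral>\<^sup>+z. ennreal (ln (1 + (cmod z)\<^sup>2)) \<partial>sphere_measure)
      = (\<integral>\<^sup>+t. indicator {0..} t * (ennreal (1 / (1 + t)\<^sup>2) * ennreal (ln (1 + t))) \<partial>lborel)"
      by (rule nn_integral_sphere_measure_radial) measurable
    also have "\<dots> = 1"
      using nn_integral_sphere_weight_ln by (simp add: ennreal_mult'[symmetric])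
    finally show ?thesis .
  qed
  then show "integrable sphere_measure (\<lambda>z. ln (1 + (cmod z)\<^sup>2))"
    "(\<integral>z. ln (1 + (cmod z)\<^sup>2) \<partial>sphere_measure) = 1"
    by (auto intro!: integrableI_nonneg simp: integral_eq_nn_integral)
qed

section \<open>Measurability of sums over the roots\<close>

text \<open>Having at least \<open>m\<close> roots in a closed set is a \<open>\<sigma>\<close>-compact condition on the coefficients, because
  the coefficients depend continuously on the roots and the leading coefficient. Hence the number
  of roots in a closed set is a measurable function of the coefficients.\<close>
definition poly_with_roots_in :: "complex set list \<Rightarrow> real \<Rightarrow> complex poly set" where
  "poly_with_roots_in Ks r =
    {smult c (\<Prod>z\<leftarrow>zs. [:- z, 1:]) | c zs. cmod c \<le> r \<and> list_all2 (\<in>) zs Ks}"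

lemma poly_with_roots_in_Cons:
  "poly_with_roots_in (K # Ks) r = (\<lambda>(z, p). [:- z, 1:] * p) ` (K \<times> poly_with_roots_in Ks r)"
proof (intro equalityI subsetI)
  fix p assume "p \<in> poly_with_roots_in (K # Ks) r"
  then obtain c z zs where *: "p = smult c (\<Prod>z\<leftarrow>z # zs. [:- z, 1:])" "cmod c \<le> r" "z \<in> K" "list_all2 (\<in>) zs Ks"
    unfolding poly_with_roots_in_def by (auto simp: list_all2_Cons2)
  then have "p = [:- z, 1:] * smult c (\<Prod>z\<leftarrow>zs. [:- z, 1:])"
    by (simp add: mult_ac)
  with * show "p \<in> (\<lambda>(z, p). [:- z, 1:] * p) ` (K \<times> poly_with_roots_in Ks r)"
    unfolding poly_with_roots_in_def
    by (intro image_eqI[of _ _ "(z, smult c (\<Prod>z\<leftarrow>zs. [:- z, 1:]))"])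
      (auto simp del: mult_pCons_left)
next
  fix p assume "p \<in> (\<lambda>(z, p). [:- z, 1:] * p) ` (K \<times> poly_with_roots_in Ks r)"
  then obtain c z zs where *: "p = [:- z, 1:] * smult c (\<Prod>z\<leftarrow>zs. [:- z, 1:])" "cmod c \<le> r" "z \<in> K" "list_all2 (\<in>) zs Ks"
    unfolding poly_with_roots_in_def by (auto simp del: mult_pCons_left)
  then have "p = smult c (\<Prod>z\<leftarrow>z # zs. [:- z, 1:])"
    by (simp add: mult_ac)
  with * show "p \<in> poly_with_roots_in (K # Ks) r"
    unfolding poly_with_roots_in_def by (auto intro!: exI[of _ c] exI[of _ "z # zs"])
qed

text \<open>Polynomials are regarded as coefficient sequences in the product topology.
  Multiplication by a linear factor is jointly continuous in the root and in the coefficients, so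
  each further root yields a continuous image of a product of compact sets.\<close>

lemma compact_coeff_poly_with_roots_in:
  assumes "\<And>K. K \<in> set Ks \<Longrightarrow> compact K"
  shows "compact (coeff ` poly_with_roots_in Ks r)"
  using assms
proof (induction Ks)
  case Nil
  have "coeff ` poly_with_roots_in [] r = (\<lambda>c k. if k = 0 then c else 0) ` cball 0 r"
  proof -
    have "poly_with_roots_in [] r = (\<lambda>c. [:c:]) ` cball 0 r"
      by (auto simp: poly_with_roots_in_def)
    moreover have "coeff [:c:] = (\<lambda>k. if k = 0 then c else 0)" for c :: complex
      by (auto simp: coeff_pCons split: nat.split)
    ultimately show ?thesis by (simp add: image_image)
  qed
  moreover have cont: "continuous_on (cball 0 r) (\<lambda>(c::complex) k::nat. if k = 0 then c else 0)"
  proof (rule continuous_on_coordinatewise_then_product)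
    show "continuous_on (cball 0 r) (\<lambda>x::complex. if k = 0 then x else 0)" for k :: nat
      by (cases "k = 0") (auto intro: continuous_intros)
  qed
  ultimately show ?case
    using compact_continuous_image[OF cont compact_cball] by simp
next
  case (Cons K Ks)
  let ?h = "\<lambda>(z::complex, a::nat \<Rightarrow> complex) k. (if k = 0 then 0 else a (k - 1)) - z * a k"
  have "coeff ([:- z, 1:] * p) = ?h (z, coeff p)" for z p
    by (auto simp: coeff_pCons split: nat.split)
  then have "coeff ` poly_with_roots_in (K # Ks) r = ?h ` (K \<times> coeff ` poly_with_roots_in Ks r)"
    unfolding poly_with_roots_in_Cons by (force simp: image_iff)
  moreover have cont: "continuous_on (K \<times> coeff ` poly_with_roots_in Ks r) ?h"
  proof (rule continuous_on_coordinatewise_then_product)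
    fix k :: nat
    have "continuous_on A (\<lambda>x. snd x j)" for A :: "(complex \<times> (nat \<Rightarrow> complex)) set" and j
      by (intro continuous_on_compose2[OF continuous_on_product_coordinates continuous_on_snd[OF continuous_on_id]]) auto
    then show "continuous_on (K \<times> coeff ` poly_with_roots_in Ks r) (\<lambda>x. ?h x k)"
      by (cases "k = 0") (auto simp: split_beta intro!: continuous_intros)
  qed
  moreover have cpt: "compact (K \<times> coeff ` poly_with_roots_in Ks r)"
    using Cons by (intro compact_Times) auto
  ultimately show ?case
    using compact_continuous_image[OF cont cpt] by simp
qed

lemma proots_smult_prod:
  assumes "c \<noteq> 0"
  shows "proots (smult c (\<Prod>z\<leftarrow>zs. [:- z, 1:])) = mset (zs :: complex list)"
proof -
  have "proots (\<Prod>z\<leftarrow>zs. [:- z, 1:]) = mset zs"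
  proof (induction zs)
    case (Cons a zs)
    have "(\<Prod>z\<leftarrow>zs. [:- z, 1:]) \<noteq> 0"
      by (auto simp: prod_list_zero_iff)
    then have "proots ([:- a, 1:] * (\<Prod>z\<leftarrow>zs. [:- z, 1:])) = proots [:- a, 1:] + proots (\<Prod>z\<leftarrow>zs. [:- z, 1:])"
      by (intro proots_mult) auto
    then show ?case
      using Cons proots_linear_factor[of "- a"] by (simp del: mult_pCons_left)
  qed simp
  then show ?thesis using assms by (simp add: proots_smult)
qed

text \<open>The number \<open>m\<close> of roots is confined to \<open>F\<close>, the other
  \<open>d\<close> roots are free, and the single bound \<open>n\<close> controls all the roots and
  the leading coefficient. The right side is thus a countable union of sets with compact coefficient
  images when \<open>F\<close> is closed. The zero polynomial has to be removed because it can enter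
  these sets through \<open>c = 0\<close>, although \<open>proots 0\<close> is empty.\<close>

lemma root_count_ge_iff:
  fixes p :: "complex poly"
  assumes "m > 0"
  shows "size (filter_mset (\<lambda>z. z \<in> F) (proots p)) \<ge> m \<longleftrightarrow>
    p \<noteq> 0 \<and> (\<exists>d n. p \<in> poly_with_roots_in (replicate m (F \<inter> cball 0 (real n)) @ replicate d (cball 0 (real n))) (real n))"
    (is "?L \<longleftrightarrow> ?R")
proof
  assume L: ?L
  then have p: "p \<noteq> 0" using assms by auto
  obtain xs where xs: "mset xs = filter_mset (\<lambda>z. z \<in> F) (proots p)" by (metis ex_mset)
  obtain ys where ys: "mset ys = filter_mset (\<lambda>z. z \<notin> F) (proots p)" by (metis ex_mset)
  have m: "mset (xs @ ys) = proots p" by (simp add: xs ys)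
  have xsF: "set xs \<subseteq> F" using xs by (metis (mono_tags, lifting) mem_Collect_eq set_mset_filter set_mset_mset subsetI)
  have lxs: "m \<le> length xs" using L xs by (metis size_mset)
  obtain n where n: "\<forall>x \<in> insert (lead_coeff p) (set (xs @ ys)). cmod x \<le> real n"
  proof -
    let ?S = "insert (lead_coeff p) (set (xs @ ys))"
    have "cmod x \<le> Max (cmod ` ?S)" if "x \<in> ?S" for x
      using that by (intro Max_ge) auto
    then show ?thesis using that real_arch_simple[of "Max (cmod ` ?S)"] by (meson order_trans)
  qed
  have "p = smult (lead_coeff p) (\<Prod>z\<in>#proots p. [:- z, 1:])"
    by (rule complex_poly_decompose_multiset[symmetric])
  also have "(\<Prod>z\<in>#proots p. [:- z, 1:]) = (\<Prod>z\<leftarrow>xs @ ys. [:- z, 1:])"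
    unfolding m[symmetric] by (simp add: prod_mset_prod_list flip: mset_map)
  finally have eq: "p = smult (lead_coeff p) (\<Prod>z\<leftarrow>xs @ ys. [:- z, 1:])" .
  define d where "d = length (xs @ ys) - m"
  have "list_all2 (\<in>) (xs @ ys) (replicate m (F \<inter> cball 0 (real n)) @ replicate d (cball 0 (real n)))"
    unfolding list_all2_conv_all_nth
  proof (intro conjI allI impI)
    show "length (xs @ ys) = length (replicate m (F \<inter> cball 0 (real n)) @ replicate d (cball 0 (real n)))"
      using lxs by (simp add: d_def)
    fix i assume i: "i < length (xs @ ys)"
    then have mem: "cmod ((xs @ ys) ! i) \<le> real n" using n nth_mem[OF i] by blast
    show "(xs @ ys) ! i \<in> (replicate m (F \<inter> cball 0 (real n)) @ replicate d (cball 0 (real n))) ! i"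
    proof (cases "i < m")
      case True
      then have "(xs @ ys) ! i \<in> set xs" using lxs by (simp add: nth_append)
      then show ?thesis using True mem xsF by (auto simp: nth_append)
    next
      case False
      then show ?thesis using mem i lxs by (simp add: nth_append d_def)
    qed
  qed
  then have "p \<in> poly_with_roots_in (replicate m (F \<inter> cball 0 (real n)) @ replicate d (cball 0 (real n))) (real n)"
    unfolding poly_with_roots_in_def using eq n by blast
  then show ?R using p by blast
next
  assume ?R
  then obtain d n c zs where p: "p \<noteq> 0" "p = smult c (\<Prod>z\<leftarrow>zs. [:- z, 1:])"
    and zs: "list_all2 (\<in>) zs (replicate m (F \<inter> cball 0 (real n)) @ replicate d (cball 0 (real n)))"
    unfolding poly_with_roots_in_def by blast
  then have "proots p = mset zs" using proots_smult_prod[of c zs] by fastforce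
  moreover obtain us vs where uv: "zs = us @ vs" "list_all2 (\<in>) us (replicate m (F \<inter> cball 0 (real n)))"
    using zs by (auto simp: list_all2_append2)
  have "length us = m" using uv(2) by (auto dest: list_all2_lengthD)
  moreover have "set us \<subseteq> F"
    using uv(2) by (auto simp: list_all2_conv_all_nth in_set_conv_nth)
  then have "filter_mset (\<lambda>z. z \<in> F) (mset us) = mset us"
    by (intro filter_mset_eq_conv[THEN iffD2]) auto
  ultimately show ?L using uv(1) by simp
qed

text \<open>Carries only the measurable structure of the coefficient vectors, so that measurability
  of root sums can be settled without reference to the variances.\<close>

definition coeff_space :: "nat \<Rightarrow> (nat \<Rightarrow> complex) measure" where
  "coeff_space N = (\<Pi>\<^sub>M k\<in>{0..N}. borel)"

lemma coeff_rand_poly: "coeff (rand_poly N a) k = (if k \<le> N then a k else 0)"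
proof -
  have "coeff (rand_poly N a) k = (\<Sum>j\<le>N. if j = k then a j else 0)"
    by (simp add: rand_poly_def coeff_sum)
  then show ?thesis by simp
qed

lemma measurable_coeff_rand_poly [measurable]: "(\<lambda>a. coeff (rand_poly N a)) \<in> coeff_space N \<rightarrow>\<^sub>M borel"
proof (rule measurable_coordinatewise_then_product)
  show "(\<lambda>a. coeff (rand_poly N a) k) \<in> borel_measurable (coeff_space N)" for k
    unfolding coeff_rand_poly coeff_space_def by (cases "k \<le> N") auto
qed

lemma measurable_root_count_closed:
  assumes "closed F"
  shows "(\<lambda>a. ennreal (real (size (filter_mset (\<lambda>z. z \<in> F) (proots (rand_poly N a)))))) \<in> borel_measurable (coeff_space N)"
proof -
  let ?c = "\<lambda>a. size (filter_mset (\<lambda>z. z \<in> F) (proots (rand_poly N a)))"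
  have meas: "{a \<in> space (coeff_space N). ?c a \<ge> m} \<in> sets (coeff_space N)" if "m > 0" for m
  proof -
    define S where "S = (\<Union>d. \<Union>n. coeff ` poly_with_roots_in (replicate m (F \<inter> cball 0 (real n)) @ replicate d (cball 0 (real n))) (real n)) - {coeff 0}"
    have "S \<in> sets borel"
    proof -
      have [measurable]: "coeff ` poly_with_roots_in (replicate m (F \<inter> cball 0 (real n)) @ replicate d (cball 0 (real n))) (real n) \<in> sets borel" for d n
        using assms
        by (intro borel_closed compact_imp_closed compact_coeff_poly_with_roots_in) (auto intro: closed_Int_compact)
      have [measurable]: "{coeff (0 :: complex poly)} \<in> sets borel"
        by (intro borel_closed) simp
      show ?thesis unfolding S_def by measurable
    qed
    moreover have "?c a \<ge> m \<longleftrightarrow> coeff (rand_poly N a) \<in> S" for a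
      unfolding S_def root_count_ge_iff[OF that] by (auto simp: image_iff coeff_inject)
    then have "{a \<in> space (coeff_space N). ?c a \<ge> m} = (\<lambda>a. coeff (rand_poly N a)) -` S \<inter> space (coeff_space N)"
      by auto
    ultimately show ?thesis by simp
  qed
  have "?c a \<le> N" for a
  proof -
    have "?c a \<le> size (proots (rand_poly N a))" by (rule size_filter_mset_lesseq)
    also have "\<dots> \<le> N" by (auto simp: size_proots_complex coeff_rand_poly intro!: degree_le)
    finally show ?thesis .
  qed
  \<comment> \<open>A count bounded by \<open>N\<close> equals the number of thresholds
    \<open>m\<close> in \<open>{1..N}\<close> that it reaches, and each threshold condition is
    measurable.\<close>
  then have "real (?c a) = (\<Sum>m\<in>{1..N}. if m \<le> ?c a then 1 else 0)" for a
  proof -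
    have "{m \<in> {1..N}. m \<le> ?c a} = {1..?c a}" using \<open>?c a \<le> N\<close> by auto
    then show ?thesis by (simp add: sum.If_cases Int_def)
  qed
  moreover have "(\<lambda>a. \<Sum>m\<in>{1..N}. if m \<le> ?c a then 1 else 0 :: real) \<in> borel_measurable (coeff_space N)"
    using meas by (intro borel_measurable_sum measurable_If) auto
  ultimately show ?thesis by simp
qed

section \<open>Root sums as integrals against a measurable kernel\<close>

lemma nn_integral_pmf_of_multiset:
  fixes \<phi> :: "'a \<Rightarrow> ennreal"
  assumes "A \<noteq> {#}"
  shows "ennreal (real (size A)) * (\<integral>\<^sup>+z. \<phi> z \<partial>measure_pmf (pmf_of_multiset A)) = (\<Sum>z\<in>#A. \<phi> z)"
proof -
  \<comment> \<open>Stated for submultisets \<open>B\<close> with the index set fixed at that of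
    \<open>A\<close>, so that the range of the sum does not change when an element is added.\<close>
  have count: "(\<Sum>z\<in>#B. \<phi> z) = (\<Sum>z\<in>set_mset A. \<phi> z * ennreal (real (count B z)))" if "B \<subseteq># A" for B
    using that
  proof (induction B)
    case (add x B)
    then have x: "x \<in># A" "B \<subseteq># A" by (auto dest: mset_subset_eq_insertD subset_mset.less_imp_le)
    have "(\<Sum>z\<in>set_mset A. \<phi> z * ennreal (real (count (add_mset x B) z)))
      = (\<Sum>z\<in>set_mset A. \<phi> z * ennreal (real (count B z)) + (if z = x then \<phi> z else 0))"
      by (intro sum.cong) (auto simp: distrib_left add.commute)
    also have "\<dots> = (\<Sum>z\<in>#B. \<phi> z) + \<phi> x"
      using x add by (simp add: sum.distrib)
    finally show ?case by (simp add: add.commute)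
  qed simp
  have n: "size A > 0" using assms by (simp add: nonempty_has_size)
  have "ennreal (real (size A)) * (\<integral>\<^sup>+z. \<phi> z \<partial>measure_pmf (pmf_of_multiset A))
    = (\<Sum>z\<in>set_mset A. \<phi> z * (ennreal (real (size A)) * ennreal (real (count A z) / real (size A))))"
    using assms by (subst nn_integral_measure_pmf_finite) (auto simp: sum_distrib_left mult_ac)
  also have "\<dots> = (\<Sum>z\<in>set_mset A. \<phi> z * ennreal (real (count A z)))"
    using n by (intro sum.cong) (auto simp flip: ennreal_mult')
  finally show ?thesis using count[of A] by simp
qed

text \<open>A uniformly chosen root, counted with multiplicity, turns root sums into integrals
  against a probability kernel. The default point \<open>0\<close> is harmless: without roots the
  prefactor in \<open>sum_roots_eq\<close> is \<open>0\<close>.\<close>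

definition root_pmf :: "nat \<Rightarrow> (nat \<Rightarrow> complex) \<Rightarrow> complex pmf" where
  "root_pmf N a = (if proots (rand_poly N a) = {#} then return_pmf 0 else pmf_of_multiset (proots (rand_poly N a)))"

lemma sum_roots_eq:
  "(\<Sum>z\<in>#proots (rand_poly N a). \<phi> z)
    = ennreal (real (size (proots (rand_poly N a)))) * (\<integral>\<^sup>+z. \<phi> z \<partial>measure_pmf (root_pmf N a))"
  by (simp add: root_pmf_def nn_integral_pmf_of_multiset)

lemma measurable_root_count:
  "(\<lambda>a. ennreal (real (size (proots (rand_poly N a))))) \<in> borel_measurable (coeff_space N)"
  using measurable_root_count_closed[of UNIV N] by simp

text \<open>Closed sets are an intersection-stable generator of the Borel sets, so the measurable
  counts of roots in closed sets suffice. The identity \<open>distr\<close> replaces the discrete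
  sigma-algebra of a \<open>pmf\<close> by \<open>borel\<close>. As a kernel, the root law can
  integrate functions that depend on the coefficients too, such as those of
  \<open>f'(z)\<close>.\<close>

lemma measurable_root_kernel:
  "(\<lambda>a. distr (measure_pmf (root_pmf N a)) borel (\<lambda>z. z)) \<in> coeff_space N \<rightarrow>\<^sub>M subprob_algebra borel"
proof (rule measurable_subprob_algebra_generated[where G = "Collect closed" and \<Omega> = UNIV])
  show "sets borel = sigma_sets UNIV (Collect closed :: complex set set)"
    by (subst borel_eq_closed) simp
  show "Int_stable (Collect closed :: complex set set)"
    by (auto simp: Int_stable_def)
  have K: "emeasure (distr (measure_pmf (root_pmf N a)) borel (\<lambda>z. z)) F
    = (if size (proots (rand_poly N a)) = 0 then indicator F 0
       else ennreal (real (size (filter_mset (\<lambda>z. z \<in> F) (proots (rand_poly N a)))))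
         / ennreal (real (size (proots (rand_poly N a)))))" if "F \<in> sets borel" for F a
  proof (cases "proots (rand_poly N a) = {#}")
    case True
    then show ?thesis using that by (simp add: emeasure_distr root_pmf_def)
  next
    case False
    let ?A = "proots (rand_poly N a)"
    have n: "size ?A > 0" using False by (simp add: nonempty_has_size)
    have "ennreal (real (size ?A)) * emeasure (measure_pmf (root_pmf N a)) F = (\<Sum>z\<in>#?A. indicator F z)"
      using sum_roots_eq[of "indicator F" N a] by simp
    also have "\<dots> = ennreal (real (size (filter_mset (\<lambda>z. z \<in> F) ?A)))"
    proof -
      have "(\<Sum>z\<in>#A. indicator F z) = ennreal (real (size (filter_mset (\<lambda>z. z \<in> F) A)))" for A
        by (induction A) (auto simp: indicator_def)
      then show ?thesis .
    qed
    finally have eq: "ennreal (real (size ?A)) * emeasure (measure_pmf (root_pmf N a)) F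
      = ennreal (real (size (filter_mset (\<lambda>z. z \<in> F) ?A)))" .
    have "emeasure (measure_pmf (root_pmf N a)) F
      = emeasure (measure_pmf (root_pmf N a)) F * ennreal (real (size ?A)) / ennreal (real (size ?A))"
      using n by (subst ennreal_mult_divide_eq) auto
    then show ?thesis
      using that False eq by (simp add: emeasure_distr mult.commute)
  qed
  note [measurable] = measurable_root_count
  have "{a \<in> space (coeff_space N). ennreal (real (size (proots (rand_poly N a)))) = 0} \<in> sets (coeff_space N)"
    by measurable
  then have Z: "{a \<in> space (coeff_space N). size (proots (rand_poly N a)) = 0} \<in> sets (coeff_space N)"
    by simp
  show M: "(\<lambda>a. emeasure (distr (measure_pmf (root_pmf N a)) borel (\<lambda>z. z)) F) \<in> borel_measurable (coeff_space N)"
    if "F \<in> Collect closed" for F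
  proof -
    have F: "closed F" "F \<in> sets borel" using that by auto
    note [measurable] = measurable_root_count measurable_root_count_closed[OF F(1)]
    show ?thesis unfolding K[OF F(2)] using Z by (intro measurable_If) auto
  qed
  show "(\<lambda>a. emeasure (distr (measure_pmf (root_pmf N a)) borel (\<lambda>z. z)) UNIV) \<in> borel_measurable (coeff_space N)"
    by (rule M) simp
  show "subprob_space (distr (measure_pmf (root_pmf N a)) borel (\<lambda>z. z))" for a
    by (intro prob_space_imp_subprob_space prob_space.prob_space_distr measure_pmf.prob_space_axioms) simp
qed auto

lemma measurable_sum_roots:
  fixes \<phi> :: "(nat \<Rightarrow> complex) \<Rightarrow> complex \<Rightarrow> ennreal"
  assumes "(\<lambda>(a, z). \<phi> a z) \<in> borel_measurable (coeff_space N \<Otimes>\<^sub>M borel)"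
  shows "(\<lambda>a. \<Sum>z\<in>#proots (rand_poly N a). \<phi> a z) \<in> borel_measurable (coeff_space N)"
proof -
  have "(\<lambda>a. \<integral>\<^sup>+z. \<phi> a z \<partial>distr (measure_pmf (root_pmf N a)) borel (\<lambda>z. z)) \<in> borel_measurable (coeff_space N)"
    by (rule nn_integral_measurable_subprob_algebra2[OF assms measurable_root_kernel])
  then have "(\<lambda>a. ennreal (real (size (proots (rand_poly N a)))) *
      (\<integral>\<^sup>+z. \<phi> a z \<partial>distr (measure_pmf (root_pmf N a)) borel (\<lambda>z. z))) \<in> borel_measurable (coeff_space N)"
    using measurable_root_count by (intro borel_measurable_times_ennreal)
  moreover have "(\<integral>\<^sup>+z. \<phi> a z \<partial>distr (measure_pmf (root_pmf N a)) borel (\<lambda>z. z)) = (\<integral>\<^sup>+z. \<phi> a z \<partial>measure_pmf (root_pmf N a))"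
    if "a \<in> space (coeff_space N)" for a
    using measurable_Pair2[OF assms that] by (subst nn_integral_distr) auto
  ultimately show ?thesis
    unfolding sum_roots_eq by (simp cong: measurable_cong)
qed

section \<open>The Kac-Rice formula\<close>

lemma sum_binomial_power:
  fixes t :: real
  shows "1 + (\<Sum>k=1..N. t ^ k * real (N choose k)) = (1 + t) ^ N"
proof -
  have "(1 + t) ^ N = (\<Sum>k\<le>N. t ^ k * real (N choose k))"
    using binomial_ring[of t 1 N] by (simp add: add.commute mult.commute)
  also have "{..N} = insert 0 {1..N}" by auto
  finally show ?thesis by simp
qed

text \<open>Up to the factor \<open>cnj z\<close> this is the covariance of \<open>f'(z)\<close>
  with \<open>f(z)\<close>. It follows from the absorption identity for binomial
  coefficients.\<close>

lemma sum_binomial_deriv: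
  fixes t :: real
  shows "(\<Sum>k=1..Suc n. real k * t ^ (k - 1) * real (Suc n choose k)) = real (Suc n) * (1 + t) ^ n"
proof -
  have "(\<Sum>k=1..Suc n. real k * t ^ (k - 1) * real (Suc n choose k))
    = (\<Sum>j\<le>n. real (Suc j) * t ^ j * real (Suc n choose Suc j))"
    by (rule sum.reindex_bij_witness[of _ Suc "\<lambda>k. k - 1"]) auto
  also have "\<dots> = (\<Sum>j\<le>n. real (Suc n) * (real (n choose j) * t ^ j))"
  proof (intro sum.cong refl)
    fix j
    have "real (Suc j) * real (Suc n choose Suc j) = real (Suc n) * real (n choose j)"
      using binomial_absorption[of j "Suc n"] by (metis diff_Suc_1 of_nat_mult)
    then show "real (Suc j) * t ^ j * real (Suc n choose Suc j) = real (Suc n) * (real (n choose j) * t ^ j)"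
      by (simp only: mult_ac) (simp add: mult_ac)
  qed
  also have "\<dots> = real (Suc n) * (1 + t) ^ n"
    using binomial_ring[of t 1 n] by (simp add: sum_distrib_left[symmetric] add.commute)
  finally show ?thesis .
qed

text \<open>The mean of a binomial distribution with success probability \<open>t / (1 + t)\<close>,
  before normalisation.\<close>

lemma sum_binomial_linear:
  fixes t :: real
  shows "(1 + t) * (\<Sum>j\<le>n. real j * (real (n choose j) * t ^ j)) = real n * t * (1 + t) ^ n"
proof (cases n)
  case (Suc m)
  have "(\<Sum>j\<le>n. real j * (real (n choose j) * t ^ j)) = (\<Sum>j=1..n. real j * (real (n choose j) * t ^ j))"
    by (intro sum.mono_neutral_right) auto
  also have "\<dots> = t * (\<Sum>j=1..n. real j * t ^ (j - 1) * real (n choose j))"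
    unfolding sum_distrib_left
  proof (intro sum.cong refl)
    fix j assume "j \<in> {1..n}"
    then have "t ^ j = t * t ^ (j - 1)" by (cases j) auto
    then show "real j * (real (n choose j) * t ^ j) = t * (real j * t ^ (j - 1) * real (n choose j))"
      by simp
  qed
  also have "\<dots> = t * (real n * (1 + t) ^ m)"
    unfolding Suc sum_binomial_deriv ..
  finally show ?thesis by (simp add: Suc)
qed simp

text \<open>The sum is the variance of \<open>f'(z)\<close>. The factor \<open>1 + t\<close> on the
  left avoids the exponent \<open>n - 1\<close>, which would be truncated for
  \<open>n = 0\<close>.\<close>

lemma sum_binomial_deriv2:
  fixes t :: real
  shows "(1 + t) * (\<Sum>k=1..Suc n. (real k)\<^sup>2 * t ^ (k - 1) * real (Suc n choose k))
    = real (Suc n) * (1 + t) ^ n * (1 + real (Suc n) * t)"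
proof -
  have "(\<Sum>k=1..Suc n. (real k)\<^sup>2 * t ^ (k - 1) * real (Suc n choose k))
    = (\<Sum>j\<le>n. (real (Suc j))\<^sup>2 * t ^ j * real (Suc n choose Suc j))"
    by (rule sum.reindex_bij_witness[of _ Suc "\<lambda>k. k - 1"]) auto
  also have "\<dots> = (\<Sum>j\<le>n. real (Suc n) * (real (n choose j) * t ^ j + real j * (real (n choose j) * t ^ j)))"
  proof (intro sum.cong refl)
    fix j
    have "real (Suc j) * real (Suc n choose Suc j) = real (Suc n) * real (n choose j)"
      using binomial_absorption[of j "Suc n"] by (metis diff_Suc_1 of_nat_mult)
    then have "(real (Suc j))\<^sup>2 * t ^ j * real (Suc n choose Suc j) = real (Suc j) * t ^ j * (real (Suc n) * real (n choose j))"
      by (simp only: power2_eq_square mult_ac) (simp add: mult_ac)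
    then show "(real (Suc j))\<^sup>2 * t ^ j * real (Suc n choose Suc j)
      = real (Suc n) * (real (n choose j) * t ^ j + real j * (real (n choose j) * t ^ j))"
      by (simp add: algebra_simps)
  qed
  also have "\<dots> = real (Suc n) * ((1 + t) ^ n + (\<Sum>j\<le>n. real j * (real (n choose j) * t ^ j)))"
    using binomial_ring[of t 1 n]
    by (simp add: sum_distrib_left[symmetric] sum.distrib add.commute del: of_nat_Suc)
  finally have "(1 + t) * (\<Sum>k=1..Suc n. (real k)\<^sup>2 * t ^ (k - 1) * real (Suc n choose k))
    = real (Suc n) * ((1 + t) * (1 + t) ^ n + (1 + t) * (\<Sum>j\<le>n. real j * (real (n choose j) * t ^ j)))"
    by (simp only: distrib_left mult_ac)
  then show ?thesis
    unfolding sum_binomial_linear by (simp add: algebra_simps)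
qed

lemma proots_simple_roots:
  fixes p :: "complex poly"
  assumes "\<And>z. poly p z = 0 \<Longrightarrow> poly (pderiv p) z \<noteq> 0" and "p \<noteq> 0"
  shows "proots p = mset_set {z. poly p z = 0}"
proof (rule multiset_eqI)
  fix z
  have "rsquarefree p" using assms by (auto simp: rsquarefree_roots)
  then have "order z p = 0 \<or> order z p = 1" by (simp add: rsquarefree_def)
  moreover have "order z p = 0 \<longleftrightarrow> poly p z \<noteq> 0" using assms(2) by (simp add: order_root)
  ultimately show "count (proots p) z = count (mset_set {z. poly p z = 0}) z"
    using assms(2) poly_roots_finite[OF assms(2)] by (auto simp: count_proots count_mset_set')
qed

lemma pderiv_sum: "pderiv (\<Sum>x\<in>A. f x) = (\<Sum>x\<in>A. pderiv (f x))"
  by (induction A rule: infinite_finite_induct) (auto simp: pderiv_add)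

lemma poly_pderiv_rand_poly: "poly (pderiv (rand_poly N a)) z = (\<Sum>k=1..N. of_nat k * z ^ (k - 1) * a k)"
proof -
  have "poly (pderiv (rand_poly N a)) z = (\<Sum>k\<le>N. of_nat k * z ^ (k - 1) * a k)"
    by (simp add: rand_poly_def pderiv_sum poly_sum pderiv_monom poly_monom mult_ac)
  also have "\<dots> = (\<Sum>k=1..N. of_nat k * z ^ (k - 1) * a k)"
    by (intro sum.mono_neutral_right) auto
  finally show ?thesis .
qed

text \<open>The product locale asks for a sigma-finite factor at every index, so the variances are
  continued by \<open>1\<close> beyond \<open>N\<close>, where the binomial coefficients
  vanish.\<close>

lemma coeff_measure_eq:
  "coeff_measure N = (\<Pi>\<^sub>M k\<in>{0..N}. complex_gaussian (if k \<le> N then real (N choose k) else 1))"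
  unfolding coeff_measure_def by (intro PiM_cong) auto

lemma sets_coeff_measure [simp, measurable_cong]: "sets (coeff_measure N) = sets (coeff_space N)"
  unfolding coeff_measure_def coeff_space_def by (intro sets_PiM_cong) auto

lemma AE_complex_gaussian_not_in_finite:
  assumes "v > 0" "finite B"
  shows "AE b in complex_gaussian v. b \<notin> B"
proof -
  have "B \<in> null_sets lborel"
    using finite_imp_null_set_lborel[OF assms(2)] .
  then have "AE b in lborel. b \<notin> B" by (rule AE_not_in)
  then show ?thesis
    using assms by (subst complex_gaussian_eq_density) (auto simp: AE_density)
qed

text \<open>The constant coefficient is integrated first: the roots of \<open>g + b\<close> are the fibre of \<open>g\<close> over
  \<open>- b\<close>, so the area formula turns the sum over the roots into an integral over the plane.\<close>
lemma nn_integral_sum_roots_const_coeff: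
  fixes g :: "complex poly" and \<phi> :: "complex \<Rightarrow> ennreal"
  assumes deg: "degree g > 0" and \<phi>: "\<phi> \<in> borel_measurable borel"
  shows "(\<integral>\<^sup>+b. (\<Sum>z\<in>#proots (g + [:b:]). \<phi> z) \<partial>complex_gaussian 1)
    = (\<integral>\<^sup>+z. ennreal (complex_normal_density 1 (poly g z)) *
        (\<phi> z * ennreal ((cmod (poly (pderiv g) z))\<^sup>2)) \<partial>lborel)"
proof -
  note [measurable] = \<phi>
  \<comment> \<open>These are exactly the constants \<open>b\<close> for which \<open>g + b\<close>
    has a multiple root. They are finitely many, hence null; for all others the root multiset is the
    fibre with each point counted once.\<close>
  define B where "B = (\<lambda>z. - poly g z) ` {z. poly (pderiv g) z = 0}"
  have "pderiv g \<noteq> 0" using deg by (simp add: pderiv_eq_0_iff)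
  then have B: "finite B" unfolding B_def by (intro finite_imageI poly_roots_finite)
  have roots: "(\<Sum>z\<in>#proots (g + [:b:]). \<phi> z) = (\<Sum>z | poly g z = - b. \<phi> z)" if "b \<notin> B" for b
  proof -
    have "g + [:b:] \<noteq> 0"
    proof
      assume "g + [:b:] = 0"
      then have "g = [:- b:]" by (simp add: add_eq_0_iff2 minus_pCons)
      then show False using deg by simp
    qed
    moreover have "pderiv (g + [:b:]) = pderiv g"
      by (simp add: pderiv_add pderiv_pCons)
    moreover have "poly (g + [:b:]) z = 0 \<longleftrightarrow> poly g z = - b" for z
      by (simp add: add_eq_0_iff2)
    moreover have "poly (pderiv g) z \<noteq> 0" if "poly g z = - b" for z
      using \<open>b \<notin> B\<close> that by (auto simp: B_def image_iff)
    ultimately have "proots (g + [:b:]) = mset_set {z. poly g z = - b}"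
      using proots_simple_roots[of "g + [:b:]"] by simp
    then show ?thesis by (simp add: sum_unfold_sum_mset)
  qed
  have area: "(\<lambda>w. \<Sum>z | poly g z = w. \<psi> z) \<in> borel_measurable borel"
    "(\<integral>\<^sup>+w. (\<Sum>z | poly g z = w. \<psi> z) \<partial>lborel) = (\<integral>\<^sup>+z. \<psi> z * ennreal ((cmod (poly (pderiv g) z))\<^sup>2) \<partial>lborel)"
    if "\<psi> \<in> borel_measurable borel" for \<psi>
    using poly_area_formula[OF deg that] by auto
  have [measurable]: "(\<lambda>b. \<Sum>z | poly g z = - b. \<phi> z) \<in> borel_measurable borel"
    using measurable_compose[OF _ area(1)[OF \<phi>], of uminus borel] by simp
  have [measurable]: "(\<lambda>b. \<Sum>z | poly g z = b. \<phi> z) \<in> borel_measurable borel"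
    by (rule area(1)[OF \<phi>])
  have "(\<integral>\<^sup>+b. (\<Sum>z\<in>#proots (g + [:b:]). \<phi> z) \<partial>complex_gaussian 1)
    = (\<integral>\<^sup>+b. (\<Sum>z | poly g z = - b. \<phi> z) \<partial>complex_gaussian 1)"
    using AE_complex_gaussian_not_in_finite[OF zero_less_one B]
    by (intro nn_integral_cong_AE) (auto elim!: eventually_mono simp: roots)
  also have "\<dots> = (\<integral>\<^sup>+w. (\<Sum>z | poly g z = w. \<phi> z) \<partial>complex_gaussian 1)"
    using nn_integral_complex_gaussian_scale[of "-1" 1 "\<lambda>w. \<Sum>z | poly g z = w. \<phi> z"] by simp
  \<comment> \<open>On the fibre over \<open>w\<close> the density at \<open>w\<close> equals the
    density at \<open>poly g z\<close>. It can thus be moved under the sum and becomes part of the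
    function to which the area formula is applied.\<close>
  also have "\<dots> = (\<integral>\<^sup>+w. (\<Sum>z | poly g z = w. ennreal (complex_normal_density 1 (poly g z)) * \<phi> z) \<partial>lborel)"
    by (subst nn_integral_complex_gaussian) (auto simp: sum_distrib_left intro!: nn_integral_cong sum.cong)
  also have "\<dots> = (\<integral>\<^sup>+z. ennreal (complex_normal_density 1 (poly g z)) * \<phi> z * ennreal ((cmod (poly (pderiv g) z))\<^sup>2) \<partial>lborel)"
    by (rule area(2)) measurable
  finally show ?thesis by (simp add: mult.assoc)
qed

text \<open>Conditionally on \<open>f(z) = 0\<close>, the derivative \<open>f'(z)\<close> has the law of \<open>root_slope N z * u\<close> with
  \<open>u\<close> distributed according to \<open>complex_gaussian (1/2)\<close>, which is normalised by \<open>E |u|\<^sup>2 = 1\<close>.\<close>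
definition root_slope :: "nat \<Rightarrow> complex \<Rightarrow> real" where
  "root_slope N z = sqrt (2 * real N * (1 + (cmod z)\<^sup>2) ^ N) / (1 + (cmod z)\<^sup>2)"

text \<open>The conditioning formula with \<open>s = 1\<close>, the variance of the constant
  coefficient that has been integrated out. With \<open>t = |z|^2\<close>, the density of
  \<open>f(z)\<close> at \<open>0\<close> is \<open>1 / (2 * pi * (1 + t) ^ N)\<close> and the
  conditional mean of \<open>|f'(z)|^2\<close> is \<open>2 * N * (1 + t) ^ N / (1 + t)^2\<close>.
  The powers \<open>(1 + t) ^ N\<close> cancel in the product, which leaves \<open>N\<close> times
  the area density of the sphere.\<close>

lemma nn_integral_vanishing_conditioned:
  fixes \<phi> :: "complex \<Rightarrow> ennreal"
  assumes N: "N \<ge> 1" and \<phi>: "\<phi> \<in> borel_measurable borel" and v: "\<And>k. v k > 0"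
    "\<And>k. k \<in> {1..N} \<Longrightarrow> v k = real (N choose k)"
  shows "(\<integral>\<^sup>+a. ennreal (complex_normal_density 1 (\<Sum>k=1..N. z ^ k * a k)) *
      (\<phi> (\<Sum>k=1..N. of_nat k * z ^ (k - 1) * a k)
        * ennreal ((cmod (\<Sum>k=1..N. of_nat k * z ^ (k - 1) * a k))\<^sup>2))
      \<partial>(\<Pi>\<^sub>M k\<in>{1..N}. complex_gaussian (v k)))
    = ennreal (real N / (pi * (1 + (cmod z)\<^sup>2)\<^sup>2)) *
      (\<integral>\<^sup>+u. ennreal ((cmod u)\<^sup>2) * \<phi> (of_real (root_slope N z) * u) \<partial>complex_gaussian (1/2))"
proof -
  note [measurable] = \<phi>
  interpret G: prob_space "complex_gaussian 1" by (rule prob_space_complex_gaussian) simp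
  obtain n where n: "N = Suc n" using N by (cases N) auto
  define t where "t = (cmod z)\<^sup>2"
  have t: "t \<ge> 0" by (simp add: t_def)
  define F where "F = (\<lambda>w. \<phi> w * ennreal ((cmod w)\<^sup>2))"
  have [measurable]: "F \<in> borel_measurable borel" unfolding F_def by measurable
  define U where "U = (1 + t) ^ N"
  have U: "U > 0" using t by (simp add: U_def)
  have pow: "(cmod (z ^ k))\<^sup>2 = t ^ k" for k
    by (simp add: t_def norm_power power_mult[symmetric] mult.commute)
  have e1: "1 + (\<Sum>k=1..N. (cmod (z ^ k))\<^sup>2 * v k) = U"
  proof -
    have "(\<Sum>k=1..N. (cmod (z ^ k))\<^sup>2 * v k) = (\<Sum>k=1..N. t ^ k * real (N choose k))"
      by (intro sum.cong) (simp_all add: v pow)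
    then show ?thesis using sum_binomial_power[of t N] by (simp add: U_def)
  qed
  have e2: "(1 + t) * (\<Sum>k=1..N. (cmod (of_nat k * z ^ (k - 1)))\<^sup>2 * v k)
    = real N * (1 + t) ^ n * (1 + real N * t)"
  proof -
    have "(\<Sum>k=1..N. (cmod (of_nat k * z ^ (k - 1)))\<^sup>2 * v k)
      = (\<Sum>k=1..N. (real k)\<^sup>2 * t ^ (k - 1) * real (N choose k))"
      by (intro sum.cong) (simp_all add: v pow norm_mult power_mult_distrib del: norm_power)
    then show ?thesis by (simp only: n sum_binomial_deriv2)
  qed
  have e3: "(cmod (\<Sum>k=1..N. of_nat k * z ^ (k - 1) * cnj (z ^ k) * of_real (v k)))\<^sup>2
    = t * (real N * (1 + t) ^ n)\<^sup>2"
  proof -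
    have "(\<Sum>k=1..N. of_nat k * z ^ (k - 1) * cnj (z ^ k) * of_real (v k))
      = (\<Sum>k=1..N. cnj z * of_real (real k * t ^ (k - 1) * real (N choose k)))"
    proof (intro sum.cong refl)
      fix k assume k: "k \<in> {1..N}"
      then have "cnj (z ^ k) = cnj z * cnj z ^ (k - 1)" by (cases k) auto
      moreover have "z ^ (k - 1) * cnj z ^ (k - 1) = of_real (t ^ (k - 1))"
        unfolding t_def by (simp add: power_mult_distrib[symmetric] flip: complex_norm_square)
      ultimately show "of_nat k * z ^ (k - 1) * cnj (z ^ k) * of_real (v k)
        = cnj z * of_real (real k * t ^ (k - 1) * real (N choose k))"
        using k by (simp add: v mult_ac del: of_real_power)
    qed
    also have "\<dots> = cnj z * of_real (real N * (1 + t) ^ n)"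
      by (simp only: n sum_distrib_left[symmetric] of_real_sum[symmetric] sum_binomial_deriv)
    finally show ?thesis
      by (simp only: norm_mult norm_of_real complex_mod_cnj power_mult_distrib power2_abs t_def)
  qed
  \<comment> \<open>The conditional variance of \<open>f'(z)\<close>: its variance minus the squared
    covariance divided by the variance \<open>U\<close> of \<open>f(z)\<close>. The terms containing
    \<open>N^2 * t\<close> cancel.\<close>
  define \<rho> where "\<rho> = real N * (1 + t) ^ N / (1 + t)\<^sup>2"
  have \<rho>: "\<rho> \<ge> 0" using t by (simp add: \<rho>_def)
  have var: "(\<Sum>k=1..N. (cmod (of_nat k * z ^ (k - 1)))\<^sup>2 * v k)
      - (cmod (\<Sum>k=1..N. of_nat k * z ^ (k - 1) * cnj (z ^ k) * of_real (v k)))\<^sup>2 / U = \<rho>"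
  proof -
    have P: "1 + t > 0" using t by simp
    have a: "(\<Sum>k=1..N. (cmod (of_nat k * z ^ (k - 1)))\<^sup>2 * v k) = real N * (1 + t) ^ n * (1 + real N * t) / (1 + t)"
      using e2 P by (simp add: field_simps)
    have b: "t * (real N * (1 + t) ^ n)\<^sup>2 / U = t * (real N)\<^sup>2 * (1 + t) ^ n / (1 + t)"
    proof -
      have Un: "U = (1 + t) * (1 + t) ^ n" by (simp add: U_def n)
      have "t * (R * X)\<^sup>2 / ((1 + t) * X) = t * R\<^sup>2 * X / (1 + t)" if "X > 0" for R X :: real
        using that P by (simp add: power2_eq_square)
      then show ?thesis unfolding Un using P by simp
    qed
    have c: "\<rho> = real N * (1 + t) ^ n / (1 + t)"
      using P by (simp add: \<rho>_def n power2_eq_square)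
    have "real N * (1 + t) ^ n * (1 + real N * t) - t * (real N)\<^sup>2 * (1 + t) ^ n = real N * (1 + t) ^ n"
      by (simp add: algebra_simps power2_eq_square)
    then show ?thesis
      unfolding e3 a b c by (simp add: diff_divide_distrib[symmetric])
  qed
  have "(\<integral>\<^sup>+a. ennreal (complex_normal_density 1 (\<Sum>k=1..N. z ^ k * a k)) *
      F (\<Sum>k=1..N. of_nat k * z ^ (k - 1) * a k) \<partial>(\<Pi>\<^sub>M k\<in>{1..N}. complex_gaussian (v k)))
    = ennreal (complex_normal_density U 0) * (\<integral>\<^sup>+y. F (of_real (sqrt \<rho>) * y) \<partial>complex_gaussian 1)"
    using gaussian_conditioning[of "{1..N}" v F 1 0 "\<lambda>k. z ^ k" 0 "\<lambda>k. of_nat k * z ^ (k - 1)"] v(1)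
      G.emeasure_space_1
    by (simp add: e1 var del: One_nat_def complex_cnj_power)
  \<comment> \<open>Passes to the normalisation \<open>E |u|^2 = 1\<close>; the factor
    \<open>sqrt 2\<close> is absorbed into \<open>root_slope\<close>.\<close>
  also have "(\<integral>\<^sup>+y. F (of_real (sqrt \<rho>) * y) \<partial>complex_gaussian 1)
    = (\<integral>\<^sup>+u. F (of_real (sqrt \<rho>) * (of_real (sqrt 2) * u)) \<partial>complex_gaussian (1/2))"
    using nn_integral_complex_gaussian_scale[of "of_real (sqrt 2)" "1/2" "\<lambda>y. F (of_real (sqrt \<rho>) * y)"] by simp
  also have "\<dots> = (\<integral>\<^sup>+u. ennreal (2 * \<rho>) * (ennreal ((cmod u)\<^sup>2) * \<phi> (of_real (root_slope N z) * u)) \<partial>complex_gaussian (1/2))"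
  proof (intro nn_integral_cong)
    fix u
    have r: "root_slope N z = sqrt \<rho> * sqrt 2"
      using t by (simp add: root_slope_def \<rho>_def t_def[symmetric] real_sqrt_mult real_sqrt_divide)
    have h1: "(cmod (of_real (root_slope N z) * u))\<^sup>2 = 2 * \<rho> * (cmod u)\<^sup>2"
      using \<rho> by (simp add: r norm_mult power_mult_distrib abs_mult)
    have h2: "of_real (sqrt \<rho>) * (of_real (sqrt 2) * u) = of_real (root_slope N z) * u"
      by (simp add: r)
    show "F (of_real (sqrt \<rho>) * (of_real (sqrt 2) * u))
      = ennreal (2 * \<rho>) * (ennreal ((cmod u)\<^sup>2) * \<phi> (of_real (root_slope N z) * u))"
      unfolding h2 F_def h1 using \<rho> by (simp add: ennreal_mult mult_ac)
  qed
  also have "\<dots> = ennreal (2 * \<rho>) * (\<integral>\<^sup>+u. ennreal ((cmod u)\<^sup>2) * \<phi> (of_real (root_slope N z) * u) \<partial>complex_gaussian (1/2))"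
    by (rule nn_integral_cmult) measurable
  also have "ennreal (complex_normal_density U 0) * (ennreal (2 * \<rho>) * (\<integral>\<^sup>+u. ennreal ((cmod u)\<^sup>2) * \<phi> (of_real (root_slope N z) * u) \<partial>complex_gaussian (1/2)))
    = ennreal (complex_normal_density U 0 * (2 * \<rho>)) * (\<integral>\<^sup>+u. ennreal ((cmod u)\<^sup>2) * \<phi> (of_real (root_slope N z) * u) \<partial>complex_gaussian (1/2))"
    using U \<rho> by (simp add: ennreal_mult mult.assoc)
  also have "complex_normal_density U 0 * (2 * \<rho>) = real N / (pi * (1 + t)\<^sup>2)"
    using t U by (simp add: complex_normal_density_def \<rho>_def U_def)
  finally show ?thesis by (simp add: F_def t_def)
qed

lemma measurable_coeff_component:
  "k \<le> N \<Longrightarrow> (\<lambda>a. a k) \<in> borel_measurable (coeff_space N)"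
  unfolding coeff_space_def by (rule measurable_component_singleton) auto

lemma measurable_poly_pderiv_rand_poly [measurable]:
  "(\<lambda>(a, z). poly (pderiv (rand_poly N a)) z) \<in> borel_measurable (coeff_space N \<Otimes>\<^sub>M borel)"
proof -
  have [measurable]: "(\<lambda>p. fst p k) \<in> borel_measurable (coeff_space N \<Otimes>\<^sub>M borel)" if "k \<in> {1..N}" for k
    using that by (intro measurable_compose[OF measurable_fst measurable_coeff_component]) auto
  show ?thesis
    unfolding poly_pderiv_rand_poly split_beta by measurable
qed

theorem kac_rice:
  fixes \<phi> :: "complex \<Rightarrow> complex \<Rightarrow> ennreal"
  assumes N: "N \<ge> 1" and \<phi>: "(\<lambda>(z, w). \<phi> z w) \<in> borel_measurable (borel \<Otimes>\<^sub>M borel)"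
  shows "(\<integral>\<^sup>+a. (\<Sum>z\<in>#proots (rand_poly N a). \<phi> z (poly (pderiv (rand_poly N a)) z)) \<partial>coeff_measure N)
    = ennreal (real N) * (\<integral>\<^sup>+z. (\<integral>\<^sup>+u. ennreal ((cmod u)\<^sup>2) * \<phi> z (of_real (root_slope N z) * u)
        \<partial>complex_gaussian (1/2)) \<partial>sphere_measure)"
proof -
  note [measurable] = \<phi>
  define v where "v = (\<lambda>k. if k \<le> N then real (N choose k) else 1)"
  have v: "v k > 0" for k by (simp add: v_def)
  interpret product_sigma_finite "\<lambda>k. complex_gaussian (v k)"
    by (rule product_sigma_finite_complex_gaussian[OF v])
  interpret G: prob_space "complex_gaussian (1/2)" by (rule prob_space_complex_gaussian) simp
  define S where "S = (\<lambda>a. \<Sum>z\<in>#proots (rand_poly N a). \<phi> z (poly (pderiv (rand_poly N a)) z))"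
  have S: "S \<in> borel_measurable (coeff_space N)"
  proof -
    have "(\<lambda>(a, z). \<phi> z (poly (pderiv (rand_poly N a)) z)) \<in> borel_measurable (coeff_space N \<Otimes>\<^sub>M borel)"
    proof -
      have "(\<lambda>x. (snd x, poly (pderiv (rand_poly N (fst x))) (snd x))) \<in> coeff_space N \<Otimes>\<^sub>M borel \<rightarrow>\<^sub>M borel \<Otimes>\<^sub>M borel"
        using measurable_poly_pderiv_rand_poly[of N] by (intro measurable_Pair) (auto simp: split_beta')
      from measurable_compose[OF this \<phi>] show ?thesis by (simp add: split_beta')
    qed
    then show ?thesis unfolding S_def by (rule measurable_sum_roots)
  qed
  define g where "g = (\<lambda>a. \<Sum>k=1..N. monom (a k) k :: complex poly)"
  have poly_g: "poly (g a) z = (\<Sum>k=1..N. z ^ k * a k)" for a z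
    by (simp add: g_def poly_sum poly_monom mult.commute)
  have pderiv_g: "poly (pderiv (g a)) z = (\<Sum>k=1..N. of_nat k * z ^ (k - 1) * a k)" for a z
    by (simp add: g_def pderiv_sum poly_sum pderiv_monom poly_monom mult_ac)
  have rp: "rand_poly N (a(0 := b)) = g a + [:b:]" for a b
  proof -
    have "rand_poly N (a(0 := b)) = (\<Sum>k\<in>insert 0 {1..N}. monom ((a(0 := b)) k) k)"
      unfolding rand_poly_def by (intro sum.cong) auto
    also have "\<dots> = (\<Sum>k\<in>{1..N}. monom ((a(0 := b)) k) k) + monom b 0"
      by simp
    also have "(\<Sum>k\<in>{1..N}. monom ((a(0 := b)) k) k) = g a"
      unfolding g_def by (intro sum.cong) auto
    finally show ?thesis unfolding monom_0 .
  qed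
  have deg: "degree (g a) > 0" if "a N \<noteq> 0" for a
  proof -
    have "coeff (g a) N = (\<Sum>k=1..N. if k = N then a k else 0)"
      by (simp add: g_def coeff_sum)
    also have "\<dots> = a N" using N by simp
    finally show ?thesis using that N le_degree[of "g a" N] by simp
  qed
  have ins: "{0..N} = insert 0 {1..N}" by auto
  let ?P = "\<Pi>\<^sub>M k\<in>{1..N}. complex_gaussian (v k)"
  interpret P: pair_sigma_finite ?P "lborel :: complex measure"
    by (intro pair_sigma_finite.intro sigma_finite lborel.sigma_finite_measure_axioms) simp
  let ?F = "\<lambda>a z. ennreal (complex_normal_density 1 (\<Sum>k=1..N. z ^ k * a k)) *
      (\<phi> z (\<Sum>k=1..N. of_nat k * z ^ (k - 1) * a k)
        * ennreal ((cmod (\<Sum>k=1..N. of_nat k * z ^ (k - 1) * a k))\<^sup>2))"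
  have "(\<integral>\<^sup>+a. S a \<partial>coeff_measure N) = (\<integral>\<^sup>+a. S a \<partial>(\<Pi>\<^sub>M k\<in>insert 0 {1..N}. complex_gaussian (v k)))"
    by (simp only: coeff_measure_eq v_def ins)
  also have "\<dots> = (\<integral>\<^sup>+a. (\<integral>\<^sup>+b. S (a(0 := b)) \<partial>complex_gaussian (v 0)) \<partial>?P)"
  proof (rule product_nn_integral_insert)
    have "sets (\<Pi>\<^sub>M k\<in>insert 0 {1..N}. complex_gaussian (v k)) = sets (coeff_space N)"
      unfolding coeff_space_def ins by (intro sets_PiM_cong) auto
    then show "S \<in> borel_measurable (\<Pi>\<^sub>M k\<in>insert 0 {1..N}. complex_gaussian (v k))"
      using S measurable_cong_sets by blast
  qed auto
  also have "\<dots> = (\<integral>\<^sup>+a. (\<integral>\<^sup>+z. ?F a z \<partial>lborel) \<partial>?P)"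
  proof (intro nn_integral_cong_AE)
    \<comment> \<open>A nonzero top coefficient makes the polynomial without its constant term
      nonconstant, as the area formula requires.\<close>
    have "AE a in ?P. a N \<notin> {0}"
      using N v by (intro AE_PiM_component prob_space_complex_gaussian AE_complex_gaussian_not_in_finite) auto
    then show "AE a in ?P. (\<integral>\<^sup>+b. S (a(0 := b)) \<partial>complex_gaussian (v 0)) = (\<integral>\<^sup>+z. ?F a z \<partial>lborel)"
    proof (rule eventually_mono)
      fix a :: "nat \<Rightarrow> complex" assume "a N \<notin> {0}"
      then have d: "degree (g a) > 0" by (intro deg) simp
      have "pderiv (g a + [:b:]) = pderiv (g a)" for b
        by (simp add: pderiv_add pderiv_pCons)
      then have "(\<integral>\<^sup>+b. S (a(0 := b)) \<partial>complex_gaussian (v 0))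
        = (\<integral>\<^sup>+b. (\<Sum>z\<in>#proots (g a + [:b:]). \<phi> z (poly (pderiv (g a)) z)) \<partial>complex_gaussian 1)"
        by (simp add: S_def rp v_def)
      also have "\<dots> = (\<integral>\<^sup>+z. ennreal (complex_normal_density 1 (poly (g a) z)) *
        (\<phi> z (poly (pderiv (g a)) z) * ennreal ((cmod (poly (pderiv (g a)) z))\<^sup>2)) \<partial>lborel)"
        by (rule nn_integral_sum_roots_const_coeff[OF d]) measurable
      finally show "(\<integral>\<^sup>+b. S (a(0 := b)) \<partial>complex_gaussian (v 0)) = (\<integral>\<^sup>+z. ?F a z \<partial>lborel)"
        by (simp only: poly_g pderiv_g)
    qed
  qed
  also have "\<dots> = (\<integral>\<^sup>+z. (\<integral>\<^sup>+a. ?F a z \<partial>?P) \<partial>lborel)"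
  proof (rule P.Fubini'[symmetric])
    have [measurable]: "(\<lambda>p. fst p k) \<in> borel_measurable (?P \<Otimes>\<^sub>M borel)" if "k \<in> {1..N}" for k
    proof (rule measurable_compose[OF measurable_fst])
      show "(\<lambda>a. a k) \<in> borel_measurable ?P"
        using measurable_component_singleton[OF that, of "\<lambda>k. complex_gaussian (v k)"]
        by (simp cong: measurable_cong_sets)
    qed
    show "(\<lambda>(a, z). ?F a z) \<in> borel_measurable (?P \<Otimes>\<^sub>M lborel)"
      unfolding split_beta by measurable
  qed
  also have "\<dots> = (\<integral>\<^sup>+z. ennreal (real N) * (ennreal (1 / (pi * (1 + (cmod z)\<^sup>2)\<^sup>2)) *
      (\<integral>\<^sup>+u. ennreal ((cmod u)\<^sup>2) * \<phi> z (of_real (root_slope N z) * u) \<partial>complex_gaussian (1/2))) \<partial>lborel)"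
  proof (intro nn_integral_cong)
    fix z
    have "(\<integral>\<^sup>+a. ?F a z \<partial>?P) = ennreal (real N / (pi * (1 + (cmod z)\<^sup>2)\<^sup>2)) *
      (\<integral>\<^sup>+u. ennreal ((cmod u)\<^sup>2) * \<phi> z (of_real (root_slope N z) * u) \<partial>complex_gaussian (1/2))"
      by (rule nn_integral_vanishing_conditioned[OF N _ v]) (auto simp: v_def)
    also have "ennreal (real N / (pi * (1 + (cmod z)\<^sup>2)\<^sup>2)) = ennreal (real N) * ennreal (1 / (pi * (1 + (cmod z)\<^sup>2)\<^sup>2))"
      by (simp add: ennreal_mult'[symmetric])
    finally show "(\<integral>\<^sup>+a. ?F a z \<partial>?P) = ennreal (real N) * (ennreal (1 / (pi * (1 + (cmod z)\<^sup>2)\<^sup>2)) *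
      (\<integral>\<^sup>+u. ennreal ((cmod u)\<^sup>2) * \<phi> z (of_real (root_slope N z) * u) \<partial>complex_gaussian (1/2)))"
      by (simp only: mult.assoc)
  qed
  also have "\<dots> = ennreal (real N) * (\<integral>\<^sup>+z. (\<integral>\<^sup>+u. ennreal ((cmod u)\<^sup>2) * \<phi> z (of_real (root_slope N z) * u)
        \<partial>complex_gaussian (1/2)) \<partial>sphere_measure)"
  proof -
    have [measurable]: "root_slope N \<in> borel_measurable borel"
      unfolding root_slope_def by measurable
    show ?thesis
      by (subst nn_integral_sphere_measure) (auto intro!: nn_integral_cmult)
  qed
  finally show ?thesis by (simp add: S_def)
qed

section \<open>Signed functions of the roots\<close>

lemma nn_sum_mset_ennreal:
  fixes f :: "'a \<Rightarrow> real"
  shows "(\<Sum>z\<in>#A. ennreal (f z)) = ennreal (\<Sum>z\<in>#A. max 0 (f z))"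
proof (induction A)
  case (add x A)
  have "(\<Sum>z\<in>#A. max 0 (f z)) \<ge> 0" by (induction A) auto
  then show ?case using add by (simp add: ennreal_plus ennreal_max_0)
qed simp

lemma sum_mset_pos_neg_parts:
  fixes f :: "'a \<Rightarrow> real"
  shows "(\<Sum>z\<in>#A. f z) = (\<Sum>z\<in>#A. max 0 (f z)) - (\<Sum>z\<in>#A. max 0 (- f z))"
  by (induction A) auto

lemma sum_mset_max_nonneg: "(\<Sum>z\<in>#A. max 0 (f z :: real)) \<ge> 0"
  by (induction A) auto

lemma measurable_sum_roots_real:
  fixes \<phi> :: "(nat \<Rightarrow> complex) \<Rightarrow> complex \<Rightarrow> real"
  assumes "(\<lambda>(a, z). \<phi> a z) \<in> borel_measurable (coeff_space N \<Otimes>\<^sub>M borel)"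
  shows "(\<lambda>a. \<Sum>z\<in>#proots (rand_poly N a). max 0 (\<phi> a z)) \<in> borel_measurable (coeff_space N)"
    and "(\<lambda>a. \<Sum>z\<in>#proots (rand_poly N a). \<phi> a z) \<in> borel_measurable (coeff_space N)"
proof -
  have *: "(\<lambda>a. \<Sum>z\<in>#proots (rand_poly N a). max 0 (\<psi> a z)) \<in> borel_measurable (coeff_space N)"
    if "(\<lambda>(a, z). \<psi> a z) \<in> borel_measurable (coeff_space N \<Otimes>\<^sub>M borel)" for \<psi> :: "(nat \<Rightarrow> complex) \<Rightarrow> complex \<Rightarrow> real"
  proof -
    have "(\<lambda>a. \<Sum>z\<in>#proots (rand_poly N a). ennreal (\<psi> a z)) \<in> borel_measurable (coeff_space N)"
      using measurable_compose[OF that measurable_ennreal]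
      by (intro measurable_sum_roots) (simp add: split_beta')
    then have "(\<lambda>a. enn2real (\<Sum>z\<in>#proots (rand_poly N a). ennreal (\<psi> a z))) \<in> borel_measurable (coeff_space N)"
      by measurable
    then show ?thesis by (simp add: nn_sum_mset_ennreal sum_mset_max_nonneg)
  qed
  show "(\<lambda>a. \<Sum>z\<in>#proots (rand_poly N a). max 0 (\<phi> a z)) \<in> borel_measurable (coeff_space N)"
    by (rule *[OF assms])
  have "(\<lambda>(a, z). - \<phi> a z) \<in> borel_measurable (coeff_space N \<Otimes>\<^sub>M borel)"
    using assms by (simp add: split_beta')
  from *[OF assms] *[OF this]
  show "(\<lambda>a. \<Sum>z\<in>#proots (rand_poly N a). \<phi> a z) \<in> borel_measurable (coeff_space N)"
    by (subst sum_mset_pos_neg_parts) (rule borel_measurable_diff)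
qed

text \<open>The nonnegative formula is applied to \<phi> and to its negative. Since
  \<open>ennreal\<close> truncates at \<open>0\<close>, it yields the sums of the positive and of
  the negative parts separately; integrability over the sphere and the Gaussian law makes both
  finite, so that they can be subtracted.\<close>

theorem kac_rice_real:
  fixes \<phi> :: "complex \<Rightarrow> complex \<Rightarrow> real"
  assumes N: "N \<ge> 1" and \<phi>: "(\<lambda>(z, w). \<phi> z w) \<in> borel_measurable (borel \<Otimes>\<^sub>M borel)"
    and int: "integrable (sphere_measure \<Otimes>\<^sub>M complex_gaussian (1/2))
      (\<lambda>(z, u). (cmod u)\<^sup>2 * \<phi> z (of_real (root_slope N z) * u))"
  shows "integrable (coeff_measure N) (\<lambda>a. \<Sum>z\<in>#proots (rand_poly N a). \<phi> z (poly (pderiv (rand_poly N a)) z))"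
    and "(\<integral>a. (\<Sum>z\<in>#proots (rand_poly N a). \<phi> z (poly (pderiv (rand_poly N a)) z)) \<partial>coeff_measure N)
      = real N * (\<integral>(z, u). (cmod u)\<^sup>2 * \<phi> z (of_real (root_slope N z) * u) \<partial>(sphere_measure \<Otimes>\<^sub>M complex_gaussian (1/2)))"
proof -
  let ?Q = "sphere_measure \<Otimes>\<^sub>M complex_gaussian (1/2)"
  let ?f = "\<lambda>(z, u). (cmod u)\<^sup>2 * \<phi> z (of_real (root_slope N z) * u)"
  interpret G: prob_space "complex_gaussian (1/2)" by (rule prob_space_complex_gaussian) simp
  have [measurable]: "root_slope N \<in> borel_measurable borel"
    unfolding root_slope_def by measurable
  let ?S = "\<lambda>\<psi> a. \<Sum>z\<in>#proots (rand_poly N a). max 0 (\<psi> z (poly (pderiv (rand_poly N a)) z))"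
  have part: "integrable (coeff_measure N) (?S \<psi>) \<and>
      (\<integral>a. ?S \<psi> a \<partial>coeff_measure N)
        = real N * enn2real (\<integral>\<^sup>+x. ennreal ((\<lambda>(z, u). (cmod u)\<^sup>2 * \<psi> z (of_real (root_slope N z) * u)) x) \<partial>?Q)"
    if \<psi>: "(\<lambda>(z, w). \<psi> z w) \<in> borel_measurable (borel \<Otimes>\<^sub>M borel)"
      and i: "integrable ?Q (\<lambda>(z, u). (cmod u)\<^sup>2 * \<psi> z (of_real (root_slope N z) * u))" for \<psi> :: "complex \<Rightarrow> complex \<Rightarrow> real"
  proof -
    note [measurable] = \<psi>
    let ?h = "\<lambda>(z, u). (cmod u)\<^sup>2 * \<psi> z (of_real (root_slope N z) * u)"
    have meas: "?S \<psi> \<in> borel_measurable (coeff_measure N)"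
    proof -
      have "(\<lambda>x. (snd x, poly (pderiv (rand_poly N (fst x))) (snd x))) \<in> coeff_space N \<Otimes>\<^sub>M borel \<rightarrow>\<^sub>M borel \<Otimes>\<^sub>M borel"
        using measurable_poly_pderiv_rand_poly[of N] by (intro measurable_Pair) (auto simp: split_beta')
      from measurable_compose[OF this \<psi>]
      have "(\<lambda>(a, z). \<psi> z (poly (pderiv (rand_poly N a)) z)) \<in> borel_measurable (coeff_space N \<Otimes>\<^sub>M borel)"
        by (simp add: split_beta')
      from measurable_sum_roots_real(1)[OF this] show ?thesis
        by (simp cong: measurable_cong_sets)
    qed
    have fin: "(\<integral>\<^sup>+x. ennreal (?h x) \<partial>?Q) < \<infinity>"
    proof -
      have "(\<integral>\<^sup>+x. ennreal (?h x) \<partial>?Q) \<le> (\<integral>\<^sup>+x. ennreal (norm (?h x)) \<partial>?Q)"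
        by (intro nn_integral_mono ennreal_leI) auto
      also have "\<dots> < \<infinity>" using i by (simp add: integrable_iff_bounded)
      finally show ?thesis .
    qed
    have "(\<integral>\<^sup>+a. ennreal (?S \<psi> a) \<partial>coeff_measure N)
      = ennreal (real N) * (\<integral>\<^sup>+z. (\<integral>\<^sup>+u. ennreal ((cmod u)\<^sup>2) * ennreal (\<psi> z (of_real (root_slope N z) * u))
        \<partial>complex_gaussian (1/2)) \<partial>sphere_measure)"
      unfolding nn_sum_mset_ennreal[symmetric] by (rule kac_rice[OF N]) measurable
    also have "(\<integral>\<^sup>+z. (\<integral>\<^sup>+u. ennreal ((cmod u)\<^sup>2) * ennreal (\<psi> z (of_real (root_slope N z) * u))
        \<partial>complex_gaussian (1/2)) \<partial>sphere_measure)
      = (\<integral>\<^sup>+z. (\<integral>\<^sup>+u. ennreal (?h (z, u)) \<partial>complex_gaussian (1/2)) \<partial>sphere_measure)"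
      by (simp add: ennreal_mult'[symmetric])
    also have "\<dots> = (\<integral>\<^sup>+x. ennreal (?h x) \<partial>?Q)"
      by (rule G.nn_integral_fst) measurable
    finally have eq: "(\<integral>\<^sup>+a. ennreal (?S \<psi> a) \<partial>coeff_measure N) = ennreal (real N) * (\<integral>\<^sup>+x. ennreal (?h x) \<partial>?Q)" .
    have "integrable (coeff_measure N) (?S \<psi>)"
      using fin by (intro integrableI_nonneg meas) (auto simp: sum_mset_max_nonneg eq ennreal_mult_less_top)
    moreover have "(\<integral>a. ?S \<psi> a \<partial>coeff_measure N) = real N * enn2real (\<integral>\<^sup>+x. ennreal (?h x) \<partial>?Q)"
      by (subst integral_eq_nn_integral[OF meas]) (auto simp: sum_mset_max_nonneg eq enn2real_mult)
    ultimately show ?thesis by blast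
  qed
  have neg: "(\<lambda>(z, w). - \<phi> z w) \<in> borel_measurable (borel \<Otimes>\<^sub>M borel)"
    using \<phi> by (simp add: split_beta')
  have negi: "integrable ?Q (\<lambda>(z, u). (cmod u)\<^sup>2 * - \<phi> z (of_real (root_slope N z) * u))"
    using Bochner_Integration.integrable_minus[OF int] by (simp add: split_beta')
  note pos = part[OF \<phi> int] and neg = part[OF neg negi]
  have eq: "(\<lambda>a. \<Sum>z\<in>#proots (rand_poly N a). \<phi> z (poly (pderiv (rand_poly N a)) z))
    = (\<lambda>a. ?S \<phi> a - ?S (\<lambda>z w. - \<phi> z w) a)"
    by (intro ext sum_mset_pos_neg_parts)
  show "integrable (coeff_measure N) (\<lambda>a. \<Sum>z\<in>#proots (rand_poly N a). \<phi> z (poly (pderiv (rand_poly N a)) z))"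
    unfolding eq using pos neg by (intro Bochner_Integration.integrable_diff) simp_all
  have "(\<integral>a. (\<Sum>z\<in>#proots (rand_poly N a). \<phi> z (poly (pderiv (rand_poly N a)) z)) \<partial>coeff_measure N)
    = (\<integral>a. ?S \<phi> a \<partial>coeff_measure N) - (\<integral>a. ?S (\<lambda>z w. - \<phi> z w) a \<partial>coeff_measure N)"
    unfolding eq using pos neg by (intro Bochner_Integration.integral_diff) simp_all
  also have "\<dots> = real N * (\<integral>x. ?f x \<partial>?Q)"
    using pos neg unfolding real_lebesgue_integral_def[OF int]
    by (simp add: split_beta' right_diff_distrib)
  finally show "(\<integral>a. (\<Sum>z\<in>#proots (rand_poly N a). \<phi> z (poly (pderiv (rand_poly N a)) z)) \<partial>coeff_measure N)
      = real N * (\<integral>x. ?f x \<partial>?Q)" .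
qed

section \<open>The energy of the roots\<close>

lemma norm_sphere_point_diff:
  "norm (sphere_point z - sphere_point w)
    = 2 * cmod (z - w) / (sqrt (1 + (cmod z)\<^sup>2) * sqrt (1 + (cmod w)\<^sup>2))"
proof -
  define s t where "s = 1 + (cmod z)\<^sup>2" and "t = 1 + (cmod w)\<^sup>2"
  have st: "s > 0" "t > 0" by (auto simp: s_def t_def intro: add_pos_nonneg)
  have diff: "sphere_point z - sphere_point w = 2 *\<^sub>R (z / of_real s - w / of_real t, 1 / s - 1 / t)"
    by (simp add: sphere_point_def hat_def s_def t_def algebra_simps)
  have "(cmod (z / of_real s - w / of_real t))\<^sup>2 + (1 / s - 1 / t)\<^sup>2 = (cmod (z - w))\<^sup>2 / (s * t)"
  proof -
    have "z / of_real s - w / of_real t = (of_real t * z - of_real s * w) / of_real (s * t)"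
      using st by (simp add: field_simps)
    then have a: "(cmod (z / of_real s - w / of_real t))\<^sup>2 = (cmod (of_real t * z - of_real s * w))\<^sup>2 / (s * t)\<^sup>2"
      using st by (simp add: norm_divide norm_mult power_divide abs_mult)
    have b: "(1 / s - 1 / t)\<^sup>2 = (t - s)\<^sup>2 / (s * t)\<^sup>2"
      using st by (simp add: divide_simps power_divide[symmetric])
    \<comment> \<open>The distance formula with denominators cleared. It is a polynomial identity,
      but only for the specific values \<open>s = 1 + |z|^2\<close> and
      \<open>t = 1 + |w|^2\<close>.\<close>
    have "(cmod (of_real t * z - of_real s * w))\<^sup>2 + (t - s)\<^sup>2 = (cmod (z - w))\<^sup>2 * (s * t)"
      unfolding s_def t_def cmod_power2 by (simp add: algebra_simps power2_eq_square)
    then show ?thesis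
      unfolding a b add_divide_distrib[symmetric] using st by (simp add: power2_eq_square)
  qed
  then have "norm (sphere_point z - sphere_point w) = 2 * sqrt ((cmod (z - w))\<^sup>2 / (s * t))"
    unfolding diff norm_scaleR unfolding norm_prod_def by simp
  then show ?thesis
    by (simp add: real_sqrt_divide real_sqrt_mult s_def t_def)
qed

lemma inj_sphere_point: "inj sphere_point"
proof (rule injI)
  fix z w assume "sphere_point z = sphere_point w"
  then have "2 * cmod (z - w) / (sqrt (1 + (cmod z)\<^sup>2) * sqrt (1 + (cmod w)\<^sup>2)) = 0"
    unfolding norm_sphere_point_diff[symmetric] by simp
  moreover have "sqrt (1 + (cmod x)\<^sup>2) > 0" for x :: complex
    by (intro real_sqrt_gt_zero add_pos_nonneg) auto
  ultimately show "z = w"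
    by (simp add: less_imp_neq[symmetric])
qed

lemma ln_norm_sphere_point_diff:
  assumes "z \<noteq> w"
  shows "ln (norm (sphere_point z - sphere_point w))
    = ln 2 + ln (cmod (z - w)) - ln (1 + (cmod z)\<^sup>2) / 2 - ln (1 + (cmod w)\<^sup>2) / 2"
proof -
  have pos: "1 + (cmod x)\<^sup>2 > 0" for x :: complex
    by (intro add_pos_nonneg) auto
  then have "1 + (cmod x)\<^sup>2 \<noteq> 0" for x :: complex
    by (metis less_irrefl)
  with pos show ?thesis
    unfolding norm_sphere_point_diff using assms
    by (simp add: ln_div ln_mult ln_sqrt)
qed

text \<open>The energy runs over unordered pairs, whereas the derivative at one root collects all
  the other roots; symmetry converts one sum into the other.\<close>

lemma sum_off_diagonal:
  fixes h :: "nat \<Rightarrow> nat \<Rightarrow> real"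
  assumes sym: "\<And>i j. h i j = h j i"
  shows "(\<Sum>i<n. \<Sum>j\<in>{..<n} - {i}. h i j) = 2 * (\<Sum>i<n. \<Sum>j\<in>{i<..<n}. h i j)"
proof -
  have upper: "(\<Sum>j\<in>{i<..<n}. h i j) = (\<Sum>j<n. if i < j then h i j else 0)" for i
  proof -
    have "{i<..<n} = {j \<in> {..<n}. i < j}" by auto
    then show ?thesis by (simp only: sum.inter_filter finite_lessThan)
  qed
  have "(\<Sum>i<n. \<Sum>j\<in>{..<n} - {i}. h i j)
    = (\<Sum>i<n. (\<Sum>j<n. if i < j then h i j else 0) + (\<Sum>j<n. if j < i then h i j else 0))"
  proof (intro sum.cong refl)
    fix i
    have "{..<n} - {i} = {j \<in> {..<n}. j \<noteq> i}" by auto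
    then have "(\<Sum>j\<in>{..<n} - {i}. h i j) = (\<Sum>j<n. if j \<noteq> i then h i j else 0)"
      by (simp only: sum.inter_filter finite_lessThan)
    also have "\<dots> = (\<Sum>j<n. (if i < j then h i j else 0) + (if j < i then h i j else 0))"
      by (intro sum.cong) auto
    finally show "(\<Sum>j\<in>{..<n} - {i}. h i j)
      = (\<Sum>j<n. if i < j then h i j else 0) + (\<Sum>j<n. if j < i then h i j else 0)"
      by (simp add: sum.distrib)
  qed
  also have "\<dots> = (\<Sum>i<n. \<Sum>j<n. if i < j then h i j else 0) + (\<Sum>j<n. \<Sum>i<n. if j < i then h i j else 0)"
    by (simp add: sum.distrib sum.swap[of "\<lambda>i j. if j < i then h i j else 0"])
  also have "(\<Sum>j<n. \<Sum>i<n. if j < i then h i j else 0) = (\<Sum>i<n. \<Sum>j<n. if i < j then h i j else 0)"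
    by (intro sum.cong) (auto simp: sym)
  finally show ?thesis by (simp add: upper)
qed

lemma sum_mset_nth: "(\<Sum>z\<in>#mset xs. f z) = (\<Sum>i<length xs. f (xs ! i))"
proof -
  have "(\<Sum>z\<in>#mset xs. f z) = sum_list (map f xs)"
    by (metis mset_map sum_mset_sum_list)
  then show ?thesis by (simp add: sum_list_sum_nth atLeast0LessThan)
qed

text \<open>In the product rule every summand but the one at position \<open>i\<close> keeps the
  factor \<open>xs ! i - xs ! i\<close>. Indexing by positions instead of values keeps this valid
  for repeated roots.\<close>

lemma pderiv_at_root:
  fixes p :: "complex poly"
  assumes xs: "mset xs = proots p" and i: "i < length xs"
  shows "poly (pderiv p) (xs ! i) = lead_coeff p * (\<Prod>j\<in>{..<length xs} - {i}. (xs ! i - xs ! j))"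
proof -
  have "p = smult (lead_coeff p) (\<Prod>z\<in>#mset xs. [:- z, 1:])"
    unfolding xs by (rule complex_poly_decompose_multiset[symmetric])
  also have "(\<Prod>z\<in>#mset xs. [:- z, 1:]) = (\<Prod>z\<leftarrow>xs. [:- z, 1:])"
    by (metis mset_map prod_mset_prod_list)
  also have "\<dots> = (\<Prod>j<length xs. [:- (xs ! j), 1:])"
    by (simp add: prod.list_conv_set_nth atLeast0LessThan)
  finally have "pderiv p = smult (lead_coeff p) (pderiv (\<Prod>j<length xs. [:- (xs ! j), 1:]))"
    by (metis pderiv_smult)
  also have "pderiv (\<Prod>j<length xs. [:- (xs ! j), 1:])
    = (\<Sum>k<length xs. (\<Prod>j\<in>{..<length xs} - {k}. [:- (xs ! j), 1:]))"
    by (simp add: pderiv_prod pderiv_pCons)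
  finally have "poly (pderiv p) (xs ! i)
    = lead_coeff p * (\<Sum>k<length xs. (\<Prod>j\<in>{..<length xs} - {k}. (xs ! i - xs ! j)))"
    by (simp add: poly_sum poly_prod)
  also have "(\<Sum>k<length xs. (\<Prod>j\<in>{..<length xs} - {k}. (xs ! i - xs ! j)))
    = (\<Sum>k\<in>{i}. (\<Prod>j\<in>{..<length xs} - {k}. (xs ! i - xs ! j)))"
    using i by (intro sum.mono_neutral_right) (auto intro!: prod_zero)
  finally show ?thesis by simp
qed

lemma log_energy_sphere_points:
  fixes p :: "complex poly"
  assumes xs: "mset xs = proots p" and d: "distinct xs"
  defines "n \<equiv> real (length xs)"
  shows "log_energy (map sphere_point xs) = ereal (n / 2 * ln (cmod (lead_coeff p)) - n * (n - 1) / 2 * ln 2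
    + (\<Sum>z\<in>#proots p. (n - 1) / 2 * ln (1 + (cmod z)\<^sup>2) - ln (cmod (poly (pderiv p) z)) / 2))"
proof -
  let ?n = "length xs"
  define L where "L = (\<lambda>i. ln (1 + (cmod (xs ! i))\<^sup>2))"
  define h where "h = (\<lambda>i j. ln (norm (sphere_point (xs ! i) - sphere_point (xs ! j))))"
  have h_sym: "h i j = h j i" for i j
    by (simp add: h_def norm_minus_commute)
  have row: "(\<Sum>j\<in>{..<?n} - {i}. h i j)
    = (n - 1) * ln 2 + (ln (cmod (poly (pderiv p) (xs ! i))) - ln (cmod (lead_coeff p)))
      - (n - 1) / 2 * L i - ((\<Sum>j<?n. L j) - L i) / 2" if i: "i < ?n" for i
  proof -
    have ne: "xs ! i \<noteq> xs ! j" if "j \<in> {..<?n} - {i}" for j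
      using that i d by (auto simp: nth_eq_iff_index_eq)
    have "p \<noteq> 0" using xs i by auto
    have card: "real (card ({..<?n} - {i})) = n - 1"
      using i by (simp add: n_def of_nat_diff)
    have "(\<Sum>j\<in>{..<?n} - {i}. h i j)
      = (\<Sum>j\<in>{..<?n} - {i}. ln 2 + ln (cmod (xs ! i - xs ! j)) - L i / 2 - L j / 2)"
      using ne by (intro sum.cong) (auto simp: h_def L_def ln_norm_sphere_point_diff)
    also have "\<dots> = (n - 1) * ln 2 + (\<Sum>j\<in>{..<?n} - {i}. ln (cmod (xs ! i - xs ! j)))
        - (n - 1) * (L i / 2) - (\<Sum>j\<in>{..<?n} - {i}. L j) / 2"
      by (simp add: sum.distrib sum_subtractf card sum_divide_distrib del: card_Diff_insert)
    also have "(\<Sum>j\<in>{..<?n} - {i}. ln (cmod (xs ! i - xs ! j))) = ln (\<Prod>j\<in>{..<?n} - {i}. cmod (xs ! i - xs ! j))"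
      using ne by (intro ln_prod[symmetric]) auto
    also have "\<dots> = ln (cmod (poly (pderiv p) (xs ! i))) - ln (cmod (lead_coeff p))"
    proof -
      have "(\<Prod>j\<in>{..<?n} - {i}. cmod (xs ! i - xs ! j)) \<noteq> 0" using ne by auto
      then have "(\<Prod>j\<in>{..<?n} - {i}. cmod (xs ! i - xs ! j)) > 0"
        by (simp add: prod_pos order.not_eq_order_implies_strict prod_nonneg)
      then show ?thesis
        using \<open>p \<noteq> 0\<close> by (simp add: pderiv_at_root[OF xs i] norm_mult prod_norm ln_mult)
    qed
    also have "(\<Sum>j\<in>{..<?n} - {i}. L j) = (\<Sum>j<?n. L j) - L i"
      using i by (simp add: sum_diff1)
    finally show ?thesis by simp
  qed
  have "distinct (map sphere_point xs)"
    using d inj_on_subset[OF inj_sphere_point subset_UNIV] by (simp add: distinct_map)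
  then have "log_energy (map sphere_point xs) = ereal (- (\<Sum>i<?n. \<Sum>j\<in>{i<..<?n}. h i j))"
    unfolding log_energy_def by (simp add: h_def)
  also have "(\<Sum>i<?n. \<Sum>j\<in>{i<..<?n}. h i j) = (\<Sum>i<?n. \<Sum>j\<in>{..<?n} - {i}. h i j) / 2"
    by (simp add: sum_off_diagonal h_sym)
  also have "(\<Sum>i<?n. \<Sum>j\<in>{..<?n} - {i}. h i j)
    = (\<Sum>i<?n. (n - 1) * ln 2 + (ln (cmod (poly (pderiv p) (xs ! i))) - ln (cmod (lead_coeff p)))
      - (n - 1) / 2 * L i - ((\<Sum>j<?n. L j) - L i) / 2)"
    by (intro sum.cong) (auto simp: row)
  \<comment> \<open>The factor \<open>L\<close> of a point enters with weight \<open>1/2\<close> in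
    the \<open>n - 1\<close> terms of its own row and once in each of the \<open>n - 1\<close> other
    rows, hence with total weight \<open>n - 1\<close>; halving the sum over ordered pairs leaves
    \<open>(n - 1) / 2\<close>.\<close>
  also have "\<dots> = n * ((n - 1) * ln 2) + ((\<Sum>i<?n. ln (cmod (poly (pderiv p) (xs ! i)))) - n * ln (cmod (lead_coeff p)))
      - (n - 1) / 2 * (\<Sum>i<?n. L i) - (n * (\<Sum>j<?n. L j) - (\<Sum>i<?n. L i)) / 2"
    by (simp add: sum.distrib sum_subtractf n_def sum_divide_distrib[symmetric] sum_distrib_left[symmetric])
  finally have main: "log_energy (map sphere_point xs) = ereal (- ((n * ((n - 1) * ln 2)
      + ((\<Sum>i<?n. ln (cmod (poly (pderiv p) (xs ! i)))) - n * ln (cmod (lead_coeff p)))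
      - (n - 1) / 2 * (\<Sum>i<?n. L i) - (n * (\<Sum>j<?n. L j) - (\<Sum>i<?n. L i)) / 2) / 2))" .
  have "(\<Sum>z\<in>#proots p. (n - 1) / 2 * ln (1 + (cmod z)\<^sup>2) - ln (cmod (poly (pderiv p) z)) / 2)
    = (n - 1) / 2 * (\<Sum>i<?n. L i) - (\<Sum>i<?n. ln (cmod (poly (pderiv p) (xs ! i)))) / 2"
    unfolding xs[symmetric] sum_mset_nth L_def
    by (simp add: sum_subtractf sum_divide_distrib[symmetric] sum_distrib_left[symmetric])
  then show ?thesis
    unfolding main by (simp add: field_simps)
qed

text \<open>Restates the case distinction in \<open>log_energy\<close> as a condition on
  \<open>f'\<close> at the roots, which root sums can detect and the Kac-Rice formula can show to
  hold almost surely.\<close>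

lemma distinct_roots_iff:
  fixes p :: "complex poly"
  assumes xs: "mset xs = proots p"
  shows "distinct xs \<longleftrightarrow> (\<forall>z\<in>#proots p. poly (pderiv p) z \<noteq> 0)"
proof (cases "p = 0")
  case True
  then show ?thesis using xs by simp
next
  case False
  have *: "poly (pderiv p) (xs ! i) \<noteq> 0 \<longleftrightarrow> (\<forall>j<length xs. j \<noteq> i \<longrightarrow> xs ! i \<noteq> xs ! j)" if "i < length xs" for i
    using False by (auto simp: pderiv_at_root[OF xs that])
  have "(\<forall>z\<in>#proots p. poly (pderiv p) z \<noteq> 0) \<longleftrightarrow> (\<forall>i<length xs. poly (pderiv p) (xs ! i) \<noteq> 0)"
    unfolding xs[symmetric] by (simp add: all_set_conv_all_nth)
  then show ?thesis
    using * by (auto simp: distinct_conv_nth)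
qed

text \<open>Eliminates the arbitrary listing of the roots. The formula is needed for every
  coefficient vector in order to obtain measurability everywhere, so the actual degree appears in it
  in place of \<open>N\<close>.\<close>

lemma log_energy_root_points:
  fixes N a
  defines "p \<equiv> rand_poly N a"
  shows "log_energy (root_points N a) = (if \<forall>z\<in>#proots p. poly (pderiv p) z \<noteq> 0
    then ereal (real (degree p) / 2 * ln (cmod (lead_coeff p)) - real (degree p) * (real (degree p) - 1) / 2 * ln 2
      + (\<Sum>z\<in>#proots p. (real (degree p) - 1) / 2 * ln (1 + (cmod z)\<^sup>2) - ln (cmod (poly (pderiv p) z)) / 2))
    else \<infinity>)"
proof -
  define xs where "xs = (SOME xs. mset xs = proots p)"
  have xs: "mset xs = proots p"
    unfolding xs_def by (rule someI_ex) (rule ex_mset)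
  have rp: "root_points N a = map sphere_point xs"
    by (simp add: root_points_def xs_def p_def)
  have len: "length xs = degree p"
    using xs by (metis size_mset size_proots_complex)
  show ?thesis
  proof (cases "distinct xs")
    case True
    then show ?thesis
      using distinct_roots_iff[OF xs] by (simp add: rp log_energy_sphere_points[OF xs True] len)
  next
    case False
    then have "\<not> distinct (map sphere_point xs)" by (simp add: distinct_map)
    then show ?thesis
      using False distinct_roots_iff[OF xs] by (simp add: rp log_energy_def)
  qed
qed

section \<open>Measurability of the energy and almost sure simplicity of the roots\<close>

lemma degree_rand_poly_le: "degree (rand_poly N a) \<le> N"
  by (rule degree_le) (simp add: coeff_rand_poly)

lemma measurable_degree_rand_poly:
  "(\<lambda>a. real (degree (rand_poly N a))) \<in> borel_measurable (coeff_space N)"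
proof -
  have "(\<lambda>a. enn2real (ennreal (real (size (proots (rand_poly N a)))))) \<in> borel_measurable (coeff_space N)"
    using measurable_root_count[of N] by measurable
  then show ?thesis by (simp add: size_proots_complex)
qed

lemma measurable_lead_coeff_rand_poly:
  "(\<lambda>a. lead_coeff (rand_poly N a)) \<in> borel_measurable (coeff_space N)"
proof -
  have eq: "lead_coeff (rand_poly N a) = (\<Sum>k\<le>N. if real (degree (rand_poly N a)) = real k then a k else 0)" for a
    using degree_rand_poly_le[of N a] by (simp add: coeff_rand_poly)
  have "(\<lambda>a. if real (degree (rand_poly N a)) = real k then a k else 0) \<in> borel_measurable (coeff_space N)"
    if "k \<le> N" for k
  proof -
    note [measurable] = measurable_degree_rand_poly[of N] measurable_coeff_component[OF that]
    show ?thesis by measurable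
  qed
  then show ?thesis
    unfolding eq by (intro borel_measurable_sum) simp
qed

lemma measurable_sum_roots_pderiv:
  fixes \<phi> :: "complex \<Rightarrow> complex \<Rightarrow> real"
  assumes \<phi>: "(\<lambda>(z, w). \<phi> z w) \<in> borel_measurable (borel \<Otimes>\<^sub>M borel)"
  shows "(\<lambda>a. \<Sum>z\<in>#proots (rand_poly N a). \<phi> z (poly (pderiv (rand_poly N a)) z)) \<in> borel_measurable (coeff_space N)"
proof -
  have "(\<lambda>x. (snd x, poly (pderiv (rand_poly N (fst x))) (snd x))) \<in> coeff_space N \<Otimes>\<^sub>M borel \<rightarrow>\<^sub>M borel \<Otimes>\<^sub>M borel"
    using measurable_poly_pderiv_rand_poly[of N] by (intro measurable_Pair) (auto simp: split_beta')
  from measurable_compose[OF this \<phi>]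
  have "(\<lambda>(a, z). \<phi> z (poly (pderiv (rand_poly N a)) z)) \<in> borel_measurable (coeff_space N \<Otimes>\<^sub>M borel)"
    by (simp add: split_beta')
  then show ?thesis by (rule measurable_sum_roots_real(2))
qed

lemma measurable_log_energy_root_points:
  "(\<lambda>a. real_of_ereal (log_energy (root_points N a))) \<in> borel_measurable (coeff_space N)"
proof -
  let ?p = "rand_poly N"
  let ?d = "\<lambda>a. real (degree (?p a))"
  let ?bad = "\<lambda>a. \<Sum>z\<in>#proots (?p a). if poly (pderiv (?p a)) z = 0 then 1 else 0 :: real"
  let ?A = "\<lambda>a. \<Sum>z\<in>#proots (?p a). ln (1 + (cmod z)\<^sup>2)"
  let ?B = "\<lambda>a. \<Sum>z\<in>#proots (?p a). ln (cmod (poly (pderiv (?p a)) z))"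
  have bad: "?bad a = 0 \<longleftrightarrow> (\<forall>z\<in>#proots (?p a). poly (pderiv (?p a)) z \<noteq> 0)" for a
  proof -
    have *: "(\<Sum>z\<in>#M. if P z then 1 else 0 :: real) = real (size (filter_mset P M))" for M and P :: "complex \<Rightarrow> bool"
      by (induction M) auto
    have "filter_mset P M = {#} \<longleftrightarrow> (\<forall>z\<in>#M. \<not> P z)" for M and P :: "complex \<Rightarrow> bool"
      by (induction M) auto
    then show ?thesis unfolding * by simp
  qed
  have lin: "(\<Sum>z\<in>#M. c * f z - g z / 2) = c * (\<Sum>z\<in>#M. f z) - (\<Sum>z\<in>#M. g z) / 2"
    for M and c :: real and f g :: "complex \<Rightarrow> real"
    by (induction M) (auto simp: algebra_simps add_divide_distrib)
  \<comment> \<open>\<open>?bad\<close> counts the roots at which \<open>f'\<close> vanishes. The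
    value \<open>0\<close> in the other branch is \<open>real_of_ereal\<close> of infinity.\<close>
  have eq: "real_of_ereal (log_energy (root_points N a)) = (if ?bad a = 0
    then ?d a / 2 * ln (cmod (lead_coeff (?p a))) - ?d a * (?d a - 1) / 2 * ln 2 + ((?d a - 1) / 2 * ?A a - ?B a / 2) else 0)" for a
    unfolding log_energy_root_points bad lin by simp
  have [measurable]: "?bad \<in> borel_measurable (coeff_space N)"
    by (rule measurable_sum_roots_pderiv[where \<phi> = "\<lambda>z w. if w = 0 then 1 else 0"]) measurable
  have [measurable]: "?A \<in> borel_measurable (coeff_space N)"
    by (rule measurable_sum_roots_pderiv[where \<phi> = "\<lambda>z w. ln (1 + (cmod z)\<^sup>2)"]) measurable
  have [measurable]: "?B \<in> borel_measurable (coeff_space N)"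
    by (rule measurable_sum_roots_pderiv[where \<phi> = "\<lambda>z w. ln (cmod w)"]) measurable
  note [measurable] = measurable_degree_rand_poly[of N] measurable_lead_coeff_rand_poly[of N]
  show ?thesis unfolding eq by measurable
qed

text \<open>The expected number of roots with \<open>f'(z) = 0\<close>, counted with multiplicity,
  is computed by the Kac-Rice formula and is \<open>0\<close>, since the size bias
  \<open>|u|^2\<close> vanishes exactly where the slope does.\<close>

lemma AE_simple_roots:
  assumes N: "N \<ge> 1"
  shows "AE a in coeff_measure N. \<forall>z\<in>#proots (rand_poly N a). poly (pderiv (rand_poly N a)) z \<noteq> 0"
proof -
  let ?S = "\<lambda>a. \<Sum>z\<in>#proots (rand_poly N a). indicator {0} (poly (pderiv (rand_poly N a)) z) :: ennreal"
  have "root_slope N z > 0" for z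
  proof -
    have "1 + (cmod z)\<^sup>2 > 0" by (intro add_pos_nonneg) auto
    then show ?thesis unfolding root_slope_def using N by (intro divide_pos_pos real_sqrt_gt_zero mult_pos_pos) auto
  qed
  then have "of_real (root_slope N z) * u = (0::complex) \<longleftrightarrow> u = 0" for z u
    by (metis less_irrefl mult_eq_0_iff of_real_eq_0_iff)
  then have zero: "ennreal ((cmod u)\<^sup>2) * indicator {0} (of_real (root_slope N z) * u) = (0 :: ennreal)" for z u
    by (simp add: indicator_def)
  have "(\<integral>\<^sup>+a. ?S a \<partial>coeff_measure N) = 0"
    by (subst kac_rice[OF N]) (auto simp: zero)
  moreover have "?S \<in> borel_measurable (coeff_measure N)"
  proof -
    have "(\<lambda>(a, z). indicator {0} (poly (pderiv (rand_poly N a)) z) :: ennreal) \<in> borel_measurable (coeff_space N \<Otimes>\<^sub>M borel)"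
      using measurable_compose[OF measurable_poly_pderiv_rand_poly[of N], of "indicator {0} :: complex \<Rightarrow> ennreal" borel]
      by (simp add: split_beta')
    from measurable_sum_roots[OF this] show ?thesis by (simp cong: measurable_cong_sets)
  qed
  ultimately have "AE a in coeff_measure N. ?S a = 0"
    by (simp add: nn_integral_0_iff_AE)
  then show ?thesis
    by (rule eventually_mono) (auto simp: indicator_def split: if_splits)
qed

lemma distr_coeff_measure:
  assumes "k \<le> N"
  shows "distr (coeff_measure N) borel (\<lambda>a. a k) = complex_gaussian (real (N choose k))"
proof -
  have "distr (coeff_measure N) borel (\<lambda>a. a k) = distr (coeff_measure N) (complex_gaussian (real (N choose k))) (\<lambda>a. a k)"
    by (intro distr_cong) auto
  also have "\<dots> = complex_gaussian (real (N choose k))"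
    unfolding coeff_measure_def using assms
    by (intro distr_PiM_component prob_space_complex_gaussian) auto
  finally show ?thesis .
qed

text \<open>Since \<open>N choose N = 1\<close>, the top coefficient has the law of
  \<open>sqrt 2 * u\<close> with \<open>E |u|^2 = 1\<close>; the term \<open>ln 2 / 2\<close> is the
  logarithm of this factor.\<close>

lemma ln_lead_coeff:
  shows "integrable (coeff_measure N) (\<lambda>a. ln (cmod (a N)))"
    and "(\<integral>a. ln (cmod (a N)) \<partial>coeff_measure N) = ln 2 / 2 + (\<integral>u. ln (cmod u) \<partial>complex_gaussian (1/2))"
proof -
  let ?H = "complex_gaussian (1/2)"
  interpret H: prob_space ?H by (rule prob_space_complex_gaussian) simp
  have G: "complex_gaussian 1 = distr ?H borel (\<lambda>u. of_real (sqrt 2) * u)"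
  proof (rule measure_eqI)
    fix A assume "A \<in> sets (complex_gaussian 1)"
    then have [measurable]: "A \<in> sets borel" by simp
    have "emeasure (complex_gaussian 1) A = (\<integral>\<^sup>+y. indicator A y \<partial>complex_gaussian 1)"
      by simp
    also have "\<dots> = (\<integral>\<^sup>+u. indicator A (of_real (sqrt 2) * u) \<partial>?H)"
      using nn_integral_complex_gaussian_scale[of "of_real (sqrt 2)" "1/2" "indicator A"] by simp
    also have "\<dots> = (\<integral>\<^sup>+y. indicator A y \<partial>distr ?H borel (\<lambda>u. of_real (sqrt 2) * u))"
      by (subst nn_integral_distr) auto
    finally show "emeasure (complex_gaussian 1) A = emeasure (distr ?H borel (\<lambda>u. of_real (sqrt 2) * u)) A"
      by simp
  qed simp
  have D: "distr (coeff_measure N) borel (\<lambda>a. a N) = distr ?H borel (\<lambda>u. of_real (sqrt 2) * u)"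
    using distr_coeff_measure[of N N] G by simp
  have mN: "(\<lambda>a. a N) \<in> borel_measurable (coeff_measure N)"
    using measurable_coeff_component[of N N] by (simp cong: measurable_cong_sets)
  \<comment> \<open>Only almost everywhere: at \<open>u = 0\<close> the convention
    \<open>ln 0 = 0\<close> breaks the product rule for the logarithm.\<close>
  have AE: "AE u in ?H. ln (cmod (of_real (sqrt 2) * u)) = ln 2 / 2 + ln (cmod u)"
    using AE_complex_gaussian_not_in_finite[of "1/2" "{0}"]
    by (auto elim!: eventually_mono simp: norm_mult ln_mult ln_sqrt)
  have i: "integrable ?H (\<lambda>u. ln (cmod (of_real (sqrt 2) * u)))"
    using complex_gaussian_ln(1) AE by (subst integrable_cong_AE[OF _ _ AE]) auto
  have scale: "(\<lambda>u. of_real (sqrt 2) * u :: complex) \<in> borel_measurable ?H"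
    by measurable
  have "integrable (distr ?H borel (\<lambda>u. of_real (sqrt 2) * u)) (\<lambda>y. ln (cmod y))"
    using i integrable_distr_eq[OF scale, of "\<lambda>y. ln (cmod y)"] by simp
  then show "integrable (coeff_measure N) (\<lambda>a. ln (cmod (a N)))"
    unfolding D[symmetric] using integrable_distr_eq[OF mN, of "\<lambda>y. ln (cmod y)"] by simp
  have "(\<integral>a. ln (cmod (a N)) \<partial>coeff_measure N) = (\<integral>y. ln (cmod y) \<partial>distr (coeff_measure N) borel (\<lambda>a. a N))"
    by (subst integral_distr[OF mN]) auto
  also have "\<dots> = (\<integral>u. ln (cmod (of_real (sqrt 2) * u)) \<partial>?H)"
    unfolding D by (subst integral_distr[OF scale]) auto
  also have "\<dots> = (\<integral>u. ln 2 / 2 + ln (cmod u) \<partial>?H)"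
    by (rule integral_cong_AE[OF _ _ AE]) auto
  also have "\<dots> = ln 2 / 2 + (\<integral>u. ln (cmod u) \<partial>?H)"
    using complex_gaussian_ln(1) H.prob_space by simp
  finally show "(\<integral>a. ln (cmod (a N)) \<partial>coeff_measure N) = ln 2 / 2 + (\<integral>u. ln (cmod u) \<partial>?H)" .
qed

lemma (in pair_sigma_finite) integral_pair_mult:
  fixes f g :: "_ \<Rightarrow> real"
  assumes f: "integrable M1 f" and g: "integrable M2 g"
  shows "integrable (M1 \<Otimes>\<^sub>M M2) (\<lambda>(x, y). f x * g y)"
    and "(\<integral>(x, y). f x * g y \<partial>(M1 \<Otimes>\<^sub>M M2)) = (\<integral>x. f x \<partial>M1) * (\<integral>y. g y \<partial>M2)"
proof -
  have [measurable]: "f \<in> borel_measurable M1" "g \<in> borel_measurable M2" using f g by auto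
  show i: "integrable (M1 \<Otimes>\<^sub>M M2) (\<lambda>(x, y). f x * g y)"
  proof (rule Fubini_integrable)
    show "integrable M1 (\<lambda>x. \<integral>y. norm (case (x, y) of (x, y) \<Rightarrow> f x * g y) \<partial>M2)"
      using f by (simp add: abs_mult)
    show "AE x in M1. integrable M2 (\<lambda>y. case (x, y) of (x, y) \<Rightarrow> f x * g y)"
      using g by simp
  qed measurable
  show "(\<integral>(x, y). f x * g y \<partial>(M1 \<Otimes>\<^sub>M M2)) = (\<integral>x. f x \<partial>M1) * (\<integral>y. g y \<partial>M2)"
    using integral_fst'[OF i] by simp
qed

text \<open>The logarithm of the slope splits into a function of \<open>z\<close> and
  \<open>ln |u|\<close>, so the integrand is a combination of products of a function of
  \<open>z\<close> with one of \<open>u\<close>. Their means are known: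
  \<open>ln (1 + |z|^2)\<close> and \<open>|u|^2\<close> both have mean \<open>1\<close>, and the
  size-biased logarithm exceeds the plain one by \<open>1/2\<close>.\<close>

lemma energy_density_integral:
  fixes N :: nat
  defines "\<phi> \<equiv> \<lambda>z w. (real N - 1) / 2 * ln (1 + (cmod z)\<^sup>2) - ln (cmod w) / 2"
  assumes N: "N \<ge> 1"
  shows "integrable (sphere_measure \<Otimes>\<^sub>M complex_gaussian (1/2))
      (\<lambda>(z, u). (cmod u)\<^sup>2 * \<phi> z (of_real (root_slope N z) * u))" (is ?I)
    and "(\<integral>(z, u). (cmod u)\<^sup>2 * \<phi> z (of_real (root_slope N z) * u) \<partial>(sphere_measure \<Otimes>\<^sub>M complex_gaussian (1/2)))
      = real N / 4 - (ln 2 + ln (real N)) / 4 - ((\<integral>u. ln (cmod u) \<partial>complex_gaussian (1/2)) + 1/2) / 2" (is ?E)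
proof -
  let ?H = "complex_gaussian (1/2)"
  interpret H: prob_space ?H by (rule prob_space_complex_gaussian) simp
  interpret S: prob_space sphere_measure by (rule prob_space_sphere_measure)
  interpret pair_sigma_finite sphere_measure ?H ..
  define L where "L = (\<lambda>z. ln (1 + (cmod z)\<^sup>2))"
  \<comment> \<open>With \<open>L = ln (1 + |z|^2)\<close>, the logarithm of
    \<open>root_slope\<close> is \<open>(ln 2 + ln N + N * L) / 2 - L\<close>. Half of it is
    subtracted from \<open>(N - 1) / 2 * L\<close>, so the coefficient of \<open>L\<close> is
    \<open>(N - 1) / 2 - N / 4 + 1 / 2 = N / 4\<close>.\<close>
  have eq: "(\<lambda>(z, u). (cmod u)\<^sup>2 * \<phi> z (of_real (root_slope N z) * u))
    = (\<lambda>x. real N / 4 * (case x of (z, u) \<Rightarrow> L z * (cmod u)\<^sup>2)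
        + (- (ln 2 + ln (real N)) / 4) * (case x of (z, u) \<Rightarrow> 1 * (cmod u)\<^sup>2)
        + (- 1/2) * (case x of (z, u) \<Rightarrow> 1 * ((cmod u)\<^sup>2 * ln (cmod u))))"
  proof (intro ext, clarify)
    fix z u
    show "(cmod u)\<^sup>2 * \<phi> z (of_real (root_slope N z) * u)
      = real N / 4 * (L z * (cmod u)\<^sup>2) + (- (ln 2 + ln (real N)) / 4) * (1 * (cmod u)\<^sup>2)
        + (- 1/2) * (1 * ((cmod u)\<^sup>2 * ln (cmod u)))"
    proof (cases "u = 0")
      case False
      have t: "1 + (cmod z)\<^sup>2 > 0" by (intro add_pos_nonneg) auto
      have R: "root_slope N z > 0"
        unfolding root_slope_def using N t by (intro divide_pos_pos real_sqrt_gt_zero mult_pos_pos) auto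
      have "ln (root_slope N z) = (ln 2 + ln (real N) + real N * L z) / 2 - L z"
        unfolding root_slope_def L_def using N t
        by (subst ln_div) (auto simp: ln_sqrt ln_mult ln_realpow intro!: mult_pos_pos)
      then have lnr: "ln (cmod (of_real (root_slope N z) * u)) = (ln 2 + ln (real N) + real N * L z) / 2 - L z + ln (cmod u)"
        using R False by (simp add: norm_mult ln_mult)
      have Lz: "ln (1 + (cmod z)\<^sup>2) = L z" by (simp add: L_def)
      show ?thesis
        unfolding \<phi>_def Lz lnr by (simp add: field_simps)
    qed simp
  qed
  have sq: "integrable ?H (\<lambda>u. (cmod u)\<^sup>2)" "(\<integral>u. (cmod u)\<^sup>2 \<partial>?H) = 1"
    using nn_integral_complex_gaussian_power2
    by (auto intro!: integrableI_nonneg simp: integral_eq_nn_integral)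
  have L: "integrable sphere_measure L" "(\<integral>z. L z \<partial>sphere_measure) = 1"
    unfolding L_def by (rule sphere_measure_ln)+
  have one: "integrable sphere_measure (\<lambda>_. 1 :: real)" by simp
  note A = integral_pair_mult[OF L(1) sq(1)] and B = integral_pair_mult[OF one sq(1)]
    and C = integral_pair_mult[OF one complex_gaussian_ln(2)]
  show ?I
    unfolding eq
    by (intro Bochner_Integration.integrable_add integrable_mult_right A B C)
  show ?E
    unfolding eq
    by (subst Bochner_Integration.integral_add Bochner_Integration.integral_add integral_mult_right_zero,
        (intro Bochner_Integration.integrable_add integrable_mult_right A B C)+)+
      (simp only: integral_mult_right_zero A B C L sq complex_gaussian_ln(3), simp add: S.prob_space[simplified] field_simps)
qed

theorem theorem3:
  fixes N :: nat
  assumes "N \<ge> 2"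
  shows "(AE a in coeff_measure N. log_energy (root_points N a) < \<infinity>)
    \<and> integrable (coeff_measure N) (\<lambda>a. real_of_ereal (log_energy (root_points N a)))
    \<and> (\<integral>a. real_of_ereal (log_energy (root_points N a)) \<partial>coeff_measure N)
        = - ((real N)\<^sup>2 / 4) * ln (4 / exp 1) - real N * ln (real N) / 4 + real N / 4 * ln (4 / exp 1)"
proof -
  have N: "N \<ge> 1" using assms by simp
  interpret C: prob_space "coeff_measure N"
    unfolding coeff_measure_def by (intro prob_space_PiM prob_space_complex_gaussian) auto
  define \<phi> where "\<phi> = (\<lambda>z w. (real N - 1) / 2 * ln (1 + (cmod z)\<^sup>2) - ln (cmod w) / 2)"
  define R where "R = (\<lambda>a. \<Sum>z\<in>#proots (rand_poly N a). \<phi> z (poly (pderiv (rand_poly N a)) z))"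
  define c where "c = (\<integral>u. ln (cmod u) \<partial>complex_gaussian (1/2))"
  have \<phi>: "(\<lambda>(z, w). \<phi> z w) \<in> borel_measurable (borel \<Otimes>\<^sub>M borel)"
    unfolding \<phi>_def by measurable
  have R: "integrable (coeff_measure N) R"
    "(\<integral>a. R a \<partial>coeff_measure N) = real N * (real N / 4 - (ln 2 + ln (real N)) / 4 - (c + 1/2) / 2)"
    unfolding R_def using kac_rice_real[OF N \<phi>] energy_density_integral[OF N]
    by (simp_all add: \<phi>_def c_def)
  let ?V = "\<lambda>a. real N / 2 * ln (cmod (a N)) - real N * (real N - 1) / 2 * ln 2 + R a"
  have nz: "AE a in coeff_measure N. a N \<notin> {0}"
    unfolding coeff_measure_def
    by (intro AE_PiM_component prob_space_complex_gaussian AE_complex_gaussian_not_in_finite) auto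
  have AE: "AE a in coeff_measure N. log_energy (root_points N a) = ereal (?V a)"
    using AE_simple_roots[OF N] nz
  proof eventually_elim
    case (elim a)
    have "coeff (rand_poly N a) N \<noteq> 0" using elim by (simp add: coeff_rand_poly)
    then have deg: "degree (rand_poly N a) = N"
      using degree_rand_poly_le[of N a] le_degree[of "rand_poly N a" N] by linarith
    show ?case
      using elim(1) by (simp add: log_energy_root_points deg coeff_rand_poly R_def \<phi>_def)
  qed
  have meas: "(\<lambda>a. real_of_ereal (log_energy (root_points N a))) \<in> borel_measurable (coeff_measure N)"
    using measurable_log_energy_root_points[of N] by (simp cong: measurable_cong_sets)
  have V: "integrable (coeff_measure N) ?V"
    using R(1) ln_lead_coeff(1)[of N] by simp
  have AE': "AE a in coeff_measure N. real_of_ereal (log_energy (root_points N a)) = ?V a"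
    using AE by (rule eventually_mono) simp
  have int: "integrable (coeff_measure N) (\<lambda>a. real_of_ereal (log_energy (root_points N a)))"
    using V by (subst integrable_cong_AE[OF meas _ AE']) auto
  have "(\<integral>a. real_of_ereal (log_energy (root_points N a)) \<partial>coeff_measure N) = (\<integral>a. ?V a \<partial>coeff_measure N)"
    using V by (intro integral_cong_AE meas AE') auto
  also have "\<dots> = real N / 2 * (ln 2 / 2 + c) - real N * (real N - 1) / 2 * ln 2
      + real N * (real N / 4 - (ln 2 + ln (real N)) / 4 - (c + 1/2) / 2)"
    using R ln_lead_coeff[of N] by (simp add: C.prob_space c_def)
  \<comment> \<open>The term \<open>N * c / 2\<close> from the leading coefficient cancels against
    \<open>N\<close> roots contributing \<open>- c / 2\<close> each, and the two terms
    \<open>N * ln 2 / 4\<close> caused by the variance convention cancel as well. Apart from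
    \<open>- N * ln N / 4\<close>, what is left is \<open>(N - N^2) / 4\<close> times
    \<open>2 * ln 2 - 1 = ln (4 / e)\<close>.\<close>
  also have "\<dots> = - ((real N)\<^sup>2 / 4) * ln (4 / exp 1) - real N * ln (real N) / 4 + real N / 4 * ln (4 / exp 1)"
  proof -
    have e: "ln (4 / exp 1) = 2 * ln 2 - (1 :: real)"
      using ln_realpow[of 2 2] by (simp add: ln_div)
    show ?thesis
      unfolding e by (simp add: field_simps power2_eq_square)
  qed
  finally have val: "(\<integral>a. real_of_ereal (log_energy (root_points N a)) \<partial>coeff_measure N)
      = - ((real N)\<^sup>2 / 4) * ln (4 / exp 1) - real N * ln (real N) / 4 + real N / 4 * ln (4 / exp 1)" .
  have "AE a in coeff_measure N. log_energy (root_points N a) < \<infinity>"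
    using AE by (rule eventually_mono) simp
  with int val show ?thesis by blast
qed

end
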